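(* Let $\varepsilon_0>0$ be fixed. Let $x\ge y\ge 2$ and write $x=y^u$. Then for $y$ large enough and $(\log\log y)^2\le u\le y^{1/(2+\varepsilon_0)}/\log y$, one has $$\Psi_G(x,y)=\frac{4x^{\alpha_G}H(\alpha_G,G;y)}{\alpha_G\sqrt{2\pi\,\phi_2(\alpha_G,G;y)}}\Big(1+O\big(\tfrac1u\big)\Big),$$ where $\alpha_G=\alpha_G(x,y)$. (Here $\varepsilon_0$ is fixed, so "large enough" and the implied constant may depend on $\varepsilon_0$.)
   Context: For $n\ge1$, $r(n)$ is the number of $(a,b)\in\mathbb Z^2$ with $a^2+b^2=n$ (signs and order counted). $P(n)$ denotes the largest prime factor of $n$, with $P(1)\le y$ for all $y$ by convention. For $x\ge y\ge 2$, $\Psi_G(x,y)=\sum_{1\le n\le x,\ P(n)\le y} r(n)$. The letter $G$ in the notation is only a label. $H(s,G;y)=\sum_{n\ge1,\ P(n)\le y}\frac{r(n)/4}{n^s}=\prod_{p\le y}(1-p^{-s})^{-1}(1-\chi_4(p)p^{-s})^{-1}$ (for $\Re s>0$), where $p$ runs over primes and $\chi_4$ is the primitive Dirichlet character modulo $4$. $\phi(s,G;y)=\log H(s,G;y)$ and $\phi_k(s,G;y)$ is its $k$-th derivative with respect to $s$. The saddle point $\alpha_G=\alpha_G(x,y)>0$ is the unique positive real solution of $\log x+\phi_1(\alpha_G,G;y)=0$; equivalently the unique point at which $\sigma\mapsto x^\sigma H(\sigma,G;y)$, $\sigma>0$, attains its minimum. *)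

theory Defs
  imports "HOL-Analysis.Analysis" "HOL-Computational_Algebra.Computational_Algebra"
begin

definition r2 :: "nat \<Rightarrow> nat" where
  "r2 n = card {(a :: int, b :: int). a\<^sup>2 + b\<^sup>2 = int n}"

(* The value 1 at n = 1 (no prime factors) realises the convention P(1) <= y for all y >= 2. *)
definition largest_prime_factor :: "nat \<Rightarrow> nat" where
  "largest_prime_factor n =
     (if prime_factors n = {} then 1 else Max (prime_factors n))"

definition Psi_G :: "real \<Rightarrow> real \<Rightarrow> real" where
  "Psi_G x y =
     (\<Sum>n | 1 \<le> n \<and> real n \<le> x \<and> real (largest_prime_factor n) \<le> y. real (r2 n))"

(* Only real s > 0 is meaningful: there the nonnegative series converges.  The saddle point and
   the main term involve H, its logarithm and the derivatives only at real points. *)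
definition H_G :: "real \<Rightarrow> real \<Rightarrow> real" where
  "H_G s y =
     (\<Sum>\<^sub>\<infinity>n\<in>{n :: nat. 1 \<le> n \<and> real (largest_prime_factor n) \<le> y}.
        (real (r2 n) / 4) / real n powr s)"

definition phi_G :: "real \<Rightarrow> real \<Rightarrow> real" where
  "phi_G s y = ln (H_G s y)"

definition phi_G_deriv :: "nat \<Rightarrow> real \<Rightarrow> real \<Rightarrow> real" where
  "phi_G_deriv k s y = (deriv ^^ k) (\<lambda>t. phi_G t y) s"

definition alpha_G :: "real \<Rightarrow> real \<Rightarrow> real" where
  "alpha_G x y = (THE a. a > 0 \<and> ln x + phi_G_deriv 1 a y = 0)"

end

theory Submission
  imports Defs "HOL-Number_Theory.Number_Theory" "HOL-Probability.Probability" "HOL-Real_Asymp.Real_Asymp"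
begin

text \<open>
  Give a smooth number \<open>n\<close> the weight \<open>r2 n / (4 n\<^sup>a H(a))\<close> with \<open>a = \<alpha>\<^sub>G\<close>. Under this probability law
  \<open>Z = ln n - ln x\<close> is centred, \<open>\<Psi>\<^sub>G(x,y) = 4 x\<^sup>a H(a) E[exp (a Z); Z \<le> 0]\<close>, and by the Euler product
  \<open>Z\<close> is compound Poisson, with cumulants \<open>\<kappa>\<^sub>j\<close> of size at most \<open>u (ln y)\<^sup>j\<close>, sharp for \<open>j = 2\<close>. Expanding its
  characteristic function for \<open>t\<close> of order at most \<open>1 / ln y\<close> gives the main term with relative error
  \<open>1/u\<close>, and smoothing \<open>Z\<close> by a Gaussian of width \<open>1/u\<close> makes frequencies beyond \<open>u\<close> to the power
  \<open>3/2\<close> irrelevant. In between, the characteristic function is small because \<open>p\<close> to the power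
  \<open>i t\<close> is close to 1 only when \<open>ln p\<close> lies in certain short intervals, and these contain few primes:
  the primes in \<open>(N, N + L]\<close> divide \<open>binomial (N + L) L\<close>. The only arithmetic input about primes
  modulo 4 is Mertens' theorem for the weights \<open>1 + \<chi>\<^sub>4\<close>, which follows from counting lattice points in
  a disc.
\<close>

section \<open>Representations as a sum of two squares\<close>

text \<open>The scale behind all estimates is \<open>\<xi> = (1 - a) * ln y\<close>. The cumulants
  have exact order \<open>exp \<xi> / \<xi> * (ln y)^j\<close>, so the saddle-point equation gives
  \<open>exp \<xi> / \<xi>\<close> the order of \<open>u\<close>, and \<open>\<xi>\<close> the order
  of \<open>ln u\<close>. The upper bound on \<open>u\<close> places the saddle point at
  \<open>a \<ge> 1/2\<close>; then every \<open>p powr (-a)\<close> is at most 3/4, and prime powers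
  with \<open>k \<ge> 2\<close> only change constants. The obstacle is the middle range of
  frequencies. Counting primes in short intervals by a binomial coefficient loses a logarithm, which
  there is as large as \<open>\<xi>\<close>. To make up for it the intervals are taken as short as
  \<open>1 / \<xi>^2\<close> permits, so the characteristic function is only shown to be at most
  \<open>exp (- const * u / (ln u)^4)\<close>. This has to beat a power of \<open>u\<close> times
  the standard deviation, which contains a factor \<open>ln y\<close>. The lower bound on
  \<open>u\<close> makes that factor at most \<open>exp (sqrt u)\<close>, which is
  affordable.\<close>

definition sq_reps :: "nat \<Rightarrow> (int \<times> int) set" where
  "sq_reps n = {(a, b). a\<^sup>2 + b\<^sup>2 = int n}"

lemma r2_eq_card: "r2 n = card (sq_reps n)"
  by (simp add: r2_def sq_reps_def)

lemma finite_sq_reps: "finite (sq_reps n)"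
proof (rule finite_subset)
  show "sq_reps n \<subseteq> {- int n..int n} \<times> {- int n..int n}"
  proof
    fix z assume "z \<in> sq_reps n"
    then obtain a b where z: "z = (a, b)" "a\<^sup>2 + b\<^sup>2 = int n"
      by (auto simp: sq_reps_def)
    have ab: "\<bar>c\<bar> \<le> c\<^sup>2" for c :: int
    proof (cases "c = 0")
      case False
      hence "\<bar>c\<bar> * 1 \<le> \<bar>c\<bar> * \<bar>c\<bar>" by (intro mult_left_mono) auto
      thus ?thesis by (simp add: power2_eq_square)
    qed auto
    have "\<bar>a\<bar> \<le> int n" "\<bar>b\<bar> \<le> int n"
      using ab[of a] ab[of b] z(2) zero_le_power2[of a] zero_le_power2[of b] by linarith+
    thus "z \<in> {- int n..int n} \<times> {- int n..int n}" using z by auto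
  qed
qed auto

lemma r2_1: "r2 1 = 4"
proof -
  have "sq_reps 1 = {(1,0), (-1,0), (0,1), (0,-1)}"
  proof (intro equalityI subsetI)
    fix z assume "z \<in> sq_reps 1"
    then obtain a b where z: "z = (a, b)" "a\<^sup>2 + b\<^sup>2 = (1::int)"
      by (auto simp: sq_reps_def)
    have "a\<^sup>2 \<le> 1" "b\<^sup>2 \<le> 1" using z(2) zero_le_power2[of a] zero_le_power2[of b] by linarith+
    hence "\<bar>a\<bar> \<le> 1" "\<bar>b\<bar> \<le> 1" by (simp_all add: abs_square_le_1)
    hence "a \<in> {-1,0,1}" "b \<in> {-1,0,1}" by auto
    thus "z \<in> {(1,0), (-1,0), (0,1), (0,-1)}" using z by auto
  qed (auto simp: sq_reps_def)
  thus ?thesis by (simp add: r2_eq_card)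
qed

text \<open>Multiplication by \<open>1 + i\<close> in the Gaussian integers reaches every
  representation of \<open>2 * n\<close>, because the two entries of such a representation have the
  same parity.\<close>

lemma r2_mult_2: "r2 (2 * n) = r2 n"
proof -
  have "bij_betw (\<lambda>(a, b). (a - b, a + b)) (sq_reps n) (sq_reps (2 * n))"
    unfolding bij_betw_def
  proof
    show "inj_on (\<lambda>(a, b). (a - b, a + b)) (sq_reps n)" by (auto simp: inj_on_def)
    show "(\<lambda>(a, b). (a - b, a + b)) ` sq_reps n = sq_reps (2 * n)"
    proof (intro equalityI subsetI)
      fix z assume "z \<in> sq_reps (2 * n)"
      then obtain e f where z: "z = (e, f)" "e\<^sup>2 + f\<^sup>2 = 2 * int n"
        by (auto simp: sq_reps_def)
      have "even (e\<^sup>2 + f\<^sup>2)" unfolding z(2) by simp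
      hence "even (e + f)" by simp
      then obtain a where a: "e + f = 2 * a" by blast
      define b where "b = f - a"
      have ef: "e = a - b" "f = a + b" using a b_def by auto
      have "a\<^sup>2 + b\<^sup>2 = int n" using z(2) unfolding ef by (simp add: power2_eq_square algebra_simps)
      hence "(a, b) \<in> sq_reps n" by (simp add: sq_reps_def)
      thus "z \<in> (\<lambda>(a, b). (a - b, a + b)) ` sq_reps n" using z ef by force
    qed (auto simp: sq_reps_def power2_eq_square algebra_simps)
  qed
  thus ?thesis unfolding r2_eq_card by (metis bij_betw_same_card)
qed

text \<open>Modulo \<open>p\<close>, raising \<open>a^2 = - b^2\<close> to the odd power
  \<open>(p - 1) div 2\<close> gives \<open>1 = -1\<close> by Fermat's theorem, unless
  \<open>p\<close> divides the entries.\<close>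

lemma sum_squares_dvd_3_mod_4:
  fixes a b :: int
  assumes p: "prime p" "p mod 4 = (3::nat)" and dvd: "int p dvd a\<^sup>2 + b\<^sup>2"
  shows "int p dvd a"
proof (rule ccontr)
  assume na: "\<not> int p dvd a"
  \<comment> \<open>\<open>fermat_theorem\<close> speaks about naturals, so the residue of
    \<open>c\<close> is first represented by a natural \<open>d\<close>.\<close>
  have fermat: "[c ^ (p - 1) = 1] (mod int p)" if "\<not> int p dvd c" for c :: int
  proof -
    define d where "d = nat (c mod int p)"
    have pp: "int p > 0" using p prime_gt_0_nat by simp
    have d: "int d = c mod int p" unfolding d_def using pp by simp
    have "\<not> p dvd d"
    proof
      assume "p dvd d"
      hence "int p dvd int d" by (simp only: int_dvd_int_iff)
      thus False using d that by (simp add: dvd_mod_iff)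
    qed
    hence "[d ^ (p - 1) = 1] (mod p)" using fermat_theorem p by blast
    hence "[int d ^ (p - 1) = 1] (mod int p)" by (metis cong_int_iff of_nat_1 of_nat_power)
    moreover have "[int d ^ (p - 1) = c ^ (p - 1)] (mod int p)"
      by (rule cong_pow) (simp add: d cong_def)
    ultimately show ?thesis by (metis cong_sym cong_trans)
  qed
  have nb: "\<not> int p dvd b"
  proof
    assume "int p dvd b"
    hence "int p dvd b\<^sup>2" by (simp add: power2_eq_square)
    hence "int p dvd a\<^sup>2" using dvd by (metis dvd_add_left_iff)
    thus False using na p prime_dvd_power[of "int p" a 2] by simp
  qed
  define k where "k = (p - 1) div 2"
  have k: "p - 1 = 2 * k" "odd k" using p(2) unfolding k_def by presburger+
  have "[a\<^sup>2 = - (b\<^sup>2)] (mod int p)" using dvd by (simp add: cong_iff_dvd_diff)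
  hence "[(a\<^sup>2) ^ k = (- (b\<^sup>2)) ^ k] (mod int p)" by (rule cong_pow)
  hence "[a ^ (p - 1) = - (b ^ (p - 1))] (mod int p)"
    using k by (simp add: power_mult)
  moreover have "[a ^ (p - 1) = 1] (mod int p)" "[- (b ^ (p - 1)) = - 1] (mod int p)"
    using fermat na nb by (auto simp: cong_minus_minus_iff)
  ultimately have "[1 = - 1] (mod int p)" by (metis cong_sym cong_trans)
  hence "int p dvd 2" by (simp add: cong_iff_dvd_diff)
  hence "p dvd 2" by (metis int_dvd_int_iff of_nat_numeral)
  hence "p \<le> 2" by (simp add: dvd_imp_le)
  thus False using p(2) by (cases "p = 2"; cases "p = 1"; cases "p = 0") auto
qed

text \<open>Both entries of a representation of a multiple of \<open>p\<close> are divisible by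
  \<open>p\<close>; hence the number represented is divisible by \<open>p^2\<close>, and cancelling
  \<open>p\<close> from the entries is a bijection.\<close>

lemma r2_mult_3_mod_4:
  assumes p: "prime p" "p mod 4 = (3::nat)"
  shows "\<not> p dvd n \<Longrightarrow> r2 (p * n) = 0" and "r2 (p\<^sup>2 * n) = r2 n"
proof -
  have dv: "int p dvd a \<and> int p dvd b" if "a\<^sup>2 + b\<^sup>2 = int (p * m)" for a b :: int and m
  proof -
    have "int p dvd a\<^sup>2 + b\<^sup>2" "int p dvd b\<^sup>2 + a\<^sup>2" using that by (simp_all add: add.commute)
    thus ?thesis using sum_squares_dvd_3_mod_4[OF p] by blast
  qed
  have p0: "int p > 0" using p prime_gt_0_nat by simp
  show "r2 (p * n) = 0" if "\<not> p dvd n"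
  proof -
    have "sq_reps (p * n) = {}"
    proof (rule ccontr)
      assume "sq_reps (p * n) \<noteq> {}"
      then obtain a b where ab: "a\<^sup>2 + b\<^sup>2 = int (p * n)" by (auto simp: sq_reps_def)
      from dv[OF this] obtain c d where "a = int p * c" "b = int p * d" by (auto elim!: dvdE)
      hence "int p * (int p * (c\<^sup>2 + d\<^sup>2)) = int p * int n" using ab
        by (simp add: power2_eq_square algebra_simps)
      hence "int p * (c\<^sup>2 + d\<^sup>2) = int n" using p0 by simp
      hence "int p dvd int n" by (metis dvd_triv_left)
      thus False using that by simp
    qed
    thus ?thesis by (simp add: r2_eq_card)
  qed
  have "bij_betw (\<lambda>(a, b). (int p * a, int p * b)) (sq_reps n) (sq_reps (p\<^sup>2 * n))"
    unfolding bij_betw_def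
  proof
    show "inj_on (\<lambda>(a, b). (int p * a, int p * b)) (sq_reps n)" using p0 by (auto simp: inj_on_def)
    show "(\<lambda>(a, b). (int p * a, int p * b)) ` sq_reps n = sq_reps (p\<^sup>2 * n)"
    proof (intro equalityI subsetI)
      fix z assume "z \<in> sq_reps (p\<^sup>2 * n)"
      then obtain a b where z: "z = (a, b)" "a\<^sup>2 + b\<^sup>2 = int (p * (p * n))"
        by (auto simp: sq_reps_def power2_eq_square mult.assoc)
      from dv[OF z(2)] obtain c d where cd: "a = int p * c" "b = int p * d" by (auto elim!: dvdE)
      hence "(int p * int p) * (c\<^sup>2 + d\<^sup>2) = (int p * int p) * int n" using z(2)
        by (simp add: power2_eq_square algebra_simps)
      hence "c\<^sup>2 + d\<^sup>2 = int n" using p0 by simp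
      thus "z \<in> (\<lambda>(a, b). (int p * a, int p * b)) ` sq_reps n"
        using z cd by (force simp: sq_reps_def)
    next
      fix z assume "z \<in> (\<lambda>(a, b). (int p * a, int p * b)) ` sq_reps n"
      then obtain a b where ab: "z = (int p * a, int p * b)" "a\<^sup>2 + b\<^sup>2 = int n"
        by (auto simp: sq_reps_def)
      have "(int p * a)\<^sup>2 + (int p * b)\<^sup>2 = int (p\<^sup>2 * n)"
        using ab(2) by (simp add: power_mult_distrib flip: distrib_left)
      thus "z \<in> sq_reps (p\<^sup>2 * n)" using ab by (simp add: sq_reps_def)
    qed
  qed
  thus "r2 (p\<^sup>2 * n) = r2 n" unfolding r2_eq_card by (metis bij_betw_same_card)
qed

text \<open>Euler's criterion, where the exponent \<open>(p - 1) div 2\<close> is even.\<close>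

lemma minus_one_quad_res_1_mod_4:
  assumes p: "prime p" "p mod 4 = (1::nat)"
  shows "\<exists>s::int. int p dvd s\<^sup>2 + 1"
proof -
  have p2: "2 < int p"
  proof -
    have "p \<ge> 2" using p prime_ge_2_nat by blast
    moreover have "p \<noteq> 2" using p by auto
    ultimately show ?thesis by linarith
  qed
  have "[Legendre (-1) (int p) = (-1) ^ ((p - 1) div 2)] (mod int p)"
    using euler_criterion[of p "-1"] p p2 by (simp add: nat_div_distrib nat_diff_distrib)
  moreover have "even ((p - 1) div 2)" using p(2) by presburger
  ultimately have "[Legendre (-1) (int p) = 1] (mod int p)" by simp
  moreover have "\<not> [-1 = 1] (mod int p)"
  proof
    assume "[-1 = 1] (mod int p)"
    hence "int p dvd 2" by (metis cong_iff_dvd_diff cong_sym diff_minus_eq_add one_add_one)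
    hence "int p \<le> 2" by (rule zdvd_imp_le) simp
    thus False using p2 by simp
  qed
  moreover have "\<not> [0 = 1] (mod int p)"
    using p2 by (simp add: cong_def)
  ultimately have "QuadRes (int p) (-1)"
    unfolding Legendre_def by (auto split: if_splits simp: cong_def)
  then obtain s where "[s\<^sup>2 = -1] (mod int p)" unfolding QuadRes_def by blast
  thus ?thesis by (auto simp: cong_iff_dvd_diff)
qed

text \<open>Thue's pigeonhole argument: more than \<open>p\<close> pairs in a box cannot all have
  different residues \<open>a + s * b\<close>. A collision yields a short nonzero vector
  \<open>(c, d)\<close> whose norm is a multiple of \<open>p\<close> below
  \<open>2 * p\<close>.\<close>

lemma prime_1_mod_4_sum_squares:
  assumes p: "prime p" "p mod 4 = (1::nat)"
  shows "\<exists>c d::int. c\<^sup>2 + d\<^sup>2 = int p"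
proof -
  obtain s :: int where s: "int p dvd s\<^sup>2 + 1" using minus_one_quad_res_1_mod_4[OF p] by blast
  define k where "k = nat \<lfloor>sqrt (real p)\<rfloor>"
  have p0: "p > 0" "int p > 0" using p prime_gt_0_nat by auto
  have k1: "real k \<le> sqrt (real p)" unfolding k_def by simp
  have k2: "sqrt (real p) < real k + 1" unfolding k_def by simp
  have kk1: "int k ^ 2 \<le> int p"
  proof -
    have "real k ^ 2 \<le> (sqrt (real p))\<^sup>2" by (intro power_mono k1) auto
    hence "real (k ^ 2) \<le> real p" by simp
    hence "k ^ 2 \<le> p" by (simp only: of_nat_le_iff)
    thus ?thesis by (metis of_nat_le_iff of_nat_power)
  qed
  have "(sqrt (real p))\<^sup>2 < (real k + 1) ^ 2" by (intro power_strict_mono k2) auto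
  hence "real p < real ((k + 1) ^ 2)" by (simp add: add.commute)
  hence kk2: "p < (k + 1) ^ 2" by (simp only: of_nat_less_iff)
  let ?A = "{0..int k} \<times> {0..int k}"
  let ?f = "\<lambda>(a, b). (a + s * b) mod int p"
  have "?f ` ?A \<subseteq> {0..<int p}" using p0 by auto
  hence "card (?f ` ?A) \<le> card {0..<int p}" by (intro card_mono) auto
  also have "\<dots> = p" by simp
  also have "p < card ?A" using kk2 by (simp add: card_cartesian_product power2_eq_square nat_add_distrib)
  finally have "\<not> inj_on ?f ?A" using pigeonhole by blast
  then obtain a b a' b' where ab: "a \<in> {0..int k}" "b \<in> {0..int k}" "a' \<in> {0..int k}" "b' \<in> {0..int k}"
      "(a, b) \<noteq> (a', b')" "(a + s * b) mod int p = (a' + s * b') mod int p"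
    unfolding inj_on_def by fastforce
  define c d where "c = a - a'" and "d = b - b'"
  have "int p dvd (a + s * b) - (a' + s * b')" using ab(6) by (simp add: mod_eq_dvd_iff)
  hence cd: "int p dvd c + s * d" by (simp add: c_def d_def algebra_simps)
  have "c\<^sup>2 + d\<^sup>2 = (c + s * d) * (c - s * d) + (s\<^sup>2 + 1) * d\<^sup>2"
    by (simp add: power2_eq_square algebra_simps)
  hence dv: "int p dvd c\<^sup>2 + d\<^sup>2" using cd s by simp
  \<comment> \<open>A prime is not a square, so the bound on each entry is strict; this excludes the
    norm \<open>2 * p\<close>.\<close>
  have sq: "e\<^sup>2 \<le> int p" "e\<^sup>2 \<noteq> int p" if "\<bar>e\<bar> \<le> int k" for e :: int
  proof -
    have "\<bar>e\<bar> ^ 2 \<le> int k ^ 2" using that by (intro power_mono) auto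
    hence "\<bar>e\<bar> ^ 2 \<le> int p" using kk1 by (rule order_trans)
    thus "e\<^sup>2 \<le> int p" by simp
    show "e\<^sup>2 \<noteq> int p"
    proof
      assume "e\<^sup>2 = int p"
      hence "p = (nat \<bar>e\<bar>)\<^sup>2"
        by (metis abs_ge_zero nat_int nat_power_eq power2_abs)
      thus False using p(1) by (simp add: prime_power_iff)
    qed
  qed
  have "\<bar>c\<bar> \<le> int k" "\<bar>d\<bar> \<le> int k" using ab unfolding c_def d_def by auto
  hence lt: "c\<^sup>2 < int p" "d\<^sup>2 < int p" using sq[of c] sq[of d] by linarith+
  have pos: "c\<^sup>2 + d\<^sup>2 > 0"
    using ab(5) unfolding c_def d_def by (auto simp: sum_power2_gt_zero_iff)
  from dv obtain j where j: "c\<^sup>2 + d\<^sup>2 = int p * j" by blast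
  have "int p * j > 0" using pos j by simp
  hence "j > 0" using p0 by (simp add: zero_less_mult_iff)
  moreover have "int p * j < int p * 2" using lt j by linarith
  hence "j < 2" using p0 by simp
  ultimately have "j = 1" by simp
  thus ?thesis using j by auto
qed

text \<open>In the Gaussian integers \<open>p\<close> is the product of \<open>c + d i\<close> and
  its conjugate. The maps \<open>f\<close> and \<open>g\<close> are multiplication by these two
  factors. Together they reach every representation of \<open>p * m\<close>, and they overlap
  exactly where both entries are divisible by \<open>p\<close>, so inclusion-exclusion gives both
  identities.\<close>

lemma r2_mult_1_mod_4:
  assumes p: "prime p" "p mod 4 = (1::nat)"
  shows "\<not> p dvd n \<Longrightarrow> r2 (p * n) = 2 * r2 n" and "r2 (p * (p * n)) + r2 n = 2 * r2 (p * n)"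
proof -
  obtain c d :: int where cd: "c\<^sup>2 + d\<^sup>2 = int p" using prime_1_mod_4_sum_squares[OF p] by blast
  have p0: "int p > 0" using p prime_gt_0_nat by simp
  have pp: "prime (int p)" using p by simp
  have nsq: "e\<^sup>2 \<noteq> int p" for e :: int
  proof
    assume "e\<^sup>2 = int p"
    hence "p = (nat \<bar>e\<bar>)\<^sup>2"
      by (metis abs_ge_zero nat_int nat_power_eq power2_abs)
    thus False using p(1) by (simp add: prime_power_iff)
  qed
  have c0: "c \<noteq> 0" "d \<noteq> 0" using cd nsq[of c] nsq[of d] by auto
  have nd: "\<not> int p dvd c"
  proof
    assume "int p dvd c"
    hence "\<bar>int p\<bar> \<le> \<bar>c\<bar>" by (rule dvd_imp_le_int[OF c0(1)])
    hence "int p * 1 \<le> \<bar>c\<bar> * \<bar>c\<bar>" using p0 c0 by (intro mult_mono) auto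
    hence "int p \<le> c\<^sup>2" by (simp add: power2_eq_square)
    moreover have "d\<^sup>2 > 0" using c0 by simp
    ultimately show False using cd by linarith
  qed
  have p2: "\<not> int p dvd 2"
  proof
    assume "int p dvd 2"
    hence "int p \<le> 2" by (rule zdvd_imp_le) simp
    hence "p = 2" using p prime_ge_2_nat[of p] by linarith
    thus False using p(2) by simp
  qed
  define f where "f = (\<lambda>(a::int, b::int). (c * a - d * b, c * b + d * a))"
  define g where "g = (\<lambda>(a::int, b::int). (c * a + d * b, c * b - d * a))"
  have fg: "f (g z) = (int p * fst z, int p * snd z)" "g (f z) = (int p * fst z, int p * snd z)" for z
    unfolding f_def g_def cd[symmetric] by (cases z; simp add: power2_eq_square algebra_simps)+
  have inj: "inj f" "inj g"
  proof -
    have eq: "z = z'" if "(int p * fst z, int p * snd z) = (int p * fst z', int p * snd z')" for z z'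
      using that p0 by (simp add: prod_eq_iff)
    show "inj f" by (rule injI, rule eq) (metis fg(2))
    show "inj g" by (rule injI, rule eq) (metis fg(1))
  qed
  have nf: "f z \<in> sq_reps (p * m) \<longleftrightarrow> z \<in> sq_reps m" "g z \<in> sq_reps (p * m) \<longleftrightarrow> z \<in> sq_reps m" for z m
  proof -
    obtain a b where z: "z = (a, b)" by (cases z)
    have 1: "(c * a - d * b)\<^sup>2 + (c * b + d * a)\<^sup>2 = int p * (a\<^sup>2 + b\<^sup>2)"
      "(c * a + d * b)\<^sup>2 + (c * b - d * a)\<^sup>2 = int p * (a\<^sup>2 + b\<^sup>2)"
      unfolding cd[symmetric] by (simp_all add: power2_eq_square algebra_simps)
    show "f z \<in> sq_reps (p * m) \<longleftrightarrow> z \<in> sq_reps m" "g z \<in> sq_reps (p * m) \<longleftrightarrow> z \<in> sq_reps m"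
      using p0 by (simp_all add: z f_def g_def sq_reps_def 1)
  qed
  have un: "f ` sq_reps m \<union> g ` sq_reps m = sq_reps (p * m)" for m
  proof (intro equalityI subsetI)
    fix w assume w: "w \<in> sq_reps (p * m)"
    obtain x y where xy: "w = (x, y)" by (cases w)
    have n: "x\<^sup>2 + y\<^sup>2 = int p * int m" using w xy by (simp add: sq_reps_def)
    \<comment> \<open>When the norm is divisible by \<open>p^2\<close>, divisibility of one entry by
      \<open>p\<close> forces that of the other.\<close>
    have key: "\<exists>z. w = (int p * fst z, int p * snd z)" if h: "w = (a, b)" "int p dvd a" "a\<^sup>2 + b\<^sup>2 = int p * (int p * int m)" for w a b
    proof -
      have "int p dvd a\<^sup>2" using h(2) by (simp add: power2_eq_square)
      moreover have "int p dvd a\<^sup>2 + b\<^sup>2" unfolding h(3) by simp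
      ultimately have "int p dvd b\<^sup>2" by (metis dvd_add_right_iff)
      hence "int p dvd b" using pp prime_dvd_power by blast
      then obtain a' b' where "a = int p * a'" "b = int p * b'" using h(2) by (auto elim!: dvdE)
      thus ?thesis using h(1) by auto
    qed
    \<comment> \<open>The factors are the first entries of \<open>g w\<close> and
      \<open>f w\<close>, so \<open>p\<close> divides one of them.\<close>
    have "(c * x + d * y) * (c * x - d * y) = c\<^sup>2 * (x\<^sup>2 + y\<^sup>2) - y\<^sup>2 * (c\<^sup>2 + d\<^sup>2)"
      by (simp add: power2_eq_square algebra_simps)
    hence "int p dvd (c * x + d * y) * (c * x - d * y)" unfolding n cd by simp
    hence "int p dvd c * x + d * y \<or> int p dvd c * x - d * y" using pp by (simp add: prime_dvd_mult_iff)
    thus "w \<in> f ` sq_reps m \<union> g ` sq_reps m"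
    proof
      assume "int p dvd c * x + d * y"
      moreover have "(c * x + d * y)\<^sup>2 + (c * y - d * x)\<^sup>2 = int p * (int p * int m)"
        unfolding n[symmetric] unfolding cd[symmetric] by (simp add: power2_eq_square algebra_simps)
      moreover have "g w = (c * x + d * y, c * y - d * x)" by (simp add: xy g_def)
      ultimately obtain z where z: "g w = (int p * fst z, int p * snd z)" using key by metis
      hence "g w = g (f z)" using fg by simp
      hence "w = f z" using inj by (simp add: inj_eq)
      thus ?thesis using w nf by blast
    next
      assume "int p dvd c * x - d * y"
      moreover have "(c * x - d * y)\<^sup>2 + (c * y + d * x)\<^sup>2 = int p * (int p * int m)"
        unfolding n[symmetric] unfolding cd[symmetric] by (simp add: power2_eq_square algebra_simps)
      moreover have "f w = (c * x - d * y, c * y + d * x)" by (simp add: xy f_def)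
      ultimately obtain z where z: "f w = (int p * fst z, int p * snd z)" using key by metis
      hence "f w = f (g z)" using fg by simp
      hence "w = g z" using inj by (simp add: inj_eq)
      thus ?thesis using w nf by blast
    qed
  next
    fix w assume "w \<in> f ` sq_reps m \<union> g ` sq_reps m"
    thus "w \<in> sq_reps (p * m)" using nf by auto
  qed
  have int_sub: "\<exists>z. w = (int p * fst z, int p * snd z)" if fw: "w \<in> range f" "w \<in> range g" for w
  proof -
    obtain x y where xy: "w = (x, y)" by (cases w)
    obtain z1 z2 where z: "w = f z1" "w = g z2" using fw by (metis rangeE)
    have "g w = (int p * fst z1, int p * snd z1)" "f w = (int p * fst z2, int p * snd z2)"
      using fg z by metis+
    hence dv: "int p dvd c * x + d * y" "int p dvd c * y - d * x" "int p dvd c * x - d * y" "int p dvd c * y + d * x"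
      by (auto simp: xy f_def g_def)
    \<comment> \<open>Adding eliminates \<open>d\<close> and leaves \<open>2 * c\<close> times each
      entry; \<open>p\<close> divides neither 2 nor \<open>c\<close>.\<close>
    have "int p dvd (c * x + d * y) + (c * x - d * y)" "int p dvd (c * y - d * x) + (c * y + d * x)"
      using dv by (blast intro: dvd_add)+
    hence "int p dvd 2 * (c * x)" "int p dvd 2 * (c * y)" by (simp_all add: algebra_simps)
    hence "int p dvd x" "int p dvd y" using pp p2 nd by (simp_all add: prime_dvd_mult_iff)
    thus ?thesis using xy by (auto elim!: dvdE)
  qed
  have card: "2 * r2 m = r2 (p * m) + card (f ` sq_reps m \<inter> g ` sq_reps m)" for m
  proof -
    have "card (f ` sq_reps m) + card (g ` sq_reps m) = card (f ` sq_reps m \<union> g ` sq_reps m) + card (f ` sq_reps m \<inter> g ` sq_reps m)"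
      by (intro card_Un_Int) (auto intro: finite_sq_reps)
    moreover have "card (f ` sq_reps m) = r2 m" "card (g ` sq_reps m) = r2 m"
      unfolding r2_eq_card using inj by (auto intro!: card_image intro: inj_on_subset)
    ultimately show ?thesis by (simp add: un r2_eq_card)
  qed
  show "r2 (p * n) = 2 * r2 n" if "\<not> p dvd n"
  proof -
    have "f ` sq_reps n \<inter> g ` sq_reps n = {}"
    proof (rule ccontr)
      assume "f ` sq_reps n \<inter> g ` sq_reps n \<noteq> {}"
      then obtain w where w: "w \<in> f ` sq_reps n" "w \<in> g ` sq_reps n" by blast
      then obtain z where z: "w = (int p * fst z, int p * snd z)" using int_sub[of w] by blast
      have "w \<in> sq_reps (p * n)" using w un by blast
      hence "int p * (int p * ((fst z)\<^sup>2 + (snd z)\<^sup>2)) = int p * int n" unfolding z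
        by (simp add: sq_reps_def power2_eq_square algebra_simps)
      hence "int p * ((fst z)\<^sup>2 + (snd z)\<^sup>2) = int n" using p0 by simp
      hence "int p dvd int n" by (metis dvd_triv_left)
      thus False using that by simp
    qed
    thus ?thesis using card[of n] by simp
  qed
  \<comment> \<open>Here the overlap is a copy of the representations of \<open>n\<close>, because
    \<open>f (g z)\<close> is \<open>p\<close> times \<open>z\<close>.\<close>
  have "f ` sq_reps (p * n) \<inter> g ` sq_reps (p * n) = (f \<circ> g) ` sq_reps n"
  proof (intro equalityI subsetI)
    fix w assume w: "w \<in> f ` sq_reps (p * n) \<inter> g ` sq_reps (p * n)"
    then obtain z where z: "w = (int p * fst z, int p * snd z)" using int_sub[of w] by blast
    hence z': "w = f (g z)" using fg by simp
    have "w \<in> sq_reps (p * (p * n))" using w un by blast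
    hence "z \<in> sq_reps n" unfolding z' using nf by blast
    thus "w \<in> (f \<circ> g) ` sq_reps n" using z' by auto
  next
    fix w assume "w \<in> (f \<circ> g) ` sq_reps n"
    then obtain z where z: "z \<in> sq_reps n" "w = f (g z)" by auto
    moreover have "w = g (f z)" using z fg by simp
    ultimately show "w \<in> f ` sq_reps (p * n) \<inter> g ` sq_reps (p * n)" using nf by blast
  qed
  moreover have "card ((f \<circ> g) ` sq_reps n) = r2 n"
    unfolding r2_eq_card by (rule card_image) (metis inj inj_compose inj_on_subset subset_UNIV)
  ultimately show "r2 (p * (p * n)) + r2 n = 2 * r2 (p * n)" using card[of "p * n"] by simp
qed

section \<open>The local factors of \<open>r2 / 4\<close>\<close>

definition chi4 :: "nat \<Rightarrow> real" where
  "chi4 p = (if p mod 4 = 1 then 1 else if p mod 4 = 3 then -1 else 0)"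

lemma chi4_cases: "chi4 p \<in> {1, 0, -1}"
  by (simp add: chi4_def)

lemma prime_cases_mod_4:
  assumes "prime (p::nat)"
  obtains "p = 2" "chi4 p = 0" | "p mod 4 = 1" "chi4 p = 1" | "p mod 4 = 3" "chi4 p = -1"
proof -
  have "p mod 4 = 1 \<or> p mod 4 = 3 \<or> even p" by presburger
  moreover have "p = 2" if "even p" using that assms primes_dvd_imp_eq two_is_prime_nat by blast
  ultimately show ?thesis using that unfolding chi4_def by fastforce
qed

text \<open>For \<open>c = chi4 p\<close> this is the value of \<open>r2 / 4\<close> at
  \<open>p ^ k\<close>; it is also the coefficient of \<open>z ^ k\<close> in
  \<open>1 / ((1 - z) * (1 - c * z))\<close>.\<close>

abbreviation local_coeff :: "real \<Rightarrow> nat \<Rightarrow> real" where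
  "local_coeff c k \<equiv> (\<Sum>j\<le>k. c ^ j)"

lemma local_coeff_minus_one: "local_coeff (-1) k = (if even k then 1 else 0)"
  by (induction k) auto

lemma local_coeff_one: "local_coeff 1 k = real k + 1"
  by (induction k) auto

lemma local_coeff_zero: "local_coeff 0 k = 1"
  by (induction k) auto

text \<open>Multiplicativity in the form in which the induction of \<open>euler_product\<close> adds
  one prime at a time. For \<open>p mod 4 = 1\<close> the recurrence says that second differences
  vanish, so the values form an arithmetic progression in \<open>k\<close>.\<close>

lemma r2_prime_power_mult:
  assumes p: "prime p" and m: "\<not> p dvd m"
  shows "real (r2 (p ^ k * m)) = local_coeff (chi4 p) k * real (r2 m)"
  using p
proof (cases rule: prime_cases_mod_4)
  case 1
  have "r2 (2 ^ k * m) = r2 m"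
    by (induction k) (simp_all add: mult.assoc r2_mult_2)
  thus ?thesis using 1 by (simp add: local_coeff_zero)
next
  case 2
  \<comment> \<open>Two consecutive values are carried along because the recurrence has order
    two.\<close>
  have "real (r2 (p ^ k * m)) = (real k + 1) * real (r2 m) \<and>
        real (r2 (p ^ Suc k * m)) = (real (Suc k) + 1) * real (r2 m)"
  proof (induction k)
    case 0
    show ?case using r2_mult_1_mod_4(1)[OF p 2(1) m] by simp
  next
    case (Suc k)
    have "r2 (p * (p * (p ^ k * m))) + r2 (p ^ k * m) = 2 * r2 (p * (p ^ k * m))"
      using r2_mult_1_mod_4(2)[OF p 2(1)] by blast
    hence "r2 (p ^ Suc (Suc k) * m) + r2 (p ^ k * m) = 2 * r2 (p ^ Suc k * m)"
      by (simp add: mult.assoc)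
    hence "real (r2 (p ^ Suc (Suc k) * m)) + real (r2 (p ^ k * m)) = 2 * real (r2 (p ^ Suc k * m))"
      by (metis of_nat_add of_nat_mult of_nat_numeral)
    thus ?case using Suc by (simp add: algebra_simps)
  qed
  thus ?thesis using 2 by (simp add: local_coeff_one)
next
  case 3
  have ev: "r2 (p ^ (2 * j) * n) = r2 n" for j n
  proof (induction j)
    case (Suc j)
    have "p ^ (2 * Suc j) * n = p\<^sup>2 * (p ^ (2 * j) * n)" by (simp add: power2_eq_square mult.assoc)
    thus ?case using r2_mult_3_mod_4(2)[OF p 3(1)] Suc by (simp only:)
  qed auto
  show ?thesis
  proof (cases "even k")
    case True
    thus ?thesis using ev[of "k div 2" m] 3 by (simp add: local_coeff_minus_one)
  next
    case False
    then obtain j where j: "k = Suc (2 * j)" by (metis oddE Suc_eq_plus1)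
    have "p ^ k * m = p ^ (2 * j) * (p * m)" using j by (simp add: mult_ac)
    hence "r2 (p ^ k * m) = 0" using ev[of j "p * m"] r2_mult_3_mod_4(1)[OF p 3(1) m] by (simp only:)
    thus ?thesis using 3 False by (simp add: local_coeff_minus_one)
  qed
qed

text \<open>This is the coefficient identity behind the logarithmic derivative of
  \<open>1 / ((1 - z) (1 - c z))\<close>.\<close>

lemma local_coeff_log_deriv:
  assumes "c \<in> {1, 0, -1::real}"
  shows "real v * local_coeff c v = (\<Sum>k=1..v. (1 + c ^ k) * local_coeff c (v - k))"
proof -
  consider "c = 1" | "c = 0" | "c = -1" using assms by auto
  thus ?thesis
  proof cases
    case 1
    have "(\<Sum>k=1..v. 2 * (real (v - k) + 1)) = real v * (real v + 1)"
    proof (induction v)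
      case (Suc v)
      have "(\<Sum>k=1..Suc v. 2 * (real (Suc v - k) + 1)) = 2 * (real v + 1) + (\<Sum>k=2..Suc v. 2 * (real (Suc v - k) + 1))"
        by (subst sum.atLeast_Suc_atMost) (auto simp: numeral_2_eq_2)
      also have "(\<Sum>k=2..Suc v. 2 * (real (Suc v - k) + 1)) = (\<Sum>k=1..v. 2 * (real (v - k) + 1))"
        by (rule sum.reindex_bij_witness[of _ Suc "\<lambda>k. k - 1"]) auto
      finally show ?case using Suc by (simp add: algebra_simps)
    qed auto
    moreover have "(\<Sum>k=1..v. (1 + c ^ k) * local_coeff c (v - k)) = (\<Sum>k=1..v. 2 * (real (v - k) + 1))"
      using 1 by (intro sum.cong refl) (simp add: local_coeff_one)
    ultimately show ?thesis using 1 by (simp only: local_coeff_one)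
  next
    case 2
    have "(\<Sum>k=1..v. (1 + c ^ k) * local_coeff c (v - k)) = (\<Sum>k=1..v. 1)"
      using 2 by (intro sum.cong refl) (simp add: local_coeff_zero)
    thus ?thesis using 2 by (simp add: local_coeff_zero)
  next
    case 3
    have s: "(\<Sum>k=1..v. 1 + (-1) ^ k) = real v + (if even v then 0 else -1)"
      by (induction v) auto
    show ?thesis
    proof (cases "even v")
      case True
      have "(\<Sum>k=1..v. (1 + c ^ k) * local_coeff c (v - k)) = (\<Sum>k=1..v. 1 + (-1) ^ k)"
        using True 3 by (intro sum.cong) (auto simp: local_coeff_minus_one)
      thus ?thesis using s True 3 by (simp add: local_coeff_minus_one)
    next
      case False
      have "(\<Sum>k=1..v. (1 + c ^ k) * local_coeff c (v - k)) = (\<Sum>k=1..v. 0)"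
        using False 3 by (intro sum.cong) (auto simp: local_coeff_minus_one)
      thus ?thesis using False 3 by (simp add: local_coeff_minus_one)
    qed
  qed
qed

text \<open>The numbers \<open>(1 + chi4 p ^ k) * ln p\<close> are the coefficients of minus the
  logarithmic derivative of the zeta function of Q(i). The identity is thus the analogue of writing
  \<open>ln\<close> as the convolution of 1 with von Mangoldt's function, and it reduces to
  \<open>local_coeff_log_deriv\<close> at each prime.\<close>

lemma r2_mult_ln:
  assumes n: "n > 0"
  shows "real (r2 n) * ln (real n) =
    (\<Sum>p\<in>prime_factors n. \<Sum>k=1..multiplicity p n. (1 + chi4 p ^ k) * ln (real p) * real (r2 (n div p ^ k)))"
proof -
  have "real n = real (\<Prod>p\<in>prime_factors n. p ^ multiplicity p n)"
    using prime_factorization_nat[of n] n by simp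
  hence "ln (real n) = ln (\<Prod>p\<in>prime_factors n. real p ^ multiplicity p n)" by simp
  also have "\<dots> = (\<Sum>p\<in>prime_factors n. ln (real p ^ multiplicity p n))"
    by (auto intro!: ln_prod simp: in_prime_factors_iff prime_gt_0_nat)
  also have "\<dots> = (\<Sum>p\<in>prime_factors n. real (multiplicity p n) * ln (real p))"
    by (intro sum.cong refl ln_realpow)
  finally have ln: "ln (real n) = \<dots>" .
  show ?thesis unfolding ln sum_distrib_left
  proof (rule sum.cong)
    fix p assume "p \<in> prime_factors n"
    hence p: "prime p" "p dvd n" by (auto simp: in_prime_factors_iff)
    define v where "v = multiplicity p n"
    obtain m where m: "n = p ^ v * m" "\<not> p dvd m"
      using multiplicity_decompose'[of n p] n p unfolding v_def
      by (metis mult.commute not_prime_unit less_numeral_extra(3))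
    have "(\<Sum>k=1..v. (1 + chi4 p ^ k) * ln (real p) * real (r2 (n div p ^ k)))
        = (\<Sum>k=1..v. (1 + chi4 p ^ k) * ln (real p) * (local_coeff (chi4 p) (v - k) * real (r2 m)))"
    proof (rule sum.cong)
      fix k assume k: "k \<in> {1..v}"
      have "p ^ v = p ^ k * p ^ (v - k)" using k by (simp flip: power_add)
      hence "n div p ^ k = p ^ (v - k) * m" using m p by (simp add: mult.assoc prime_gt_0_nat)
      thus "(1 + chi4 p ^ k) * ln (real p) * real (r2 (n div p ^ k)) =
        (1 + chi4 p ^ k) * ln (real p) * (local_coeff (chi4 p) (v - k) * real (r2 m))"
        using r2_prime_power_mult[OF p(1) m(2)] by simp
    qed auto
    also have "\<dots> = (\<Sum>k=1..v. (1 + chi4 p ^ k) * local_coeff (chi4 p) (v - k)) * (ln (real p) * real (r2 m))"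
      by (subst sum_distrib_right, intro sum.cong refl) (simp only: mult_ac)
    also have "\<dots> = real v * local_coeff (chi4 p) v * (ln (real p) * real (r2 m))"
      using local_coeff_log_deriv[OF chi4_cases] by simp
    finally show "real (r2 n) * (real (multiplicity p n) * ln (real p)) =
      (\<Sum>k=1..multiplicity p n. (1 + chi4 p ^ k) * ln (real p) * real (r2 (n div p ^ k)))"
      using r2_prime_power_mult[OF p(1) m(2), of v] m(1) unfolding v_def[symmetric] by simp
  qed auto
qed

text \<open>The number of lattice points other than the origin in the closed disc of radius
  \<open>sqrt N\<close>.\<close>

definition sum_r2 :: "nat \<Rightarrow> real" where
  "sum_r2 N = (\<Sum>n=1..N. real (r2 n))"

lemma sum_r2_mult_ln:
  "(\<Sum>n=1..N. real (r2 n) * ln (real n)) =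
   (\<Sum>p | prime p \<and> p \<le> N. \<Sum>k=1..N. (1 + chi4 p ^ k) * ln (real p) * sum_r2 (N div p ^ k))"
proof -
  let ?P = "{p. prime p \<and> p \<le> N}"
  let ?h = "\<lambda>p k n. if p ^ k dvd n then (1 + chi4 p ^ k) * ln (real p) * real (r2 (n div p ^ k)) else 0"
  have fin: "finite ?P" by simp
  have "(\<Sum>n=1..N. real (r2 n) * ln (real n)) = (\<Sum>n=1..N. \<Sum>p\<in>?P. \<Sum>k=1..N. ?h p k n)"
  proof (rule sum.cong)
    fix n assume n: "n \<in> {1..N}"
    have sub: "prime_factors n \<subseteq> ?P" using n by (auto simp: in_prime_factors_iff dest!: dvd_imp_le)
    have "real (r2 n) * ln (real n) = (\<Sum>p\<in>prime_factors n. \<Sum>k=1..N. ?h p k n)"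
    proof (subst r2_mult_ln, goal_cases)
      case 2
      show ?case
      proof (rule sum.cong)
        fix p assume "p \<in> prime_factors n"
        hence p: "prime p" "p dvd n" by (auto simp: in_prime_factors_iff)
        have iff: "p ^ k dvd n \<longleftrightarrow> k \<le> multiplicity p n" for k
          using n p by (intro power_dvd_iff_le_multiplicity) (auto simp: not_prime_unit)
        have "multiplicity p n < p ^ multiplicity p n" using prime_gt_1_nat[OF p(1)] by (intro power_gt_expt) simp
        also have "\<dots> \<le> n" using n by (intro dvd_imp_le multiplicity_dvd) auto
        finally have le: "multiplicity p n \<le> N" using n by simp
        have "(\<Sum>k=1..N. ?h p k n) = (\<Sum>k\<in>{1..multiplicity p n}. ?h p k n)"
          using le by (intro sum.mono_neutral_right) (auto simp: iff)
        thus "(\<Sum>k=1..multiplicity p n. (1 + chi4 p ^ k) * ln (real p) * real (r2 (n div p ^ k))) = (\<Sum>k=1..N. ?h p k n)"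
          by (simp add: iff)
      qed auto
    qed (use n in auto)
    also have "\<dots> = (\<Sum>p\<in>?P. \<Sum>k=1..N. ?h p k n)"
    proof (rule sum.mono_neutral_left[OF fin sub], safe)
      fix p assume p: "prime p" "p \<le> N" "p \<notin> prime_factors n"
      hence "\<not> p dvd n" using n by (auto simp: in_prime_factors_iff)
      hence "\<not> p ^ k dvd n" if "k \<ge> 1" for k using that by (metis dvd_power dvd_trans not_one_le_zero zero_less_iff_neq_zero)
      thus "(\<Sum>k=1..N. ?h p k n) = 0" by (intro sum.neutral) auto
    qed
    finally show "real (r2 n) * ln (real n) = (\<Sum>p\<in>?P. \<Sum>k=1..N. ?h p k n)" .
  qed auto
  also have "\<dots> = (\<Sum>p\<in>?P. \<Sum>k=1..N. \<Sum>n=1..N. ?h p k n)"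
    by (subst sum.swap, rule sum.cong[OF refl], rule sum.swap)
  also have "\<dots> = (\<Sum>p\<in>?P. \<Sum>k=1..N. (1 + chi4 p ^ k) * ln (real p) * sum_r2 (N div p ^ k))"
  proof (intro sum.cong refl)
    fix p k assume p: "p \<in> ?P"
    hence q: "p ^ k > 0" by (simp add: prime_gt_0_nat)
    have "(\<Sum>n=1..N. ?h p k n) = (\<Sum>n\<in>{n\<in>{1..N}. p ^ k dvd n}. (1 + chi4 p ^ k) * ln (real p) * real (r2 (n div p ^ k)))"
      by (rule sum.inter_filter[symmetric]) simp
    also have "\<dots> = (\<Sum>m\<in>{1..N div p ^ k}. (1 + chi4 p ^ k) * ln (real p) * real (r2 m))"
    proof (rule sum.reindex_bij_witness[of _ "\<lambda>m. p ^ k * m" "\<lambda>n. n div p ^ k"])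
      fix n assume n: "n \<in> {n \<in> {1..N}. p ^ k dvd n}"
      thus "n div p ^ k \<in> {1..N div p ^ k}" using q
        by (auto simp: div_le_mono dvd_imp_le Suc_le_eq div_greater_zero_iff)
    next
      fix m assume m: "m \<in> {1..N div p ^ k}"
      hence "p ^ k * m \<le> p ^ k * (N div p ^ k)" by simp
      also have "\<dots> \<le> N" by simp
      finally show "p ^ k * m \<in> {n \<in> {1..N}. p ^ k dvd n}" using m q by (auto simp: Suc_le_eq)
    qed (use q in auto)
    finally show "(\<Sum>n=1..N. ?h p k n) = (1 + chi4 p ^ k) * ln (real p) * sum_r2 (N div p ^ k)"
      by (simp add: sum_r2_def sum_distrib_left)
  qed
  finally show ?thesis .
qed

section \<open>Lattice points in a disc\<close>

lemma card_int_squares_le: "card {b::int. b\<^sup>2 \<le> int M} = 2 * nat \<lfloor>sqrt (real M)\<rfloor> + 1"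
proof -
  define m where "m = \<lfloor>sqrt (real M)\<rfloor>"
  have eqv: "b \<in> {b. b\<^sup>2 \<le> int M} \<longleftrightarrow> b \<in> {-m..m}" for b :: int
  proof -
    have "b\<^sup>2 \<le> int M \<longleftrightarrow> (real_of_int b)\<^sup>2 \<le> real M"
      by (metis of_int_le_iff of_int_of_nat_eq of_int_power)
    also have "\<dots> \<longleftrightarrow> \<bar>real_of_int b\<bar> \<le> sqrt (real M)"
      by (metis real_sqrt_abs real_sqrt_le_iff)
    also have "\<dots> \<longleftrightarrow> \<bar>b\<bar> \<le> m" unfolding m_def by (simp add: le_floor_iff)
    finally show ?thesis by auto
  qed
  have "{b::int. b\<^sup>2 \<le> int M} = {-m..m}" using eqv by blast
  moreover have "m \<ge> 0" unfolding m_def by simp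
  ultimately show ?thesis unfolding m_def[symmetric] by simp
qed

text \<open>The maximum with 0 keeps the height continuous and decreasing past the edge of the disc,
  so that sum and integral can be compared on the whole half line.\<close>

definition disc_height :: "real \<Rightarrow> real \<Rightarrow> real" where
  "disc_height N v = sqrt (max 0 (N - v\<^sup>2))"

text \<open>Replacing the count in a column by twice its height costs at most 1 in each of
  \<open>2 * s + 1\<close> columns. The origin costs 1 more, and counting the column
  \<open>a = 0\<close> twice costs \<open>2 * sqrt N\<close>. Since \<open>1 \<le> sqrt N\<close>,
  the total is at most \<open>6 * sqrt N\<close>.\<close>

lemma sum_r2_disc_height:
  assumes "N > 0" and s: "s = nat \<lfloor>sqrt (real N)\<rfloor>"
  shows "\<bar>sum_r2 N - 4 * (\<Sum>k\<le>s. disc_height N (real k))\<bar> \<le> 6 * sqrt (real N)"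
proof -
  have s1: "real s \<le> sqrt (real N)" unfolding s by simp
  have N1: "1 \<le> sqrt (real N)" using assms by simp
  let ?D = "\<lambda>a::int. {b::int. b\<^sup>2 \<le> int N - a\<^sup>2}"
  let ?h = "\<lambda>a::int. disc_height N (real_of_int a)"
  let ?A = "{- int s..int s}"
  have asq: "a\<^sup>2 \<le> int N" if "a \<in> ?A" for a
  proof -
    have "\<bar>real_of_int a\<bar> \<le> sqrt (real N)" using that s1 by auto
    hence "\<bar>real_of_int a\<bar>\<^sup>2 \<le> (sqrt (real N))\<^sup>2" by (intro power_mono) auto
    hence "real_of_int (a\<^sup>2) \<le> real_of_int (int N)" by simp
    thus ?thesis by (simp only: of_int_le_iff)
  qed
  have asq': "a \<in> ?A" if "a\<^sup>2 \<le> int N" for a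
  proof -
    have "(real_of_int a)\<^sup>2 \<le> real N" using that by (metis of_int_le_iff of_int_of_nat_eq of_int_power)
    hence "\<bar>real_of_int a\<bar> \<le> sqrt (real N)" by (metis real_sqrt_abs real_sqrt_le_iff)
    hence "\<bar>a\<bar> \<le> \<lfloor>sqrt (real N)\<rfloor>" by (simp add: le_floor_iff)
    thus ?thesis unfolding s by auto
  qed
  have cardD: "\<bar>real (card (?D a)) - 2 * ?h a\<bar> \<le> 1" and finD: "finite (?D a)" if "a \<in> ?A" for a
  proof -
    define M where "M = nat (int N - a\<^sup>2)"
    have M: "int N - a\<^sup>2 = int M" using asq[OF that] unfolding M_def by simp
    have "real N - (real_of_int a)\<^sup>2 = real M" using M
      by (metis of_int_diff of_int_of_nat_eq of_int_power)
    hence h: "?h a = sqrt (real M)" by (simp add: disc_height_def)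
    have c: "real (card (?D a)) = 2 * real_of_int \<lfloor>sqrt (real M)\<rfloor> + 1"
      unfolding M card_int_squares_le by simp
    show "\<bar>real (card (?D a)) - 2 * ?h a\<bar> \<le> 1" unfolding c h by linarith
    have "card (?D a) \<noteq> 0" unfolding M card_int_squares_le by simp
    thus "finite (?D a)" using card_gt_0_iff by blast
  qed
  have un: "(\<Union>n\<le>N. sq_reps n) = Sigma ?A ?D"
  proof (intro equalityI subsetI)
    fix z assume "z \<in> (\<Union>n\<le>N. sq_reps n)"
    then obtain a b n where z: "z = (a, b)" "n \<le> N" "a\<^sup>2 + b\<^sup>2 = int n"
      by (auto simp: sq_reps_def)
    have "a\<^sup>2 \<le> int N" using z(2,3) zero_le_power2[of b] by linarith
    thus "z \<in> Sigma ?A ?D" using asq'[of a] z by auto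
  next
    fix z assume "z \<in> Sigma ?A ?D"
    then obtain a b where z: "z = (a, b)" "b\<^sup>2 \<le> int N - a\<^sup>2" by auto
    have "a\<^sup>2 + b\<^sup>2 = int (nat (a\<^sup>2 + b\<^sup>2))" by simp
    moreover have "nat (a\<^sup>2 + b\<^sup>2) \<le> N" using z by linarith
    ultimately show "z \<in> (\<Union>n\<le>N. sq_reps n)" using z by (intro UN_I[of "nat (a\<^sup>2 + b\<^sup>2)"]) (auto simp: sq_reps_def)
  qed
  have r0: "r2 0 = 1"
  proof -
    have "sq_reps 0 = {(0, 0)}" by (auto simp: sq_reps_def)
    thus ?thesis by (simp add: r2_eq_card)
  qed
  have "card (\<Union>n\<le>N. sq_reps n) = (\<Sum>n\<le>N. card (sq_reps n))"
    by (rule card_UN_disjoint) (simp, simp add: finite_sq_reps, auto simp: sq_reps_def)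
  also have "\<dots> = (\<Sum>n\<le>N. r2 n)" by (simp add: r2_eq_card)
  also have "\<dots> = 1 + (\<Sum>n=1..N. r2 n)"
    by (simp add: atMost_atLeast0 sum.atLeast_Suc_atMost r0)
  also have "card (\<Union>n\<le>N. sq_reps n) = (\<Sum>a\<in>?A. card (?D a))"
    unfolding un by (rule card_SigmaI) (use finD in auto)
  finally have "(\<Sum>a\<in>?A. card (?D a)) = 1 + (\<Sum>n=1..N. r2 n)" .
  hence "real (\<Sum>a\<in>?A. card (?D a)) = real (1 + (\<Sum>n=1..N. r2 n))" by (rule arg_cong)
  hence S: "sum_r2 N = (\<Sum>a\<in>?A. real (card (?D a))) - 1" by (simp add: sum_r2_def)
  have "\<bar>(\<Sum>a\<in>?A. real (card (?D a))) - (\<Sum>a\<in>?A. 2 * ?h a)\<bar> \<le> (\<Sum>a\<in>?A. 1)"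
    unfolding sum_subtractf[symmetric] by (rule order_trans[OF sum_abs]) (intro sum_mono cardD)
  also have "\<dots> = 2 * real s + 1" by simp
  finally have 1: "\<bar>(\<Sum>a\<in>?A. real (card (?D a))) - (\<Sum>a\<in>?A. 2 * ?h a)\<bar> \<le> 2 * real s + 1" .
  have "?A = int ` {..s} \<union> (\<lambda>k. - int k) ` {1..s}"
  proof (intro equalityI subsetI)
    fix a assume a: "a \<in> ?A"
    show "a \<in> int ` {..s} \<union> (\<lambda>k. - int k) ` {1..s}"
    proof (cases "a \<ge> 0")
      case True
      hence "a = int (nat a)" "nat a \<le> s" using a by auto
      thus ?thesis by blast
    next
      case False
      hence "a = - int (nat (- a))" "nat (-a) \<in> {1..s}" using a by auto
      thus ?thesis by blast
    qed
  qed auto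
  hence "(\<Sum>a\<in>?A. 2 * ?h a) = (\<Sum>a\<in>int ` {..s}. 2 * ?h a) + (\<Sum>a\<in>(\<lambda>k. - int k) ` {1..s}. 2 * ?h a)"
    by (simp only:) (rule sum.union_disjoint, auto)
  also have "(\<Sum>a\<in>int ` {..s}. 2 * ?h a) = (\<Sum>k\<le>s. 2 * disc_height N (real k))"
    by (subst sum.reindex) (auto simp: inj_on_def)
  also have "(\<Sum>a\<in>(\<lambda>k. - int k) ` {1..s}. 2 * ?h a) = (\<Sum>k=1..s. 2 * disc_height N (real k))"
    by (subst sum.reindex) (auto simp: inj_on_def disc_height_def)
  also have "(\<Sum>k=1..s. 2 * disc_height N (real k)) = (\<Sum>k\<le>s. 2 * disc_height N (real k)) - 2 * disc_height N 0"
    by (simp add: atMost_atLeast0 sum.atLeast_Suc_atMost)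
  also have "disc_height N 0 = sqrt (real N)" by (simp add: disc_height_def)
  finally have 2: "(\<Sum>a\<in>?A. 2 * ?h a) = 4 * (\<Sum>k\<le>s. disc_height N (real k)) - 2 * sqrt (real N)"
    by (simp add: sum_distrib_left[symmetric])
  show ?thesis using 1 2 S s1 N1 by linarith
qed

lemma disc_height_cont: "continuous_on A (disc_height N)"
  unfolding disc_height_def by (intro continuous_intros)

text \<open>The number \<open>pi / 4\<close>, which is also the value at 1 of the L-function of
  \<open>chi4\<close>; its positivity is what permits the division in
  \<open>mertens_full_bound\<close>.\<close>

definition quarter_disc_area :: real where
  "quarter_disc_area = integral {0..1} (disc_height 1)"

lemma quarter_disc_area_pos: "quarter_disc_area > 0"
proof -
  have nn: "disc_height 1 x \<ge> 0" for x by (simp add: disc_height_def)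
  have "quarter_disc_area \<ge> 0" unfolding quarter_disc_area_def
    by (intro integral_nonneg integrable_continuous_real disc_height_cont nn)
  moreover have "quarter_disc_area \<noteq> 0"
  proof
    assume "quarter_disc_area = 0"
    hence "disc_height 1 0 = 0" unfolding quarter_disc_area_def
      by (subst (asm) integral_eq_0_iff) (auto simp: nn disc_height_cont)
    thus False by (simp add: disc_height_def)
  qed
  ultimately show ?thesis by simp
qed

lemma integral_disc_height:
  assumes N: "N > 0" and X: "X \<ge> sqrt N"
  shows "integral {0..X} (disc_height N) = N * quarter_disc_area"
proof -
  have int: "disc_height M integrable_on {a..b}" for M a b :: real
    by (intro integrable_continuous_real disc_height_cont)
  have "(disc_height N has_integral integral {0..sqrt N} (disc_height N)) {0..sqrt N}"
    using int by (rule integrable_integral)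
  from has_integral_stretch_real[OF this, of "sqrt N"]
  have "((\<lambda>x. disc_height N (sqrt N * x)) has_integral (1 / sqrt N) * integral {0..sqrt N} (disc_height N)) {0..1}"
    using N by simp
  also have "(\<lambda>x. disc_height N (sqrt N * x)) = (\<lambda>x. sqrt N * disc_height 1 x)"
  proof
    fix x
    have "max 0 (N - (sqrt N * x)\<^sup>2) = N * max 0 (1 - x\<^sup>2)"
      using N by (simp add: power_mult_distrib max_mult_distrib_left right_diff_distrib)
    thus "disc_height N (sqrt N * x) = sqrt N * disc_height 1 x"
      unfolding disc_height_def by (simp add: real_sqrt_mult)
  qed
  finally have "integral {0..1} (\<lambda>x. sqrt N * disc_height 1 x) = (1 / sqrt N) * integral {0..sqrt N} (disc_height N)"
    by (rule integral_unique)
  hence "sqrt N * quarter_disc_area = (1 / sqrt N) * integral {0..sqrt N} (disc_height N)"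
    by (simp add: quarter_disc_area_def)
  hence "integral {0..sqrt N} (disc_height N) = N * quarter_disc_area"
    using N by (simp add: field_simps)
  moreover have "integral {0..X} (disc_height N) = integral {0..sqrt N} (disc_height N) + integral {sqrt N..X} (disc_height N)"
    by (rule Henstock_Kurzweil_Integration.integral_combine[symmetric]) (use N X int in auto)
  moreover have "integral {sqrt N..X} (disc_height N) = integral {sqrt N..X} (\<lambda>_. 0)"
  proof (rule integral_cong)
    fix x assume "x \<in> {sqrt N..X}"
    hence "(sqrt N)\<^sup>2 \<le> x\<^sup>2" using N by (intro power_mono) auto
    thus "disc_height N x = 0" using N by (simp add: disc_height_def)
  qed
  ultimately show ?thesis by simp
qed

text \<open>For a decreasing function the sum exceeds the integral by an amount between 0 and the
  first term, here \<open>sqrt N\<close>. Four such errors together with the 6 of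
  \<open>sum_r2_disc_height\<close> make 10.\<close>

lemma sum_r2_asymp: "\<bar>sum_r2 N - 4 * quarter_disc_area * real N\<bar> \<le> 10 * sqrt (real N)"
proof (cases "N = 0")
  case True
  thus ?thesis by (simp add: sum_r2_def)
next
  case False
  define s where "s = nat \<lfloor>sqrt (real N)\<rfloor>"
  have s2: "sqrt (real N) \<le> real (Suc s)" unfolding s_def by simp linarith
  interpret A: antimono_fun_sum_integral_diff "disc_height (real N)"
  proof
    fix x y :: real assume "0 \<le> x" "x \<le> y"
    hence "x\<^sup>2 \<le> y\<^sup>2" by (intro power_mono)
    thus "disc_height (real N) x \<ge> disc_height (real N) y" unfolding disc_height_def by simp
  qed (auto simp: disc_height_cont, simp add: disc_height_def)
  \<comment> \<open>Going on to \<open>Suc s\<close> puts the whole quarter disc under the integral,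
    and the extra summand vanishes.\<close>
  have "A.sum_integral_diff_series (Suc s) \<le> A.sum_integral_diff_series 0"
    by (rule A.sum_integral_diff_series_antimono) simp
  moreover have "A.sum_integral_diff_series (Suc s) \<ge> 0" by (rule A.sum_integral_diff_series_nonneg)
  moreover have "A.sum_integral_diff_series 0 = sqrt (real N)"
    by (simp add: A.sum_integral_diff_series_def disc_height_def)
  moreover have "A.sum_integral_diff_series (Suc s) = (\<Sum>k\<le>Suc s. disc_height N (real k)) - real N * quarter_disc_area"
    unfolding A.sum_integral_diff_series_def using False s2 by (subst integral_disc_height) auto
  moreover have "disc_height N (real (Suc s)) = 0"
  proof -
    have "(sqrt (real N))\<^sup>2 \<le> (real (Suc s))\<^sup>2" using s2 by (intro power_mono) auto
    thus ?thesis by (simp add: disc_height_def)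
  qed
  ultimately have A: "\<bar>(\<Sum>k\<le>s. disc_height N (real k)) - real N * quarter_disc_area\<bar> \<le> sqrt (real N)"
    by simp
  moreover have "\<bar>sum_r2 N - 4 * (\<Sum>k\<le>s. disc_height N (real k))\<bar> \<le> 6 * sqrt (real N)"
    using False s_def by (intro sum_r2_disc_height) auto
  ultimately show ?thesis using A unfolding mult.assoc mult.commute[of quarter_disc_area] by linarith
qed

section \<open>Chebyshev and Mertens estimates\<close>

lemma prod_primes_dvd:
  assumes "finite A" "\<And>p. p \<in> A \<Longrightarrow> prime p" "\<And>p. p \<in> A \<Longrightarrow> p dvd (n::nat)"
  shows "\<Prod>A dvd n"
  using assms
proof (induction A rule: finite_induct)
  case (insert p A)
  have "coprime p (\<Prod>A)"
    using insert by (intro prod_coprime_right) (metis insert_iff primes_coprime)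
  thus ?case using insert by (auto intro: divides_mult)
qed auto

lemma power_le_fact_exp: "0 \<le> x \<Longrightarrow> x ^ n \<le> fact n * exp x" for x :: real
proof -
  assume x: "0 \<le> x"
  have "(\<Sum>k\<in>{n}. x ^ k /\<^sub>R fact k) \<le> (\<Sum>k. x ^ k /\<^sub>R fact k)"
    by (rule sum_le_suminf) (use x in \<open>auto intro: summable_exp\<close>)
  thus ?thesis by (simp add: exp_def field_simps)
qed

text \<open>A weak form of Stirling's formula, \<open>L ^ L \<le> exp L * fact L\<close>, applied to
  the bound \<open>(N + L) ^ L / fact L\<close>.\<close>

lemma ln_binomial_le:
  assumes "L \<ge> 1"
  shows "ln (real ((N + L) choose L)) \<le> real L * (1 + ln ((real N + real L) / real L))"
proof -
  have "real (((N + L) choose L) * fact L) \<le> real ((N + L) ^ L)"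
    using binomial_fact_pow by (simp only: of_nat_le_iff)
  hence 1: "real ((N + L) choose L) * fact L \<le> (real N + real L) ^ L" by simp
  have 2: "real L ^ L \<le> exp (real L) * fact L"
    using power_le_fact_exp[of "real L" L] by (simp add: mult.commute)
  have "real ((N + L) choose L) * real L ^ L \<le> real ((N + L) choose L) * (exp (real L) * fact L)"
    by (intro mult_left_mono 2) auto
  also have "\<dots> \<le> exp (real L) * (real N + real L) ^ L" using mult_left_mono[OF 1, of "exp (real L)"] by (simp add: mult_ac)
  finally have "real ((N + L) choose L) \<le> exp (real L) * ((real N + real L) / real L) ^ L"
    using assms by (simp add: field_simps)
  hence "ln (real ((N + L) choose L)) \<le> ln (exp (real L) * ((real N + real L) / real L) ^ L)"
    using assms by (subst ln_le_cancel_iff) auto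
  also have "\<dots> = real L + real L * ln ((real N + real L) / real L)"
    using assms by (subst ln_mult) (auto simp: ln_realpow)
  finally show ?thesis by (simp add: algebra_simps)
qed

text \<open>For short intervals this is Brun--Titchmarsh up to a factor logarithmic in \<open>N / L\<close>; that
  loss is affordable since \<open>N / L\<close> stays below a power of \<open>u\<close> in the application.\<close>

lemma sum_ln_primes_interval_le:
  assumes "1 \<le> L" "L \<le> N"
  shows "(\<Sum>p | prime p \<and> N < p \<and> p \<le> N + L. ln (real p)) \<le> real L * (1 + ln ((real N + real L) / real L))"
proof -
  let ?A = "{p. prime p \<and> N < p \<and> p \<le> N + L}"
  have fin: "finite ?A" by simp
  have dvd: "\<Prod>?A dvd ((N + L) choose L)"
  proof (rule prod_primes_dvd[OF fin])
    fix p assume p: "p \<in> ?A"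
    have "p dvd fact (N + L)" using p by (simp add: prime_dvd_fact_iff)
    also have "fact (N + L) = fact L * fact N * ((N + L) choose L)"
      using binomial_fact_lemma[of L "N + L"] by simp
    finally show "p dvd ((N + L) choose L)"
      using p assms by (auto simp: prime_dvd_mult_iff prime_dvd_fact_iff)
  qed auto
  have "(\<Sum>p\<in>?A. ln (real p)) = ln (\<Prod>p\<in>?A. real p)"
    by (rule ln_prod[symmetric]) (auto simp: prime_gt_0_nat)
  also have "(\<Prod>p\<in>?A. real p) = real (\<Prod>?A)" by simp
  also have "ln (real (\<Prod>?A)) \<le> ln (real ((N + L) choose L))"
  proof (subst ln_le_cancel_iff)
    show "real (\<Prod>?A) > 0" using fin by (auto simp: prime_gt_0_nat intro!: prod_pos)
    show "real ((N + L) choose L) > 0" by simp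
    show "real (\<Prod>?A) \<le> real ((N + L) choose L)"
      using dvd by (simp only: of_nat_le_iff) (rule dvd_imp_le, auto)
  qed
  also have "\<dots> \<le> real L * (1 + ln ((real N + real L) / real L))" by (rule ln_binomial_le[OF assms(1)])
  finally show ?thesis .
qed

lemma ln_two_le_one: "ln (2::real) \<le> 1"
  using ln_add_one_self_le_self[of 1] by simp

text \<open>With \<open>L = n div 2\<close>, the primes up to \<open>L\<close> cost
  \<open>4 * L\<close> by induction, those in \<open>(L, 2 * L]\<close> cost \<open>2 * L\<close> by
  the binomial estimate, and the possible prime \<open>2 * L + 1\<close> costs \<open>2 * L\<close>.
  The sum \<open>8 * L\<close> is at most \<open>4 * n\<close>.\<close>

lemma sum_ln_primes_le: "(\<Sum>p | prime p \<and> p \<le> n. ln (real p)) \<le> 4 * real n"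
proof (induction n rule: less_induct)
  case (less n)
  show ?case
  proof (cases "n < 2")
    case True
    hence e: "{p. prime p \<and> p \<le> n} = {}" by (auto dest: prime_ge_2_nat)
    show ?thesis unfolding e by simp
  next
    case False
    define L where "L = n div 2"
    have L: "L \<ge> 1" "n \<le> 2 * L + 1" "2 * L \<le> n" "L < n" using False unfolding L_def by auto
    let ?f = "\<lambda>A. (\<Sum>p | prime p \<and> p \<in> A. ln (real p))"
    have nn: "ln (real p) \<ge> 0" if "prime p" for p using prime_ge_1_nat[OF that] by simp
    have "(\<Sum>p | prime p \<and> p \<le> n. ln (real p)) \<le>
       (\<Sum>p\<in>{p. prime p \<and> p \<le> L} \<union> {p. prime p \<and> L < p \<and> p \<le> L + L} \<union> {2 * L + 1}. ln (real p))"
      using L nn by (intro sum_mono2) auto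
    also have "\<dots> \<le> (\<Sum>p | prime p \<and> p \<le> L. ln (real p)) + (\<Sum>p | prime p \<and> L < p \<and> p \<le> L + L. ln (real p)) + ln (real (2 * L + 1))"
    proof -
      have "(\<Sum>p\<in>{p. prime p \<and> p \<le> L} \<union> {p. prime p \<and> L < p \<and> p \<le> L + L} \<union> {2 * L + 1}. ln (real p)) =
        (\<Sum>p\<in>{p. prime p \<and> p \<le> L} \<union> {p. prime p \<and> L < p \<and> p \<le> L + L}. ln (real p)) + (\<Sum>p\<in>{2 * L + 1}. ln (real p))"
        by (rule sum.union_disjoint) auto
      also have "(\<Sum>p\<in>{p. prime p \<and> p \<le> L} \<union> {p. prime p \<and> L < p \<and> p \<le> L + L}. ln (real p)) =
        (\<Sum>p | prime p \<and> p \<le> L. ln (real p)) + (\<Sum>p | prime p \<and> L < p \<and> p \<le> L + L. ln (real p))"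
        by (rule sum.union_disjoint) auto
      finally show ?thesis by simp
    qed
    also have "\<dots> \<le> 4 * real L + 2 * real L + 2 * real L"
    proof (intro add_mono)
      show "(\<Sum>p | prime p \<and> p \<le> L. ln (real p)) \<le> 4 * real L" using less.IH L by blast
      have "(\<Sum>p | prime p \<and> L < p \<and> p \<le> L + L. ln (real p)) \<le> real L * (1 + ln 2)"
        using sum_ln_primes_interval_le[of L L] L by (simp add: field_simps)
      also have "\<dots> \<le> real L * 2" using ln_two_le_one by (intro mult_left_mono) auto
      finally show "(\<Sum>p | prime p \<and> L < p \<and> p \<le> L + L. ln (real p)) \<le> 2 * real L" by simp
      show "ln (real (2 * L + 1)) \<le> 2 * real L"
        using ln_add_one_self_le_self[of "2 * real L"] by (simp add: add.commute)
    qed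
    also have "\<dots> \<le> 4 * real n" using L by linarith
    finally show ?thesis .
  qed
qed

text \<open>The saving of one halving step in the next induction. Being linear in \<open>b\<close>,
  it lets the final constant grow only like \<open>1 / (1 - a)\<close>; this factor later becomes
  the denominator of \<open>exp \<xi> / \<xi>\<close>.\<close>

lemma one_minus_two_powr_ge:
  fixes b :: real
  assumes "0 \<le> b" "b \<le> 1"
  shows "1 - 2 powr (-b) \<ge> b / 3"
proof -
  define v where "v = b * ln 2"
  have l: "2/3 \<le> ln (2::real)" by (rule ln2_ge_two_thirds)
  have v: "v \<ge> 0" "v \<le> 1" unfolding v_def using assms ln_two_le_one
    by (simp, intro mult_le_one) auto
  have "2 powr (-b) = exp (- v)" by (simp add: powr_def v_def)
  also have "\<dots> = 1 / exp v" by (simp add: exp_minus field_simps)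
  also have "\<dots> \<le> 1 / (1 + v)" using v exp_ge_add_one_self[of v] by (intro divide_left_mono) auto
  finally have "1 - 2 powr (-b) \<ge> 1 - 1 / (1 + v)" by simp
  also have "1 - 1 / (1 + v) = v / (1 + v)" using v by (simp add: field_simps)
  also have "v / (1 + v) \<ge> v / 2" using v by (intro divide_left_mono) auto
  also have "v / 2 \<ge> b / 3" unfolding v_def using mult_left_mono[OF l assms(1)] by simp
  finally show ?thesis by simp
qed

text \<open>By halving: the primes in the upper half contribute at most \<open>8 * n powr b\<close>
  with \<open>b = 1 - a\<close>, and passing to the lower half saves
  \<open>24 / b * (1 - 2 powr (-b)) \<ge> 8\<close> times \<open>n powr b\<close>. This determines
  the 24.\<close>

lemma sum_ln_primes_powr_le:
  fixes a :: real
  assumes "0 \<le> a" "a < 1"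
  shows "(\<Sum>p | prime p \<and> p \<le> n. ln (real p) * real p powr (-a)) \<le> 24 / (1 - a) * real n powr (1 - a)"
proof (induction n rule: less_induct)
  case (less n)
  define b where "b = 1 - a"
  have b: "0 < b" "b \<le> 1" using assms by (auto simp: b_def)
  show ?case
  proof (cases "n = 0")
    case True
    hence e: "{p. prime p \<and> p \<le> n} = {}" by (auto dest: prime_ge_2_nat)
    show ?thesis unfolding e using assms by simp
  next
    case False
    define L where "L = n div 2"
    have "L < n" "2 * L \<le> n" "n < 2 * (L + 1)" using False unfolding L_def by auto
    hence "L < n" "real (2 * L) \<le> real n" "real n < real (2 * (L + 1))" by (simp_all only: of_nat_le_iff of_nat_less_iff)
    hence L: "L < n" "real L \<le> real n / 2" "real L + 1 > real n / 2" by auto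
    have n0: "real n > 0" using False by simp
    let ?A = "{p. prime p \<and> p \<le> L}" and ?B = "{p. prime p \<and> L < p \<and> p \<le> n}"
    have "{p. prime p \<and> p \<le> n} = ?A \<union> ?B" using L by auto
    hence "(\<Sum>p | prime p \<and> p \<le> n. ln (real p) * real p powr (-a)) =
       (\<Sum>p\<in>?A. ln (real p) * real p powr (-a)) + (\<Sum>p\<in>?B. ln (real p) * real p powr (-a))"
      by (simp only:) (rule sum.union_disjoint, auto)
    also have "(\<Sum>p\<in>?A. ln (real p) * real p powr (-a)) \<le> 24 / b * real L powr b"
      using less.IH[OF L(1)] by (simp add: b_def)
    also have "\<dots> \<le> 24 / b * (real n / 2) powr b"
      using b L by (intro mult_left_mono powr_mono2) auto
    also have "(real n / 2) powr b = real n powr b * 2 powr (-b)"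
      by (simp add: powr_divide powr_minus field_simps)
    also have "(\<Sum>p\<in>?B. ln (real p) * real p powr (-a)) \<le> (\<Sum>p\<in>?B. ln (real p) * (real n / 2) powr (-a))"
    proof (intro sum_mono mult_left_mono)
      fix p assume p: "p \<in> ?B"
      show "0 \<le> ln (real p)" using p prime_ge_1_nat[of p] by auto
      have "real n / 2 \<le> real p" using p L by simp
      thus "real p powr (-a) \<le> (real n / 2) powr (-a)" using n0 assms by (intro powr_mono2') auto
    qed
    also have "\<dots> = (\<Sum>p\<in>?B. ln (real p)) * (real n / 2) powr (-a)" by (simp add: sum_distrib_right)
    also have "\<dots> \<le> (4 * real n) * (real n / 2) powr (-a)"
    proof (rule mult_right_mono)
      have "(\<Sum>p\<in>?B. ln (real p)) \<le> (\<Sum>p | prime p \<and> p \<le> n. ln (real p))"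
        by (intro sum_mono2) (auto dest: prime_ge_1_nat)
      thus "(\<Sum>p\<in>?B. ln (real p)) \<le> 4 * real n" using sum_ln_primes_le[of n] by linarith
    qed auto
    also have "(4 * real n) * (real n / 2) powr (-a) = 4 * 2 powr a * real n powr b"
      using n0 by (simp add: b_def powr_divide powr_minus powr_diff field_simps)
    also have "\<dots> \<le> 4 * 2 powr 1 * real n powr b"
      using assms by (intro mult_left_mono mult_right_mono powr_mono) auto
    finally have "(\<Sum>p | prime p \<and> p \<le> n. ln (real p) * real p powr (-a)) \<le>
       real n powr b * (24 / b * 2 powr (-b) + 8)" by (simp add: algebra_simps)
    also have "\<dots> \<le> real n powr b * (24 / b)"
    proof (rule mult_left_mono)
      have "24 / b * (1 - 2 powr (-b)) \<ge> 24 / b * (b / 3)"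
        using b by (intro mult_left_mono one_minus_two_powr_ge) auto
      thus "24 / b * 2 powr (-b) + 8 \<le> 24 / b" using b by (simp add: right_diff_distrib)
    qed auto
    finally show ?thesis by (simp add: b_def mult.commute)
  qed
qed

section \<open>Mertens' theorem for the weights \<open>1 + chi4\<close>\<close>

lemma r2_area_pos: "4 * quarter_disc_area > 0"
  using quarter_disc_area_pos by simp

lemma real_le_self_sqrt: "x \<ge> 1 \<Longrightarrow> sqrt x \<le> x"
  by (rule real_le_lsqrt) (simp_all add: self_le_power)

lemma ln_le_two_sqrt: "x > 0 \<Longrightarrow> ln x \<le> 2 * sqrt x"
  using ln_le_minus_one[of "sqrt x"] by (simp add: ln_sqrt)

lemma sum_r2_le: "sum_r2 N \<le> (4 * quarter_disc_area + 10) * real N"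
proof (cases "N = 0")
  case False
  hence "sqrt (real N) \<le> real N" by (intro real_le_self_sqrt) simp
  thus ?thesis using sum_r2_asymp[of N] by (simp add: algebra_simps abs_le_iff)
qed (simp add: sum_r2_def)

lemma ln_diff_le_harmonic:
  assumes "1 \<le> n" "n \<le> N"
  shows "ln (real N) - ln (real n) \<le> (\<Sum>m\<in>{n..<N}. 1 / real m)"
  using assms(2)
proof (induction N rule: dec_induct)
  case (step k)
  have k: "real k > 0" using step assms by simp
  have "ln (real (Suc k)) - ln (real k) = ln (1 + 1 / real k)"
  proof -
    have "1 + 1 / real k = real (Suc k) / real k" using k by (simp add: field_simps)
    thus ?thesis using k by (simp only: ln_div) (simp add: ln_div)
  qed
  also have "\<dots> \<le> 1 / real k" using k by (intro ln_add_one_self_le_self) auto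
  finally show ?case using step by (simp add: sum.atLeastLessThan_Suc)
qed simp

text \<open>The defect \<open>ln N - ln n\<close> is at most a sum of \<open>1 / m\<close> over
  \<open>m \<ge> n\<close>. After exchanging the summations it contributes only the sum of
  \<open>sum_r2 m / m\<close>, which is of order \<open>N\<close>. The 30 consists of 10 from
  \<open>sum_r2_le\<close> and 20 from the disc error multiplied by \<open>ln N\<close>.\<close>

lemma sum_r2_mult_ln_asymp:
  assumes "N \<ge> 1"
  shows "\<bar>(\<Sum>n=1..N. real (r2 n) * ln (real n)) - 4 * quarter_disc_area * (real N * ln (real N))\<bar>
           \<le> (4 * quarter_disc_area + 30) * real N"
proof -
  define c where "c = 4 * quarter_disc_area"
  define Q where "Q = (\<Sum>n=1..N. real (r2 n) * ln (real n))"
  define l where "l = ln (real N)"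
  have c: "c > 0" using r2_area_pos by (simp add: c_def)
  have l: "l \<ge> 0" using assms by (simp add: l_def)
  have sl: "sqrt (real N) * l \<le> 2 * real N"
  proof -
    have "sqrt (real N) * l \<le> sqrt (real N) * (2 * sqrt (real N))"
      unfolding l_def using assms by (intro mult_left_mono ln_le_two_sqrt) auto
    also have "\<dots> = 2 * real N" by simp
    finally show ?thesis .
  qed
  have S: "\<bar>sum_r2 N * l - c * (real N * l)\<bar> \<le> 20 * real N"
  proof -
    have "\<bar>sum_r2 N * l - c * (real N * l)\<bar> = \<bar>sum_r2 N - c * real N\<bar> * l"
      using l by (simp add: abs_mult_pos left_diff_distrib[symmetric] mult.assoc[symmetric])
    also have "\<dots> \<le> 10 * sqrt (real N) * l" using sum_r2_asymp[of N] l unfolding c_def by (intro mult_right_mono)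
    finally show ?thesis using sl by linarith
  qed
  have eq: "sum_r2 N * l - Q = (\<Sum>n=1..N. real (r2 n) * (l - ln (real n)))"
    by (simp add: sum_r2_def Q_def sum_distrib_right sum_subtractf[symmetric] right_diff_distrib)
  have lo: "sum_r2 N * l - Q \<ge> 0"
    unfolding eq by (intro sum_nonneg mult_nonneg_nonneg) (auto simp: l_def)
  have "sum_r2 N * l - Q \<le> (\<Sum>n=1..N. real (r2 n) * (\<Sum>m=1..N. if n \<le> m then 1 / real m else 0))"
    unfolding eq
  proof (intro sum_mono mult_left_mono)
    fix n assume n: "n \<in> {1..N}"
    have "l - ln (real n) \<le> (\<Sum>m\<in>{n..<N}. 1 / real m)" unfolding l_def using n by (intro ln_diff_le_harmonic) auto
    also have "\<dots> \<le> (\<Sum>m\<in>{m\<in>{1..N}. n \<le> m}. 1 / real m)" using n by (intro sum_mono2) auto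
    also have "\<dots> = (\<Sum>m=1..N. if n \<le> m then 1 / real m else 0)" by (rule sum.inter_filter) simp
    finally show "l - ln (real n) \<le> (\<Sum>m=1..N. if n \<le> m then 1 / real m else 0)" .
  qed auto
  also have "\<dots> = (\<Sum>n=1..N. \<Sum>m=1..N. if n \<le> m then real (r2 n) / real m else 0)"
    unfolding sum_distrib_left by (intro sum.cong refl) auto
  also have "\<dots> = (\<Sum>m=1..N. \<Sum>n=1..N. if n \<le> m then real (r2 n) / real m else 0)"
    by (rule sum.swap)
  also have "\<dots> = (\<Sum>m=1..N. sum_r2 m / real m)"
  proof (rule sum.cong[OF refl])
    fix m assume m: "m \<in> {1..N}"
    have "(\<Sum>n=1..N. if n \<le> m then real (r2 n) / real m else 0) = (\<Sum>n\<in>{n\<in>{1..N}. n \<le> m}. real (r2 n) / real m)"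
      by (rule sum.inter_filter[symmetric]) simp
    also have "{n\<in>{1..N}. n \<le> m} = {1..m}" using m by auto
    finally show "(\<Sum>n=1..N. if n \<le> m then real (r2 n) / real m else 0) = sum_r2 m / real m"
      by (simp add: sum_r2_def sum_divide_distrib)
  qed
  also have "\<dots> \<le> (\<Sum>m=1..N. c + 10)"
  proof (rule sum_mono)
    fix m assume "m \<in> {1..N}"
    thus "sum_r2 m / real m \<le> c + 10" using sum_r2_le[of m] by (simp add: field_simps c_def)
  qed
  also have "\<dots> = (c + 10) * real N" by simp
  finally have hi: "sum_r2 N * l - Q \<le> (c + 10) * real N" .
  have "(c + 10) * real N + 20 * real N = (c + 30) * real N" by (simp add: algebra_simps)
  moreover have "c * real N \<ge> 0" using c by simp
  ultimately have "\<bar>Q - c * (real N * l)\<bar> \<le> (c + 30) * real N"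
    using S lo hi unfolding abs_le_iff by linarith
  thus ?thesis by (simp add: c_def Q_def l_def)
qed

text \<open>Since \<open>N / q \<ge> 1\<close>, the bounded effect of rounding the quotient is
  absorbed into the square root.\<close>

lemma sum_r2_div_asymp:
  assumes "1 \<le> q" "q \<le> N"
  shows "\<bar>sum_r2 (N div q) - 4 * quarter_disc_area * (real N / real q)\<bar> \<le> (4 * quarter_disc_area + 10) * sqrt (real N / real q)"
proof -
  define c where "c = 4 * quarter_disc_area"
  have c: "c > 0" using r2_area_pos by (simp add: c_def)
  have "real (N div q) = real_of_int \<lfloor>real N / real q\<rfloor>" by (simp add: floor_divide_of_nat_eq)
  hence fl: "real (N div q) \<le> real N / real q" "real N / real q \<le> real (N div q) + 1" by linarith+
  have "real N / real q \<ge> 1" using assms by simp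
  hence s1: "sqrt (real N / real q) \<ge> 1" by simp
  have "\<bar>sum_r2 (N div q) - c * real (N div q)\<bar> \<le> 10 * sqrt (real (N div q))"
    unfolding c_def by (rule sum_r2_asymp)
  also have "\<dots> \<le> 10 * sqrt (real N / real q)" using fl by simp
  finally have 1: "\<bar>sum_r2 (N div q) - c * real (N div q)\<bar> \<le> 10 * sqrt (real N / real q)" .
  have "\<bar>c * real (N div q) - c * (real N / real q)\<bar> = c * \<bar>real (N div q) - real N / real q\<bar>"
    using c by (metis abs_mult abs_of_pos right_diff_distrib)
  also have "\<dots> \<le> c * sqrt (real N / real q)"
  proof (rule mult_left_mono)
    have "\<bar>real (N div q) - real N / real q\<bar> \<le> 1" using fl by linarith
    thus "\<bar>real (N div q) - real N / real q\<bar> \<le> sqrt (real N / real q)" using s1 by linarith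
  qed (use c in simp)
  finally show ?thesis using 1 unfolding c_def[symmetric] by (simp add: algebra_simps)
qed

lemma geometric_tail_le:
  fixes x :: real
  assumes "0 \<le> x" "x < 1" "finite K" "\<And>k. k \<in> K \<Longrightarrow> j \<le> k"
  shows "(\<Sum>k\<in>K. x ^ k) \<le> x ^ j / (1 - x)"
proof -
  have "(\<Sum>k\<in>K. x ^ k) = (\<Sum>k\<in>(\<lambda>i. i - j) ` K. x ^ (k + j))"
  proof (subst sum.reindex)
    show "inj_on (\<lambda>i. i - j) K" using assms(4) by (intro inj_onI) (metis le_add_diff_inverse2)
  qed (use assms(4) in \<open>auto intro!: sum.cong\<close>)
  also have "\<dots> = x ^ j * (\<Sum>k\<in>(\<lambda>i. i - j) ` K. x ^ k)"
    by (simp add: power_add sum_distrib_left mult.commute)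
  also have "(\<Sum>k\<in>(\<lambda>i. i - j) ` K. x ^ k) \<le> (\<Sum>k. x ^ k)"
    using assms by (intro sum_le_suminf) (auto intro: summable_geometric)
  also have "(\<Sum>k. x ^ k) = 1 / (1 - x)" using assms by (simp add: suminf_geometric)
  finally show ?thesis using assms by (simp add: mult_left_mono)
qed

lemma chi4_coeff_bounds: "0 \<le> 1 + chi4 p ^ k" "1 + chi4 p ^ k \<le> 2"
  using power_le_one[of "\<bar>chi4 p\<bar>" k] chi4_cases[of p] by (auto simp: power_abs[symmetric] abs_le_iff)

text \<open>The bound \<open>k \<le> N\<close> already follows from \<open>p ^ k \<le> N\<close>; it
  makes the index set visibly finite.\<close>

definition mertens_full :: "nat \<Rightarrow> real" where
  "mertens_full N = (\<Sum>p | prime p \<and> p \<le> N. \<Sum>k | k \<in> {1..N} \<and> p ^ k \<le> N. (1 + chi4 p ^ k) * ln (real p) / real p ^ k)"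

definition mertens_prime :: "nat \<Rightarrow> real" where
  "mertens_prime N = (\<Sum>p | prime p \<and> p \<le> N. (1 + chi4 p) * ln (real p) / real p)"

lemma inverse_sqrt_two_le: "1 / sqrt 2 \<le> (3/4 :: real)"
proof -
  have "sqrt 2 \<ge> (4/3 :: real)" by (rule real_le_rsqrt) (simp add: power2_eq_square)
  thus ?thesis by (simp add: field_simps)
qed

text \<open>Two evaluations of the sum of \<open>r2 n * ln n\<close> are compared: directly, and
  through \<open>sum_r2_mult_ln\<close> with the lattice-point count inserted. The square-root error
  of the count sums to a multiple of \<open>sqrt N\<close> times the sum of
  \<open>ln p / sqrt p\<close>. That is \<open>O(N)\<close> by Chebyshev, hence \<open>O(1)\<close>
  after division by \<open>4 * quarter_disc_area * N\<close>.\<close>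

lemma mertens_full_bound: "\<exists>C. \<forall>N\<ge>1. \<bar>mertens_full N - ln (real N)\<bar> \<le> C"
proof -
  define c where "c = 4 * quarter_disc_area"
  have c: "c > 0" using r2_area_pos by (simp add: c_def)
  \<comment> \<open>Equals \<open>8 * (c + 10) * (24 / (1 - 1/2))\<close>, the constant produced by
    \<open>sum_ln_primes_powr_le\<close> at exponent 1/2.\<close>
  define D where "D = 2 * (c + 10) * 192"
  have "\<bar>mertens_full N - ln (real N)\<bar> \<le> (D + (c + 30)) / c" if N: "N \<ge> 1" for N
  proof -
    let ?P = "{p. prime p \<and> p \<le> N}" and ?K = "\<lambda>p. {k. k \<in> {1..N} \<and> p ^ k \<le> N}"
    let ?h = "\<lambda>p k. (1 + chi4 p ^ k) * ln (real p)"
    define Q where "Q = (\<Sum>n=1..N. real (r2 n) * ln (real n))"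
    have lnp: "ln (real p) \<ge> 0" if "p \<in> ?P" for p using that prime_ge_1_nat[of p] by auto
    have Q1: "Q = (\<Sum>p\<in>?P. \<Sum>k\<in>?K p. ?h p k * sum_r2 (N div p ^ k))"
      unfolding Q_def sum_r2_mult_ln
    proof (rule sum.cong[OF refl], rule sum.mono_neutral_right, goal_cases)
      case (3 p)
      show ?case
      proof
      fix k assume "k \<in> {1..N} - ?K p"
      hence "N div p ^ k = 0" by auto
      thus "?h p k * sum_r2 (N div p ^ k) = 0" by (simp add: sum_r2_def)
      qed
    qed auto
    have M1: "c * real N * mertens_full N = (\<Sum>p\<in>?P. \<Sum>k\<in>?K p. ?h p k * (c * (real N / real (p ^ k))))"
      unfolding mertens_full_def sum_distrib_left by (intro sum.cong refl) (simp add: field_simps)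
    have "\<bar>Q - c * real N * mertens_full N\<bar> = \<bar>\<Sum>p\<in>?P. \<Sum>k\<in>?K p. ?h p k * (sum_r2 (N div p ^ k) - c * (real N / real (p ^ k)))\<bar>"
      unfolding Q1 M1 by (simp add: sum_subtractf[symmetric] right_diff_distrib)
    also have "\<dots> \<le> (\<Sum>p\<in>?P. \<Sum>k\<in>?K p. 2 * ln (real p) * ((c + 10) * (sqrt (real N) * (1 / sqrt (real p)) ^ k)))"
    proof (rule order_trans[OF sum_abs], intro sum_mono order_trans[OF sum_abs])
      fix p k assume p: "p \<in> ?P" and k: "k \<in> ?K p"
      have pk: "1 \<le> p ^ k" using p prime_ge_1_nat by (intro one_le_power) auto
      have "\<bar>sum_r2 (N div p ^ k) - c * (real N / real (p ^ k))\<bar> \<le> (c + 10) * sqrt (real N / real (p ^ k))"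
        unfolding c_def using pk k by (intro sum_r2_div_asymp) auto
      also have "sqrt (real N / real (p ^ k)) = sqrt (real N) * (1 / sqrt (real p)) ^ k"
        by (simp add: real_sqrt_divide real_sqrt_power power_divide)
      finally show "\<bar>?h p k * (sum_r2 (N div p ^ k) - c * (real N / real (p ^ k)))\<bar> \<le>
          2 * ln (real p) * ((c + 10) * (sqrt (real N) * (1 / sqrt (real p)) ^ k))"
        unfolding abs_mult using chi4_coeff_bounds[of p k] lnp[OF p]
        by (intro mult_mono) (auto simp: abs_of_nonneg)
    qed
    also have "\<dots> = (\<Sum>p\<in>?P. 2 * (c + 10) * sqrt (real N) * (ln (real p) * (\<Sum>k\<in>?K p. (1 / sqrt (real p)) ^ k)))"
      unfolding sum_distrib_left by (intro sum.cong refl) (simp add: algebra_simps)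
    also have "\<dots> \<le> (\<Sum>p\<in>?P. 2 * (c + 10) * sqrt (real N) * (ln (real p) * (4 * real p powr (- (1/2)))))"
    proof (intro sum_mono mult_left_mono)
      fix p assume p: "p \<in> ?P"
      define x where "x = 1 / sqrt (real p)"
      have p2: "real p \<ge> 2" using p prime_ge_2_nat[of p] by auto
      have "x \<le> 1 / sqrt 2" unfolding x_def using p2 by (intro divide_left_mono) auto
      also note inverse_sqrt_two_le
      finally have x: "x \<le> 3/4" "x \<ge> 0" by (auto simp: x_def)
      have "(\<Sum>k\<in>?K p. x ^ k) \<le> x ^ 1 / (1 - x)" using x by (intro geometric_tail_le) auto
      also have "\<dots> \<le> 4 * x" using x by (simp add: field_simps) (use mult_left_mono[of x "3/4" x] in simp)
      finally have "(\<Sum>k\<in>?K p. x ^ k) \<le> 4 * x" .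
      moreover have xe: "real p powr (- (1/2)) = x" unfolding x_def using p2 by (simp add: powr_minus powr_half_sqrt field_simps)
      ultimately show "(\<Sum>k\<in>?K p. (1 / sqrt (real p)) ^ k) \<le> 4 * real p powr (- (1/2))"
        unfolding xe x_def[symmetric] by simp
    qed (use c lnp in auto)
    also have "\<dots> = 8 * (c + 10) * sqrt (real N) * (\<Sum>p\<in>?P. ln (real p) * real p powr (- (1/2)))"
      unfolding sum_distrib_left by (intro sum.cong refl) (simp add: algebra_simps)
    also have "\<dots> \<le> 8 * (c + 10) * sqrt (real N) * (24 / (1 - 1/2) * real N powr (1 - 1/2))"
      using c by (intro mult_left_mono sum_ln_primes_powr_le) auto
    also have "\<dots> = D * real N"
    proof -
      define r where "r = sqrt (real N)"
      have h: "real N powr (1 - 1/2) = r" by (simp add: r_def powr_half_sqrt)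
      have "8 * (c + 10) * r * (24 / (1 - 1/2) * r) = D * (r * r)" by (simp add: D_def algebra_simps)
      thus ?thesis unfolding h r_def[symmetric] by (simp add: r_def)
    qed
    finally have 1: "\<bar>Q - c * real N * mertens_full N\<bar> \<le> D * real N" .
    have 2: "\<bar>Q - c * (real N * ln (real N))\<bar> \<le> (c + 30) * real N"
      using sum_r2_mult_ln_asymp[OF N] unfolding c_def Q_def .
    have "\<bar>c * real N * mertens_full N - c * (real N * ln (real N))\<bar> \<le> D * real N + (c + 30) * real N"
      using 1 2 by linarith
    also have "c * real N * mertens_full N - c * (real N * ln (real N)) = (c * real N) * (mertens_full N - ln (real N))"
      by (simp add: algebra_simps)
    also have "\<bar>(c * real N) * (mertens_full N - ln (real N))\<bar> = (c * real N) * \<bar>mertens_full N - ln (real N)\<bar>"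
      using c by (simp add: abs_mult)
    finally have "(c * real N) * \<bar>mertens_full N - ln (real N)\<bar> \<le> (D + (c + 30)) * real N"
      by (simp only: distrib_right)
    hence "(c * \<bar>mertens_full N - ln (real N)\<bar>) * real N \<le> (D + (c + 30)) * real N" by (simp only: mult_ac)
    hence "c * \<bar>mertens_full N - ln (real N)\<bar> \<le> D + (c + 30)"
      by (rule mult_right_le_imp_le) (use N in simp)
    thus ?thesis using c by (simp add: field_simps)
  qed
  thus ?thesis by blast
qed

text \<open>The exponents from 2 on contribute a convergent series:
  \<open>ln p \<le> 2 * sqrt p\<close> compares it with the sum of
  \<open>n powr (-3/2)\<close>.\<close>

lemma mertens_full_minus_prime: "\<exists>C. \<forall>N\<ge>1. mertens_prime N \<le> mertens_full N \<and> mertens_full N \<le> mertens_prime N + C"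
proof -
  have sm: "summable (\<lambda>n. real n powr (-(3/2)))" by (subst summable_real_powr_iff) auto
  define C where "C = 8 * (\<Sum>n. real n powr (-(3/2)))"
  have "mertens_prime N \<le> mertens_full N \<and> mertens_full N \<le> mertens_prime N + C" if N: "N \<ge> 1" for N
  proof -
    let ?P = "{p. prime p \<and> p \<le> N}" and ?K = "\<lambda>p. {k. k \<in> {1..N} \<and> p ^ k \<le> N}"
    let ?h = "\<lambda>p k. (1 + chi4 p ^ k) * ln (real p) / real p ^ k"
    have lnp: "ln (real p) \<ge> 0" if "p \<in> ?P" for p using that prime_ge_1_nat[of p] by auto
    have hn: "?h p k \<ge> 0" if "p \<in> ?P" for p k using lnp[OF that] chi4_coeff_bounds[of p k] by simp
    have sp: "(\<Sum>k\<in>?K p. ?h p k) = ?h p 1 + (\<Sum>k\<in>?K p - {1}. ?h p k)" if "p \<in> ?P" for p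
      using that N by (intro sum.remove) auto
    have eq: "mertens_full N = mertens_prime N + (\<Sum>p\<in>?P. \<Sum>k\<in>?K p - {1}. ?h p k)"
      unfolding mertens_full_def mertens_prime_def sum.distrib[symmetric]
      by (intro sum.cong refl, subst sp) auto
    have "(\<Sum>p\<in>?P. \<Sum>k\<in>?K p - {1}. ?h p k) \<le> (\<Sum>p\<in>?P. 8 * real p powr (-(3/2)))"
    proof (rule sum_mono)
      fix p assume p: "p \<in> ?P"
      have p2: "real p \<ge> 2" using p prime_ge_2_nat[of p] by auto
      define x where "x = 1 / real p"
      have x: "0 \<le> x" "x \<le> 1/2" using p2 by (auto simp: x_def field_simps)
      have "(\<Sum>k\<in>?K p - {1}. ?h p k) \<le> (\<Sum>k\<in>?K p - {1}. (2 * ln (real p)) * x ^ k)"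
      proof (rule sum_mono)
        fix k
        have "?h p k = (1 + chi4 p ^ k) * ln (real p) * x ^ k" by (simp add: x_def power_divide)
        also have "\<dots> \<le> 2 * ln (real p) * x ^ k"
          using chi4_coeff_bounds[of p k] lnp[OF p] x by (intro mult_right_mono) auto
        finally show "?h p k \<le> (2 * ln (real p)) * x ^ k" .
      qed
      also have "\<dots> = 2 * ln (real p) * (\<Sum>k\<in>?K p - {1}. x ^ k)" by (simp add: sum_distrib_left)
      also have "\<dots> \<le> 2 * ln (real p) * (x ^ 2 / (1 - x))"
        using lnp[OF p] x by (intro mult_left_mono geometric_tail_le) auto
      also have "\<dots> \<le> 2 * (2 * sqrt (real p)) * (2 * x ^ 2)"
      proof (intro mult_mono)
        show "ln (real p) \<le> 2 * sqrt (real p)" using p2 by (intro ln_le_two_sqrt) simp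
        have "x ^ 2 / (1 - x) \<le> x ^ 2 / (1/2)" using x by (intro divide_left_mono) auto
        thus "x ^ 2 / (1 - x) \<le> 2 * x ^ 2" by simp
      qed (use x lnp[OF p] in auto)
      also have "\<dots> = 8 * (real p powr (1/2) * real p powr (-2))"
        using p2 by (simp add: x_def powr_half_sqrt powr_minus powr_realpow field_simps)
      also have "real p powr (1/2) * real p powr (-2) = real p powr (-(3/2))"
        by (simp flip: powr_add)
      finally show "(\<Sum>k\<in>?K p - {1}. ?h p k) \<le> 8 * real p powr (-(3/2))" .
    qed
    also have "\<dots> = 8 * (\<Sum>p\<in>?P. real p powr (-(3/2)))" by (simp add: sum_distrib_left)
    also have "\<dots> \<le> C" unfolding C_def using sm by (intro mult_left_mono sum_le_suminf) auto
    finally have "(\<Sum>p\<in>?P. \<Sum>k\<in>?K p - {1}. ?h p k) \<le> C" .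
    moreover have "(\<Sum>p\<in>?P. \<Sum>k\<in>?K p - {1}. ?h p k) \<ge> 0"
      by (intro sum_nonneg) (use hn in blast)
    ultimately show ?thesis using eq by simp
  qed
  thus ?thesis by blast
qed

text \<open>Difference of two Mertens sums. It guarantees weight in every interval that is long
  enough on the logarithmic scale, and all lower bounds for cumulants of the right order rest on it.
  The 1 in the constant pays for rounding \<open>y\<close> down to \<open>N\<close>, since
  \<open>y \<le> 2 * N\<close>.\<close>

lemma mertens_interval_lower:
  "\<exists>C\<ge>0. \<forall>w y. 1 \<le> w \<longrightarrow> w \<le> y \<longrightarrow>
     (\<Sum>p | prime p \<and> w < real p \<and> real p \<le> y. (1 + chi4 p) * ln (real p) / real p) \<ge> ln (y / w) - C"
proof -
  obtain C1 where C1: "\<And>N. N \<ge> 1 \<Longrightarrow> \<bar>mertens_full N - ln (real N)\<bar> \<le> C1" using mertens_full_bound by blast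
  obtain C2 where C2: "\<And>N. N \<ge> 1 \<Longrightarrow> mertens_prime N \<le> mertens_full N \<and> mertens_full N \<le> mertens_prime N + C2"
    using mertens_full_minus_prime by blast
  have C1': "C1 \<ge> 0" using C1[of 1] by linarith
  have C2': "C2 \<ge> 0" using C2[of 1] by linarith
  have "(\<Sum>p | prime p \<and> w < real p \<and> real p \<le> y. (1 + chi4 p) * ln (real p) / real p) \<ge> ln (y / w) - (2 * C1 + C2 + 1)"
    if w: "1 \<le> w" "w \<le> y" for w y
  proof -
    define N M where "N = nat \<lfloor>y\<rfloor>" and "M = nat \<lfloor>w\<rfloor>"
    have NM: "1 \<le> M" "M \<le> N" unfolding N_def M_def using w by (auto simp: le_nat_iff floor_mono nat_mono)
    have b: "real N \<le> y" "y < real N + 1" "real M \<le> w" "w < real M + 1"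
    proof -
      have "real N = real_of_int \<lfloor>y\<rfloor>" "real M = real_of_int \<lfloor>w\<rfloor>" using w by (simp_all add: N_def M_def)
      thus "real N \<le> y" "y < real N + 1" "real M \<le> w" "w < real M + 1" by linarith+
    qed
    have set: "{p. prime p \<and> w < real p \<and> real p \<le> y} = {p. prime p \<and> p \<le> N} - {p. prime p \<and> p \<le> M}"
    proof -
      have "real p \<le> y \<longleftrightarrow> p \<le> N" for p
        using b(1,2) by (metis add.commute le_less_trans less_Suc_eq_le not_less of_nat_Suc of_nat_le_iff of_nat_less_iff order_trans)
      moreover have "w < real p \<longleftrightarrow> \<not> p \<le> M" for p
        using b(3,4) by (metis add.commute le_less_trans less_Suc_eq_le not_less of_nat_Suc of_nat_le_iff of_nat_less_iff order_trans)
      ultimately show ?thesis by auto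
    qed
    have "(\<Sum>p | prime p \<and> w < real p \<and> real p \<le> y. (1 + chi4 p) * ln (real p) / real p) = mertens_prime N - mertens_prime M"
      unfolding set mertens_prime_def using NM by (intro sum_diff) auto
    moreover have "mertens_prime N \<ge> ln (real N) - C1 - C2" using C1[of N] C2[of N] NM by linarith
    moreover have "mertens_prime M \<le> ln (real M) + C1" using C1[of M] C2[of M] NM by linarith
    moreover have "ln (real M) \<le> ln w" using b NM w by (subst ln_le_cancel_iff) auto
    moreover have "ln y - 1 \<le> ln (real N)"
    proof -
      have "y \<le> 2 * real N" using b NM by linarith
      hence "ln y \<le> ln (2 * real N)" using w NM by (subst ln_le_cancel_iff) auto
      also have "\<dots> = ln 2 + ln (real N)" using NM by (subst ln_mult) auto
      finally show ?thesis using ln_two_le_one by linarith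
    qed
    moreover have "ln (y / w) = ln y - ln w" using w by (simp add: ln_div)
    ultimately show ?thesis by linarith
  qed
  moreover have "2 * C1 + C2 + 1 \<ge> 0" using C1' C2' by simp
  ultimately show ?thesis by blast
qed

section \<open>Gaussian smoothing and the local saddle-point estimate\<close>

lemma gaussian_integral:
  fixes a :: real
  assumes "a > 0"
  shows "integrable lborel (\<lambda>t::real. exp (- (a * t\<^sup>2)))" and "(\<integral>t. exp (- (a * t\<^sup>2)) \<partial>lborel) = sqrt (pi / a)"
proof -
  define \<sigma> where "\<sigma> = 1 / sqrt (2 * a)"
  have s: "\<sigma> > 0" "\<sigma>\<^sup>2 = 1 / (2 * a)" using assms by (auto simp: \<sigma>_def power_divide)
  have eq: "exp (- (a * t\<^sup>2)) = sqrt (pi / a) * normal_density 0 \<sigma> t" for t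
    unfolding normal_density_def s(2) using assms by (simp add: real_sqrt_divide field_simps)
  show "integrable lborel (\<lambda>t::real. exp (- (a * t\<^sup>2)))"
    unfolding eq using s(1) by (intro integrable_mult_right integrable_normal_density)
  show "(\<integral>t. exp (- (a * t\<^sup>2)) \<partial>lborel) = sqrt (pi / a)"
    unfolding eq using s(1) by simp
qed

text \<open>The characteristic function of the centred normal law with standard deviation
  \<open>1 / T\<close>; \<open>gauss_kernel T\<close> is the density of that law.\<close>

definition gauss_hat :: "real \<Rightarrow> real \<Rightarrow> real" where
  "gauss_hat T t = exp (- (t\<^sup>2 / (2 * T\<^sup>2)))"

definition gauss_kernel :: "real \<Rightarrow> real \<Rightarrow> real" where
  "gauss_kernel T s = T / sqrt (2 * pi) * exp (- ((T * s)\<^sup>2 / 2))"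

lemma gauss_hat_bounds: "0 < gauss_hat T t" "0 \<le> gauss_hat T t" "gauss_hat T t \<le> 1"
  by (auto simp: gauss_hat_def)

lemma gauss_hat_measurable [measurable]: "gauss_hat T \<in> borel_measurable borel"
  unfolding gauss_hat_def by measurable

lemma gauss_kernel_measurable [measurable]: "gauss_kernel T \<in> borel_measurable borel"
  unfolding gauss_kernel_def by measurable

lemma integrable_gauss_hat: "T > 0 \<Longrightarrow> integrable lborel (gauss_hat T)"
  using gaussian_integral(1)[of "1 / (2 * T\<^sup>2)"] by (simp add: gauss_hat_def [abs_def])

lemma gauss_kernel_nonneg: "T > 0 \<Longrightarrow> gauss_kernel T s \<ge> 0"
  by (simp add: gauss_kernel_def)

lemma gauss_kernel_integral:
  assumes "T > 0"
  shows "integrable lborel (gauss_kernel T)" and "(\<integral>s. gauss_kernel T s \<partial>lborel) = 1"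
proof -
  have eq: "gauss_kernel T = (\<lambda>s. T / sqrt (2 * pi) * exp (- (T\<^sup>2 / 2 * s\<^sup>2)))"
    by (auto simp: gauss_kernel_def power_mult_distrib)
  have g: "T\<^sup>2 / 2 > 0" using assms by simp
  show "integrable lborel (gauss_kernel T)"
    unfolding eq using gaussian_integral(1)[OF g] by (intro integrable_mult_right) auto
  have "(\<integral>s. gauss_kernel T s \<partial>lborel) = T / sqrt (2 * pi) * sqrt (pi / (T\<^sup>2 / 2))"
    unfolding eq using gaussian_integral(2)[OF g] by simp
  also have "\<dots> = 1" using assms by (simp add: real_sqrt_divide real_sqrt_mult)
  finally show "(\<integral>s. gauss_kernel T s \<partial>lborel) = 1" .
qed

text \<open>The characteristic function of the standard normal law is Gaussian again; substituting
  \<open>x = t / T\<close> turns this self-duality into an inversion formula.\<close>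

lemma gauss_kernel_fourier:
  assumes "T > 0"
  shows "complex_of_real (gauss_kernel T s) = 1 / (2 * pi) * (CLINT t|lborel. gauss_hat T t * iexp (t * s))"
proof -
  have "complex_of_real (exp (- ((T * s)\<^sup>2 / 2))) = char std_normal_distribution (T * s)"
    by (simp add: char_std_normal_distribution)
  also have "\<dots> = (CLINT x|lborel. std_normal_density x *\<^sub>R iexp (T * s * x))"
    unfolding char_def by (subst integral_density) auto
  also have "\<dots> = \<bar>1 / T\<bar> *\<^sub>R (CLINT t|lborel. std_normal_density (0 + 1 / T * t) *\<^sub>R iexp (T * s * (0 + 1 / T * t)))"
    using assms by (intro lborel_integral_real_affine) auto
  also have "(\<lambda>t. std_normal_density (0 + 1 / T * t) *\<^sub>R iexp (T * s * (0 + 1 / T * t))) =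
      (\<lambda>t. complex_of_real (1 / sqrt (2 * pi)) * (gauss_hat T t * iexp (t * s)))"
    using assms by (auto simp: std_normal_density_def gauss_hat_def power_divide scaleR_conv_of_real mult_ac)
  finally have "complex_of_real (exp (- ((T * s)\<^sup>2 / 2))) =
     1 / T * (1 / sqrt (2 * pi) * (CLINT t|lborel. gauss_hat T t * iexp (t * s)))"
    using assms by (simp add: scaleR_conv_of_real)
  hence "complex_of_real (gauss_kernel T s) = complex_of_real (T / sqrt (2 * pi)) *
     (1 / T * (1 / sqrt (2 * pi) * (CLINT t|lborel. gauss_hat T t * iexp (t * s))))"
    by (simp add: gauss_kernel_def)
  also have "\<dots> = complex_of_real (T / sqrt (2 * pi) * (1 / T * (1 / sqrt (2 * pi)))) * (CLINT t|lborel. gauss_hat T t * iexp (t * s))"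
    by (simp only: of_real_mult of_real_divide of_real_1 mult.assoc)
  also have "T / sqrt (2 * pi) * (1 / T * (1 / sqrt (2 * pi))) = 1 / (2 * pi)"
    using assms by (simp add: field_simps)
  finally show ?thesis by (simp only: of_real_mult of_real_divide of_real_1 of_real_numeral)
qed

lemma half_line_exp_integral:
  fixes a t :: real
  assumes "a > 0"
  shows "integrable lborel (\<lambda>v. indicator {..0} v * exp (a * v))"
    and "(CLINT v|lborel. complex_of_real (indicator {..0} v * exp (a * v)) * iexp (- (t * v))) = 1 / (a - \<i> * t)"
proof -
  let ?g = "\<lambda>v. indicator {..0} v * exp (a * v)"
  show int: "integrable lborel ?g"
  proof -
    have "(\<integral>\<^sup>+x. ennreal (exp (- a * x)) * indicator {0..} x \<partial>lborel) = 0 - (- exp (- a * 0) / a)"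
    proof (rule nn_integral_FTC_atLeast)
      show "((\<lambda>x. - exp (- a * x) / a) \<longlongrightarrow> 0) at_top" using assms by real_asymp
    qed (use assms in \<open>auto intro!: derivative_eq_intros\<close>)
    hence "(\<integral>\<^sup>+x. ennreal (indicator {0..} x * exp (- a * x)) \<partial>lborel) < \<infinity>"
      by (simp add: ennreal_mult' ennreal_indicator mult.commute)
    hence "integrable lborel (\<lambda>x. indicator {0..} x * exp (- a * x))"
      by (intro integrableI_nonneg) auto
    hence "integrable lborel (\<lambda>x. indicator {0..} (0 + (-1) * x) * exp (- a * (0 + (-1) * x)))"
      by (rule lborel_integrable_real_affine) simp
    also have "(\<lambda>x. indicator {0..} (0 + (-1) * x) * exp (- a * (0 + (-1) * x))) = ?g"
      by (auto simp: indicator_def)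
    finally show ?thesis .
  qed
  let ?F = "\<lambda>v::real. exp ((a - \<i> * t) * v) / (a - \<i> * t)"
  let ?f = "\<lambda>v::real. exp ((a - \<i> * t) * v)"
  have nz: "a - \<i> * t \<noteq> 0" using assms by (auto simp: complex_eq_iff)
  have eqf: "complex_of_real (?g v) * iexp (- (t * v)) = indicator {..0} v *\<^sub>R ?f v" for v
    by (auto simp: indicator_def exp_of_real[symmetric] exp_add[symmetric] algebra_simps simp del: exp_of_real)
  have int2: "integrable lborel (\<lambda>v. indicator {..0} v *\<^sub>R ?f v)"
    unfolding eqf[symmetric] by (rule Bochner_Integration.integrable_bound[OF int]) (auto simp: norm_mult)
  have "(LBINT v=-\<infinity>..0. ?f v) = 1 / (a - \<i> * t) - 0"
  proof (rule interval_integral_FTC_integrable)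
    fix v show "(?F has_vector_derivative ?f v) (at v)"
      using nz by (auto intro!: derivative_eq_intros has_vector_derivative_real_field)
    show "isCont ?f v" by (intro continuous_intros)
  next
    have "set_integrable lborel {..0} ?f" unfolding set_integrable_def by (rule int2)
    hence "set_integrable lborel {..<0} ?f" by (rule set_integrable_subset) auto
    thus "set_integrable lborel (einterval (-\<infinity>) 0) ?f" by (simp add: einterval_def lessThan_def zero_ereal_def)
  next
    have "((\<lambda>v. exp (a * v) / cmod (a - \<i> * t)) \<longlongrightarrow> 0 / cmod (a - \<i> * t)) at_bot"
      using nz assms by (intro tendsto_divide tendsto_const) (real_asymp, auto)
    hence "((\<lambda>v. norm (?F v)) \<longlongrightarrow> 0) at_bot" by (simp add: norm_divide)
    hence "(?F \<longlongrightarrow> 0) at_bot" by (simp add: tendsto_norm_zero_iff)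
    thus "((?F \<circ> real_of_ereal) \<longlongrightarrow> 0) (at_right (-\<infinity>))" by (simp add: ereal_tendsto_simps)
  next
    have "isCont ?F 0" using nz by (intro continuous_intros)
    hence "(?F \<longlongrightarrow> ?F 0) (at_left 0)" unfolding isCont_def by (rule tendsto_mono[rotated]) (simp add: at_le)
    thus "((?F \<circ> real_of_ereal) \<longlongrightarrow> 1 / (a - \<i> * t)) (at_left 0)"
      by (simp add: ereal_tendsto_simps zero_ereal_def)
  qed auto
  moreover have "(LBINT v=-\<infinity>..0. ?f v) = (LBINT v:{..<0}. ?f v)"
    by (simp add: interval_lebesgue_integral_def einterval_def lessThan_def zero_ereal_def)
  moreover have "(LBINT v:{..<0}. ?f v) = (LBINT v:{..0}. ?f v)"
    unfolding set_lebesgue_integral_def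
  proof (rule integral_cong_AE)
    have "AE v in lborel. v \<noteq> (0::real)" by (rule AE_lborel_singleton)
    thus "AE v in lborel. indicat_real {..<0} v *\<^sub>R ?f v = indicat_real {..0} v *\<^sub>R ?f v"
      by eventually_elim (auto simp: indicator_def)
  qed auto
  ultimately show "(CLINT v|lborel. complex_of_real (?g v) * iexp (- (t * v))) = 1 / (a - \<i> * t)"
    unfolding eqf by (simp add: set_lebesgue_integral_def)
qed

text \<open>The truncated exponential, whose expectation is wanted, convolved with the kernel; its
  jump at 0 is thereby spread over a width of order \<open>1 / T\<close>.\<close>

definition smoothed_exp :: "real \<Rightarrow> real \<Rightarrow> real \<Rightarrow> real" where
  "smoothed_exp a T z = (\<integral>v. indicator {..0} v * exp (a * v) * gauss_kernel T (z - v) \<partial>lborel)"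

text \<open>A convolution becomes a product of transforms. The factor \<open>1 / (a - i t)\<close>
  alone is not absolutely integrable; the Gaussian factor is what makes Fubini's theorem
  applicable.\<close>

lemma smoothed_exp_fourier:
  assumes "a > 0" "T > 0"
  shows "complex_of_real (smoothed_exp a T z) = 1 / (2 * pi) * (CLINT t|lborel. gauss_hat T t / (a - \<i> * t) * iexp (t * z))"
proof -
  let ?g = "\<lambda>v. indicator {..0} v * exp (a * v)"
  let ?F = "\<lambda>v t. complex_of_real (?g v) * (complex_of_real (gauss_hat T t) * iexp (t * (z - v)))"
  have norm: "norm (?F v t) = ?g v * gauss_hat T t" for v t
    using gauss_hat_bounds[of T t] by (simp add: norm_mult)
  have int: "integrable (lborel \<Otimes>\<^sub>M lborel) (\<lambda>(v, t). ?F v t)"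
  proof (rule lborel_pair.Fubini_integrable)
    show "integrable lborel (\<lambda>v. \<integral>t. norm (case (v, t) of (v, t) \<Rightarrow> ?F v t) \<partial>lborel)"
      unfolding split_conv norm using half_line_exp_integral(1)[OF assms(1)] integrable_gauss_hat[OF assms(2)]
      by (simp add: integrable_mult_left)
    show "AE v in lborel. integrable lborel (\<lambda>t. case (v, t) of (v, t) \<Rightarrow> ?F v t)"
    proof (rule AE_I2)
      fix v :: real
      show "integrable lborel (\<lambda>t. case (v, t) of (v, t) \<Rightarrow> ?F v t)"
        unfolding split_conv
        by (intro integrable_mult_right, rule Bochner_Integration.integrable_bound[OF integrable_gauss_hat[OF assms(2)]])
           (auto simp: norm_mult)
    qed
  qed measurable
  have "complex_of_real (smoothed_exp a T z) = (CLINT v|lborel. complex_of_real (?g v) * complex_of_real (gauss_kernel T (z - v)))"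
    unfolding smoothed_exp_def integral_complex_of_real[symmetric] by simp
  also have "\<dots> = (CLINT v|lborel. 1 / (2 * pi) * (CLINT t|lborel. ?F v t))"
    by (intro Bochner_Integration.integral_cong refl, subst gauss_kernel_fourier[OF assms(2)],
        subst Bochner_Integration.integral_mult_right_zero) (rule mult.left_commute)
  also have "\<dots> = 1 / (2 * pi) * (CLINT v|lborel. CLINT t|lborel. ?F v t)"
    by (simp only: Bochner_Integration.integral_mult_right_zero)
  also have "(CLINT v|lborel. CLINT t|lborel. ?F v t) = (CLINT t|lborel. CLINT v|lborel. ?F v t)"
    by (rule lborel_pair.Fubini_integral[OF int, symmetric])
  also have "\<dots> = (CLINT t|lborel. gauss_hat T t / (a - \<i> * t) * iexp (t * z))"
  proof (rule Bochner_Integration.integral_cong[OF refl])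
    fix t :: real
    have "?F v t = (gauss_hat T t * iexp (t * z)) * (complex_of_real (?g v) * iexp (- (t * v)))" for v
      by (simp add: exp_add[symmetric] algebra_simps)
    hence "(CLINT v|lborel. ?F v t) = (gauss_hat T t * iexp (t * z)) * (1 / (a - \<i> * t))"
      by (simp only: Bochner_Integration.integral_mult_right_zero half_line_exp_integral(2)[OF assms(1)])
    thus "(CLINT v|lborel. ?F v t) = gauss_hat T t / (a - \<i> * t) * iexp (t * z)" by simp
  qed
  finally show ?thesis .
qed

lemma cmod_diff_ii_ge:
  fixes a t :: real
  shows "\<bar>a\<bar> \<le> cmod (complex_of_real a - \<i> * complex_of_real t)"
  using abs_Re_le_cmod[of "complex_of_real a - \<i> * complex_of_real t"] by simp

lemma integrable_gauss_hat_div: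
  fixes a :: real
  assumes "a > 0" "T > 0"
  shows "integrable lborel (\<lambda>t. complex_of_real (gauss_hat T t) / (a - \<i> * t))"
proof (rule Bochner_Integration.integrable_bound)
  show "integrable lborel (\<lambda>t. gauss_hat T t / a)" using integrable_gauss_hat[OF assms(2)] by simp
  show "AE t in lborel. norm (complex_of_real (gauss_hat T t) / (a - \<i> * t)) \<le> norm (gauss_hat T t / a)"
  proof (rule AE_I2)
    fix t :: real
    have "a \<le> cmod (a - \<i> * t)" using cmod_diff_ii_ge[of a t] assms by linarith
    hence "gauss_hat T t / cmod (a - \<i> * t) \<le> gauss_hat T t / a"
      using assms gauss_hat_bounds[of T t] by (intro divide_left_mono mult_pos_pos) auto
    thus "norm (complex_of_real (gauss_hat T t) / (a - \<i> * t)) \<le> norm (gauss_hat T t / a)"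
      using assms gauss_hat_bounds[of T t] by (simp add: norm_divide)
  qed
qed measurable

lemma smoothed_exp_measurable [measurable]:
  assumes "a > 0" "T > 0"
  shows "smoothed_exp a T \<in> borel_measurable borel"
  unfolding smoothed_exp_def by measurable

text \<open>Parseval's formula: the exponentials have modulus 1, so integrability of
  \<open>g\<close> suffices for exchanging the integrals.\<close>

lemma expectation_fourier_integral:
  fixes g :: "real \<Rightarrow> complex"
  assumes M: "real_distribution M" and g: "integrable lborel g"
  shows "(CLINT z|M. CLINT t|lborel. g t * iexp (t * z)) = (CLINT t|lborel. g t * char M t)"
proof -
  interpret real_distribution M by fact
  interpret P: pair_sigma_finite M lborel ..
  have [measurable]: "g \<in> borel_measurable borel" using borel_measurable_integrable[OF g] by simp
  let ?F = "\<lambda>z t. g t * iexp (t * z)"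
  have norm: "norm (?F z t) = norm (g t)" for z t by (simp add: norm_mult)
  have int: "integrable (M \<Otimes>\<^sub>M lborel) (\<lambda>(z, t). ?F z t)"
  proof (rule P.Fubini_integrable)
    show "integrable M (\<lambda>z. \<integral>t. norm (case (z, t) of (z, t) \<Rightarrow> ?F z t) \<partial>lborel)"
      unfolding split_conv norm by simp
    show "AE z in M. integrable lborel (\<lambda>t. case (z, t) of (z, t) \<Rightarrow> ?F z t)"
      unfolding split_conv
      by (intro AE_I2 Bochner_Integration.integrable_bound[OF g]) (auto simp: norm_mult)
  qed measurable
  have "(CLINT z|M. CLINT t|lborel. ?F z t) = (CLINT t|lborel. CLINT z|M. ?F z t)"
    by (rule P.Fubini_integral[OF int, symmetric])
  also have "\<dots> = (CLINT t|lborel. g t * char M t)"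
    unfolding char_def by (simp only: Bochner_Integration.integral_mult_right_zero)
  finally show ?thesis .
qed

lemma expectation_smoothed_exp:
  assumes M: "real_distribution M" and "a > 0" "T > 0"
  shows "complex_of_real (\<integral>z. smoothed_exp a T z \<partial>M) = 1 / (2 * pi) * (CLINT t|lborel. gauss_hat T t / (a - \<i> * t) * char M t)"
  unfolding integral_complex_of_real[symmetric] smoothed_exp_fourier[OF assms(2,3)]
    expectation_fourier_integral[OF M integrable_gauss_hat_div[OF assms(2,3)], symmetric]
  by (rule Bochner_Integration.integral_mult_right_zero)

lemma expectation_gauss_kernel:
  assumes M: "real_distribution M" and "T > 0"
  shows "complex_of_real (\<integral>z. gauss_kernel T z \<partial>M) = 1 / (2 * pi) * (CLINT t|lborel. gauss_hat T t * char M t)"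
proof -
  have "integrable lborel (\<lambda>t. complex_of_real (gauss_hat T t))" using integrable_gauss_hat[OF assms(2)] by simp
  from expectation_fourier_integral[OF M this] show ?thesis
    unfolding integral_complex_of_real[symmetric] gauss_kernel_fourier[OF assms(2)]
    by (simp only: Bochner_Integration.integral_mult_right_zero)
qed

section \<open>The error made by smoothing\<close>

lemma abs_one_minus_exp_le: "\<bar>1 - exp (- x)\<bar> \<le> \<bar>x\<bar> * exp \<bar>x\<bar>" for x :: real
proof (cases "x \<ge> 0")
  case True
  have "1 - exp (- x) \<le> x" using exp_ge_add_one_self[of "- x"] by linarith
  moreover have "x * 1 \<le> x * exp x" using True by (intro mult_left_mono) auto
  ultimately show ?thesis using True by simp
next
  case False
  have "1 - exp x \<le> - x" using exp_ge_add_one_self[of x] by linarith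
  hence "(1 - exp x) * exp (- x) \<le> - x * exp (- x)" by (intro mult_right_mono) auto
  hence "exp (-x) - 1 \<le> - x * exp (-x)" by (simp add: left_diff_distrib exp_minus_inverse)
  thus ?thesis using False by simp
qed

text \<open>The hypothesis puts \<open>s\<close> on the far side of \<open>z\<close> as seen from 0,
  so that \<open>s^2 \<ge> (s - z)^2 + z^2\<close>. It shows that the kernel mass carried across the
  jump is Gaussian in \<open>T * z\<close>.\<close>

lemma gauss_kernel_shift:
  assumes "T > 0" "s * z \<ge> z\<^sup>2"
  shows "gauss_kernel T s \<le> exp (- ((T * z)\<^sup>2 / 2)) * gauss_kernel T (s - z)"
proof -
  have "s\<^sup>2 \<ge> (s - z)\<^sup>2 + z\<^sup>2" using assms(2) by (simp add: power2_eq_square algebra_simps)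
  hence "T\<^sup>2 * s\<^sup>2 \<ge> T\<^sup>2 * ((s - z)\<^sup>2 + z\<^sup>2)" by (intro mult_left_mono) auto
  hence "(T * s)\<^sup>2 \<ge> (T * (s - z))\<^sup>2 + (T * z)\<^sup>2" by (simp add: power_mult_distrib distrib_left)
  hence "exp (- ((T * s)\<^sup>2 / 2)) \<le> exp (- ((T * z)\<^sup>2 / 2) + - ((T * (s - z))\<^sup>2 / 2))" by simp
  also have "\<dots> = exp (- ((T * z)\<^sup>2 / 2)) * exp (- ((T * (s - z))\<^sup>2 / 2))" by (rule exp_add)
  finally show ?thesis using assms(1) unfolding gauss_kernel_def
    by (simp add: mult.left_commute[of "exp (- ((T * z)\<^sup>2 / 2))"] divide_right_mono)
qed

text \<open>Half of the Gaussian exponent pays for the factor in front, the other half remains for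
  integration. The \<open>exp 4\<close> comes from completing the square
  \<open>(T * \<bar>s\<bar> / 2 - 2)^2\<close>.\<close>

lemma abs_mult_exp_gauss_kernel_le:
  assumes "T \<ge> 1"
  shows "\<bar>s\<bar> * exp \<bar>s\<bar> * gauss_kernel T s \<le> exp 4 / sqrt (2 * pi) * exp (- (T\<^sup>2 / 4 * s\<^sup>2))"
proof -
  have "\<bar>s\<bar> * 1 \<le> \<bar>s\<bar> * T" using assms by (intro mult_left_mono) auto
  hence "exp \<bar>s\<bar> \<le> exp (T * \<bar>s\<bar>)" by (simp add: mult.commute)
  moreover have "T * \<bar>s\<bar> \<le> exp (T * \<bar>s\<bar>)" using exp_ge_add_one_self[of "T * \<bar>s\<bar>"] by linarith
  ultimately have "(T * \<bar>s\<bar>) * exp \<bar>s\<bar> \<le> exp (T * \<bar>s\<bar>) * exp (T * \<bar>s\<bar>)"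
    using assms by (intro mult_mono) auto
  also have "\<dots> = exp (2 * (T * \<bar>s\<bar>))" by (simp only: exp_add[symmetric] mult_2)
  also have "\<dots> \<le> exp (4 + T\<^sup>2 / 4 * s\<^sup>2)"
  proof -
    have "0 \<le> (T * \<bar>s\<bar> / 2 - 2)\<^sup>2" by simp
    also have "\<dots> = T\<^sup>2 / 4 * s\<^sup>2 - 2 * (T * \<bar>s\<bar>) + 4" by (simp add: power2_diff power_mult_distrib power_divide)
    finally show ?thesis by simp
  qed
  also have "\<dots> = exp 4 * exp (T\<^sup>2 / 4 * s\<^sup>2)" by (rule exp_add)
  finally have 1: "(T * \<bar>s\<bar>) * exp \<bar>s\<bar> \<le> exp 4 * exp (T\<^sup>2 / 4 * s\<^sup>2)" .
  have "\<bar>s\<bar> * exp \<bar>s\<bar> * gauss_kernel T s = ((T * \<bar>s\<bar>) * exp \<bar>s\<bar>) * (exp (- ((T * s)\<^sup>2 / 2)) / sqrt (2 * pi))"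
    by (simp add: gauss_kernel_def)
  also have "\<dots> \<le> (exp 4 * exp (T\<^sup>2 / 4 * s\<^sup>2)) * (exp (- ((T * s)\<^sup>2 / 2)) / sqrt (2 * pi))"
    by (intro mult_right_mono 1) auto
  also have "\<dots> = exp 4 / sqrt (2 * pi) * exp (T\<^sup>2 / 4 * s\<^sup>2 + - ((T * s)\<^sup>2 / 2))"
    by (simp only: exp_add) simp
  also have "T\<^sup>2 / 4 * s\<^sup>2 + - ((T * s)\<^sup>2 / 2) = - (T\<^sup>2 / 4 * s\<^sup>2)" by (simp add: power_mult_distrib)
  finally show ?thesis .
qed

text \<open>The error has two sources. Where no mass crosses the jump, only the variation of the
  exponential matters, and this error is proportional to the function itself; hence it stays a
  relative error after taking expectations. Mass that crosses the jump is bounded by a Gaussian in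
  \<open>T * z\<close>.\<close>

lemma smoothed_exp_close:
  assumes a: "0 < a" "a \<le> 1" and T: "T \<ge> 1"
  shows "\<bar>indicator {..0} z * exp (a * z) - smoothed_exp a T z\<bar> \<le>
    exp 4 * sqrt 2 / T * (indicator {..0} z * exp (a * z)) + exp (- ((T * z)\<^sup>2 / 2))"
proof -
  have T0: "T > 0" using T by simp
  define g where "g = indicator {..0} z * exp (a * z)"
  let ?k = "gauss_kernel T"
  let ?f = "\<lambda>s. indicator {..0} (z - s) * exp (a * (z - s)) * ?k s"
  have g0: "g \<ge> 0" by (simp add: g_def)
  have se: "smoothed_exp a T z = (\<integral>s. ?f s \<partial>lborel)"
    unfolding smoothed_exp_def by (subst lborel_integral_real_affine[of "-1" _ z]) auto
  have intf: "integrable lborel ?f"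
  proof (rule Bochner_Integration.integrable_bound)
    show "integrable lborel (\<lambda>s. 1 * ?k s)" using gauss_kernel_integral(1)[OF T0] by simp
    show "AE s in lborel. norm (?f s) \<le> norm (1 * ?k s)"
    proof (rule AE_I2)
      fix s
      have "indicator {..0} (z - s) * exp (a * (z - s)) \<le> 1"
        using a by (auto simp: indicator_def mult_nonneg_nonpos)
      thus "norm (?f s) \<le> norm (1 * ?k s)"
        unfolding real_norm_def abs_mult using gauss_kernel_nonneg[OF T0, of s]
        by (intro mult_right_mono) auto
    qed
  qed measurable
  have intg: "integrable lborel (\<lambda>s. g * ?k s)" using gauss_kernel_integral(1)[OF T0] by simp
  have g: "g = (\<integral>s. g * ?k s \<partial>lborel)" using gauss_kernel_integral(2)[OF T0] by simp
  let ?B = "\<lambda>s. g * (exp 4 / sqrt (2 * pi) * exp (- (T\<^sup>2 / 4 * s\<^sup>2))) + exp (- ((T * z)\<^sup>2 / 2)) * ?k (-z + 1 * s)"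
  have T4: "T\<^sup>2 / 4 > 0" using T0 by simp
  have intk: "integrable lborel (\<lambda>s. ?k (-z + 1 * s))"
    by (rule lborel_integrable_real_affine[OF gauss_kernel_integral(1)[OF T0]]) simp
  have intk2: "(\<integral>s. ?k (-z + 1 * s) \<partial>lborel) = 1"
    using lborel_integral_real_affine[of 1 ?k "-z"] gauss_kernel_integral(2)[OF T0] by simp
  have intB: "integrable lborel ?B"
    using gaussian_integral(1)[OF T4] intk by (intro Bochner_Integration.integrable_add integrable_mult_right)
  have "\<bar>g - smoothed_exp a T z\<bar> = \<bar>\<integral>s. g * ?k s - ?f s \<partial>lborel\<bar>"
    unfolding se using g intf intg by (simp only: Bochner_Integration.integral_diff)
  also have "\<dots> \<le> (\<integral>s. \<bar>g * ?k s - ?f s\<bar> \<partial>lborel)" by (rule integral_abs_bound)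
  also have "\<dots> \<le> (\<integral>s. ?B s \<partial>lborel)"
  proof (rule integral_mono)
    fix s :: real
    have k0: "?k s \<ge> 0" "?k (-z + 1 * s) \<ge> 0" by (rule gauss_kernel_nonneg[OF T0])+
    have p1: "0 \<le> g * (exp 4 / sqrt (2 * pi) * exp (- (T\<^sup>2 / 4 * s\<^sup>2)))" using g0 by simp
    have p2: "0 \<le> exp (- ((T * z)\<^sup>2 / 2)) * ?k (-z + 1 * s)" using k0 by simp
    \<comment> \<open>The sign of \<open>z\<close> decides whether the original function is nonzero,
      and comparing \<open>s\<close> with \<open>z\<close> decides it for the shifted one. In the
      first case both survive, in the third both vanish, and in the other two the jump lies between
      them.\<close>
    consider "z \<le> 0" "s \<ge> z" | "z \<le> 0" "s < z" | "z > 0" "s < z" | "z > 0" "s \<ge> z" by linarith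
    thus "\<bar>g * ?k s - ?f s\<bar> \<le> ?B s"
    proof cases
      case 1
      hence "g * ?k s - ?f s = g * (?k s * (1 - exp (- (a * s))))"
        by (simp add: g_def right_diff_distrib exp_diff exp_minus field_simps)
      hence "\<bar>g * ?k s - ?f s\<bar> = g * (?k s * \<bar>1 - exp (- (a * s))\<bar>)"
        using g0 k0 by (simp add: abs_mult)
      also have "\<dots> \<le> g * (?k s * (\<bar>s\<bar> * exp \<bar>s\<bar>))"
      proof (intro mult_left_mono g0 k0)
        have le: "\<bar>a * s\<bar> \<le> \<bar>s\<bar>" using a mult_right_mono[of a 1 "\<bar>s\<bar>"] by (simp add: abs_mult)
        have "\<bar>1 - exp (- (a * s))\<bar> \<le> \<bar>a * s\<bar> * exp \<bar>a * s\<bar>" by (rule abs_one_minus_exp_le)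
        also have "\<dots> \<le> \<bar>s\<bar> * exp \<bar>s\<bar>" by (intro mult_mono) (use le in auto)
        finally show "\<bar>1 - exp (- (a * s))\<bar> \<le> \<bar>s\<bar> * exp \<bar>s\<bar>" .
      qed
      also have "g * (?k s * (\<bar>s\<bar> * exp \<bar>s\<bar>)) = g * (\<bar>s\<bar> * exp \<bar>s\<bar> * ?k s)" by (simp add: mult_ac)
      also have "\<dots> \<le> g * (exp 4 / sqrt (2 * pi) * exp (- (T\<^sup>2 / 4 * s\<^sup>2)))"
        by (intro mult_left_mono g0 abs_mult_exp_gauss_kernel_le[OF T])
      finally show ?thesis using p2 by linarith
    next
      case 2
      hence "\<bar>g * ?k s - ?f s\<bar> = g * ?k s" using g0 k0 by (simp add: abs_mult)
      also have "g \<le> 1" using 2 a by (simp add: g_def mult_nonneg_nonpos)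
      also have "1 * ?k s \<le> exp (- ((T * z)\<^sup>2 / 2)) * ?k (s - z)"
        using 2 mult_right_mono_neg[of s z z] by (intro order_trans[OF _ gauss_kernel_shift[OF T0]]) (auto simp: power2_eq_square)
      finally show ?thesis using p1 k0 by (simp add: mult_right_mono)
    next
      case 3
      thus ?thesis using p1 p2 by (simp add: g_def)
    next
      case 4
      hence "g = 0" by (simp add: g_def)
      hence "\<bar>g * ?k s - ?f s\<bar> = exp (a * (z - s)) * ?k s" using 4 k0 by (simp add: abs_mult)
      also have "exp (a * (z - s)) \<le> 1" using 4 a by (simp add: mult_nonneg_nonpos)
      also have "1 * ?k s \<le> exp (- ((T * z)\<^sup>2 / 2)) * ?k (s - z)"
        using 4 mult_right_mono[of z s z] by (intro order_trans[OF _ gauss_kernel_shift[OF T0]]) (auto simp: power2_eq_square)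
      finally show ?thesis using p1 k0 by (simp add: mult_right_mono)
    qed
  qed (use intB intf intg in auto)
  also have "\<dots> = g * (exp 4 / sqrt (2 * pi) * sqrt (pi / (T\<^sup>2 / 4))) + exp (- ((T * z)\<^sup>2 / 2))"
    using gaussian_integral[OF T4] intk intk2
    by (subst Bochner_Integration.integral_add) (auto simp del: mult_1 intro!: integrable_mult_right)
  also have "exp 4 / sqrt (2 * pi) * sqrt (pi / (T\<^sup>2 / 4)) = exp 4 * sqrt 2 / T"
    using T0 by (simp add: real_sqrt_divide real_sqrt_mult field_simps)
  finally show ?thesis by (simp add: g_def mult.commute)
qed

text \<open>The crossing error is a multiple of \<open>gauss_kernel T z\<close>, so its expectation
  is again expressed by the characteristic function; this gives \<open>I / T\<close>. The term
  proportional to \<open>E\<close> can be absorbed once \<open>T\<close> is large.\<close>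

lemma smoothing_bound:
  fixes a T :: real
  assumes M: "real_distribution M" and a: "0 < a" "a \<le> 1" and T: "T \<ge> 1"
  defines "E \<equiv> (\<integral>z. indicator {..0} z * exp (a * z) \<partial>M)"
  defines "I \<equiv> (\<integral>t. gauss_hat T t * cmod (char M t) \<partial>lborel)"
  defines "J \<equiv> 1 / (2 * pi) * (\<integral>t. gauss_hat T t * Re (char M t / (a - \<i> * t)) \<partial>lborel)"
  shows "\<bar>E - J\<bar> \<le> exp 4 * sqrt 2 / T * E + I / T"
proof -
  interpret real_distribution M by fact
  have T0: "T > 0" using T by simp
  note [measurable] = char_measurable
  let ?g = "\<lambda>z. indicator {..0} z * exp (a * z)"
  have intJ: "integrable lborel (\<lambda>t. gauss_hat T t / (a - \<i> * t) * char M t)"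
  proof (rule Bochner_Integration.integrable_bound[OF integrable_gauss_hat_div[OF a(1) T0]])
    show "AE t in lborel. norm (gauss_hat T t / (a - \<i> * t) * char M t) \<le> norm (complex_of_real (gauss_hat T t) / (a - \<i> * t))"
      using cmod_char_le_1 gauss_hat_bounds(2)[of T]
      by (intro AE_I2) (auto simp: norm_mult norm_divide intro!: divide_right_mono mult_left_le)
  qed measurable
  have "(\<integral>z. smoothed_exp a T z \<partial>M) = Re (1 / (2 * pi) * (CLINT t|lborel. gauss_hat T t / (a - \<i> * t) * char M t))"
    by (metis expectation_smoothed_exp[OF M a(1) T0] Re_complex_of_real)
  also have "\<dots> = 1 / (2 * pi) * Re (CLINT t|lborel. gauss_hat T t / (a - \<i> * t) * char M t)"
  proof -
    have c: "1 / (2 * complex_of_real pi) = complex_of_real (1 / (2 * pi))" by simp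
    have r: "Re (complex_of_real b * w) = b * Re w" for b w by simp
    show ?thesis unfolding c by (rule r)
  qed
  also have "Re (CLINT t|lborel. gauss_hat T t / (a - \<i> * t) * char M t) = (\<integral>t. Re (gauss_hat T t / (a - \<i> * t) * char M t) \<partial>lborel)"
    using intJ by (rule integral_Re[symmetric])
  also have "(\<lambda>t. Re (gauss_hat T t / (a - \<i> * t) * char M t)) = (\<lambda>t. gauss_hat T t * Re (char M t / (a - \<i> * t)))"
  proof
    fix t
    have r: "Re (complex_of_real b * w) = b * Re w" for b w by simp
    have "gauss_hat T t / (a - \<i> * t) * char M t = gauss_hat T t * (char M t / (a - \<i> * t))" by simp
    thus "Re (gauss_hat T t / (a - \<i> * t) * char M t) = gauss_hat T t * Re (char M t / (a - \<i> * t))"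
      by (simp only: r)
  qed
  finally have EJ: "(\<integral>z. smoothed_exp a T z \<partial>M) = J" by (simp add: J_def)
  have intg: "integrable M ?g"
    by (rule integrable_const_bound[of _ 1]) (use a in \<open>auto simp: indicator_def mult_nonneg_nonpos\<close>)
  have inte: "integrable M (\<lambda>z. exp (- ((T * z)\<^sup>2 / 2)))"
    by (rule integrable_const_bound[of _ 1]) auto
  have [measurable]: "smoothed_exp a T \<in> borel_measurable borel" using smoothed_exp_measurable[OF a(1) T0] .
  have ints: "integrable M (smoothed_exp a T)"
  proof (rule Bochner_Integration.integrable_bound)
    show "integrable M (\<lambda>z. ?g z + (exp 4 * sqrt 2 / T * ?g z + exp (- ((T * z)\<^sup>2 / 2))))"
      using intg inte by simp
    show "AE z in M. norm (smoothed_exp a T z) \<le> norm (?g z + (exp 4 * sqrt 2 / T * ?g z + exp (- ((T * z)\<^sup>2 / 2))))"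
    proof (rule AE_I2)
      fix z
      have "?g z \<ge> 0" by simp
      thus "norm (smoothed_exp a T z) \<le> norm (?g z + (exp 4 * sqrt 2 / T * ?g z + exp (- ((T * z)\<^sup>2 / 2))))"
        using smoothed_exp_close[OF a T, of z] unfolding real_norm_def by linarith
    qed
  qed measurable
  have "\<bar>E - J\<bar> = \<bar>\<integral>z. ?g z - smoothed_exp a T z \<partial>M\<bar>"
    unfolding E_def EJ[symmetric] using intg ints by simp
  also have "\<dots> \<le> (\<integral>z. \<bar>?g z - smoothed_exp a T z\<bar> \<partial>M)" by (rule integral_abs_bound)
  also have "\<dots> \<le> (\<integral>z. exp 4 * sqrt 2 / T * ?g z + exp (- ((T * z)\<^sup>2 / 2)) \<partial>M)"
    using intg ints inte smoothed_exp_close[OF a T] by (intro integral_mono) auto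
  also have "\<dots> = exp 4 * sqrt 2 / T * E + (\<integral>z. exp (- ((T * z)\<^sup>2 / 2)) \<partial>M)"
    unfolding E_def using intg inte by simp
  also have "(\<integral>z. exp (- ((T * z)\<^sup>2 / 2)) \<partial>M) \<le> I / T"
  proof -
    have "(\<integral>z. gauss_kernel T z \<partial>M) \<le> cmod (complex_of_real (\<integral>z. gauss_kernel T z \<partial>M))" by simp
    also have "\<dots> = 1 / (2 * pi) * cmod (CLINT t|lborel. gauss_hat T t * char M t)"
      unfolding expectation_gauss_kernel[OF M T0] by (simp add: norm_mult norm_divide)
    also have "\<dots> \<le> 1 / (2 * pi) * (\<integral>t. norm (gauss_hat T t * char M t) \<partial>lborel)"
      by (intro mult_left_mono integral_norm_bound) auto
    also have "(\<integral>t. norm (gauss_hat T t * char M t) \<partial>lborel) = I"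
      unfolding I_def using gauss_hat_bounds(2)[of T] by (simp add: norm_mult)
    finally have k: "(\<integral>z. gauss_kernel T z \<partial>M) \<le> 1 / (2 * pi) * I" .
    have "(\<integral>z. exp (- ((T * z)\<^sup>2 / 2)) \<partial>M) = sqrt (2 * pi) / T * (\<integral>z. gauss_kernel T z \<partial>M)"
      unfolding gauss_kernel_def using T0 by simp
    also have "\<dots> \<le> sqrt (2 * pi) / T * (1 / (2 * pi) * I)"
      using T0 by (intro mult_left_mono k) auto
    also have "sqrt (2 * pi) / T * (1 / (2 * pi) * I) = (1 / sqrt (2 * pi)) * (I / T)"
      using T0 by (simp add: field_simps)
    also have "\<dots> \<le> 1 * (I / T)"
    proof (rule mult_right_mono)
      have "sqrt (2 * pi) \<ge> sqrt 1" using pi_gt3 by (intro real_sqrt_le_mono) linarith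
      thus "1 / sqrt (2 * pi) \<le> 1" by simp
      show "0 \<le> I / T" unfolding I_def using T0 gauss_hat_bounds(2)[of T] by (intro divide_nonneg_pos integral_nonneg) auto
    qed
    finally show ?thesis by simp
  qed
  finally show ?thesis by simp
qed

text \<open>The two terms of order \<open>t\<close> and \<open>t\<^sup>3\<close> are purely imaginary, so the real part loses them
  pointwise; this is why the relative error is \<open>1/u\<close> and not \<open>u\<close> to the power \<open>-1/2\<close>.\<close>

lemma saddle_integrand_close:
  fixes K :: real
  assumes K: "K \<ge> 1"
  shows "\<exists>C\<ge>0. \<forall>(\<sigma>::real) (u::real) (\<beta>::real) (\<gamma>::real) (a::real) (t::real) (T::real) (R::complex).
     1/2 \<le> a \<longrightarrow> a \<le> 1 \<longrightarrow> u \<ge> 1 \<longrightarrow> \<sigma> > 0 \<longrightarrow> \<sigma>\<^sup>2 \<ge> u \<longrightarrow> \<beta>\<^sup>2 \<le> K * \<sigma> ^ 6 / u \<longrightarrow> 0 \<le> \<gamma> \<longrightarrow> \<gamma> \<le> K * \<sigma> ^ 4 / u \<longrightarrow>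
     cmod R \<le> \<gamma> * t ^ 4 \<longrightarrow> \<gamma> * t\<^sup>2 \<le> \<sigma>\<^sup>2 / 4 \<longrightarrow> T \<ge> 1 \<longrightarrow>
     \<bar>gauss_hat T t * Re (exp (- (\<sigma>\<^sup>2 * t\<^sup>2 / 2) + \<i> * (\<beta> * t ^ 3) + R) / (a - \<i> * t)) - exp (- (\<sigma>\<^sup>2 * t\<^sup>2 / 2)) / a\<bar>
       \<le> C / u * exp (- (\<sigma>\<^sup>2 / 8 * t\<^sup>2))"
proof -
  \<comment> \<open>The sum of \<open>8 ^ n * fact n\<close> for \<open>n\<close> from 1 to 4: the
    price of bounding these powers of \<open>v\<close> by \<open>exp (v / 8)\<close>.\<close>
  define P :: real where "P = 8 + 64 * 2 + 512 * 6 + 4096 * 24"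
  define C where "C = 11 * K\<^sup>2 * P"
  have KK: "K \<le> K\<^sup>2" using K by (simp add: power2_eq_square)
  have K2: "1 \<le> K\<^sup>2" using K by (simp add: power2_eq_square mult_ge1_I)
  show ?thesis
  proof (intro exI[of _ C] conjI allI impI)
    show "C \<ge> 0" by (simp add: C_def P_def)
    fix \<sigma> u \<beta> \<gamma> a t T :: real and R :: complex
    assume a: "1/2 \<le> a" "a \<le> 1" and u: "u \<ge> 1" and s: "\<sigma> > 0" "\<sigma>\<^sup>2 \<ge> u" and b: "\<beta>\<^sup>2 \<le> K * \<sigma> ^ 6 / u"
      and g: "0 \<le> \<gamma>" "\<gamma> \<le> K * \<sigma> ^ 4 / u" and R: "cmod R \<le> \<gamma> * t ^ 4" and gt: "\<gamma> * t\<^sup>2 \<le> \<sigma>\<^sup>2 / 4" and T: "T \<ge> 1"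
    define v where "v = \<sigma>\<^sup>2 * t\<^sup>2"
    have v0: "v \<ge> 0" by (simp add: v_def)
    define B where "B = \<beta> * t ^ 3"
    define w where "w = \<i> * complex_of_real B + R"
    have t2: "t\<^sup>2 \<le> v / u"
    proof -
      have "u * t\<^sup>2 \<le> \<sigma>\<^sup>2 * t\<^sup>2" using s by (intro mult_right_mono) auto
      thus ?thesis using u by (simp add: v_def field_simps)
    qed
    have vu: "v / u \<le> v" using mult_right_mono[of 1 u v] u v0 by (simp add: field_simps)
    have t4: "t ^ 4 \<le> v\<^sup>2 / u"
    proof -
      have "t ^ 4 = t\<^sup>2 * t\<^sup>2" by (simp add: power_add[symmetric])
      also have "\<dots> \<le> (v / u) * v" using t2 vu v0 u by (intro mult_mono) (auto intro: order_trans)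
      finally show ?thesis by (simp add: power2_eq_square)
    qed
    have B2: "B\<^sup>2 \<le> K * v ^ 3 / u"
    proof -
      have "B\<^sup>2 = \<beta>\<^sup>2 * t ^ 6" by (simp add: B_def power_mult_distrib power_mult[symmetric])
      also have "\<dots> \<le> (K * \<sigma> ^ 6 / u) * t ^ 6" using b by (intro mult_right_mono) auto
      also have "\<dots> = K * v ^ 3 / u" by (simp add: v_def power_mult_distrib power_mult[symmetric])
      finally show ?thesis .
    qed
    have gt4: "\<gamma> * t ^ 4 \<le> K * v\<^sup>2 / u"
    proof -
      have "\<gamma> * t ^ 4 \<le> (K * \<sigma> ^ 4 / u) * t ^ 4" using g by (intro mult_right_mono) auto
      also have "\<dots> = K * v\<^sup>2 / u" by (simp add: v_def power_mult_distrib power_mult[symmetric])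
      finally show ?thesis .
    qed
    have R1: "cmod R \<le> K * v\<^sup>2 / u" using R gt4 by linarith
    have R4: "cmod R \<le> v / 4"
    proof -
      have "\<gamma> * t ^ 4 = (\<gamma> * t\<^sup>2) * t\<^sup>2" by (simp add: power_add[symmetric])
      also have "\<dots> \<le> (\<sigma>\<^sup>2 / 4) * t\<^sup>2" using gt by (intro mult_right_mono) auto
      finally show ?thesis using R by (simp add: v_def)
    qed
    have R2: "(cmod R)\<^sup>2 \<le> K\<^sup>2 * v ^ 4 / u"
    proof -
      have "(cmod R)\<^sup>2 \<le> (K * v\<^sup>2 / u)\<^sup>2" by (intro power_mono R1) auto
      also have "\<dots> = K\<^sup>2 * v ^ 4 / (u * u)" by (simp add: power_divide power_mult_distrib power_mult[symmetric] power2_eq_square[of u])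
      also have "\<dots> \<le> K\<^sup>2 * v ^ 4 / (u * 1)" using u v0 by (intro divide_left_mono mult_left_mono) auto
      finally show ?thesis by simp
    qed
    have w2: "(cmod w)\<^sup>2 \<le> 2 * B\<^sup>2 + 2 * (cmod R)\<^sup>2"
    proof -
      have "cmod w \<le> \<bar>B\<bar> + cmod R" unfolding w_def by (rule order_trans[OF norm_triangle_ineq]) (simp add: norm_mult)
      hence "(cmod w)\<^sup>2 \<le> (\<bar>B\<bar> + cmod R)\<^sup>2" by (intro power_mono) auto
      also have "\<dots> \<le> 2 * B\<^sup>2 + 2 * (cmod R)\<^sup>2"
        using sum_squares_bound[of "\<bar>B\<bar>" "cmod R"] by (simp add: power2_sum)
      finally show ?thesis .
    qed
    \<comment> \<open>\<open>R\<close> is itself of size \<open>1 / u\<close> and is counted as an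
      error; only the larger term \<open>i B\<close> is kept.\<close>
    define e1 where "e1 = exp w - 1 - \<i> * complex_of_real B"
    have e1: "cmod e1 \<le> cmod R + (2 * B\<^sup>2 + 2 * (cmod R)\<^sup>2) * exp (v / 4)"
    proof -
      have "cmod (exp w - (\<Sum>k\<le>1. w ^ k / fact k)) \<le> exp \<bar>Re w\<bar> * cmod w ^ Suc 1 / fact 1"
        by (rule Taylor_exp)
      hence 1: "cmod (exp w - 1 - w) \<le> exp \<bar>Re w\<bar> * (cmod w)\<^sup>2" by (simp add: diff_diff_eq numeral_2_eq_2)
      have "\<bar>Re w\<bar> \<le> v / 4" using R4 abs_Re_le_cmod[of R] by (simp add: w_def)
      hence "exp \<bar>Re w\<bar> * (cmod w)\<^sup>2 \<le> exp (v / 4) * (2 * B\<^sup>2 + 2 * (cmod R)\<^sup>2)" by (intro mult_mono w2) auto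
      moreover have "e1 = R + (exp w - 1 - w)" by (simp add: e1_def w_def)
      hence "cmod e1 \<le> cmod R + cmod (exp w - 1 - w)" by (metis norm_triangle_ineq)
      ultimately show ?thesis using 1 by (simp add: mult.commute)
    qed
    define q where "q = complex_of_real (gauss_hat T t) / (a - \<i> * t)"
    \<comment> \<open>First-order expansion of \<open>q\<close> in \<open>t\<close>; the Gaussian
      factor differs from 1 only by \<open>O(t^2)\<close>.\<close>
    define e2 where "e2 = q - 1 / a - \<i> * t / a\<^sup>2"
    have nz: "complex_of_real a - \<i> * t \<noteq> 0" using a by (auto simp: complex_eq_iff)
    have ca: "cmod (1 / (complex_of_real a - \<i> * t)) \<le> 2"
    proof -
      have "cmod (complex_of_real a - \<i> * t) \<ge> 1/2" using cmod_diff_ii_ge[of a t] a by linarith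
      hence "1 / cmod (complex_of_real a - \<i> * t) \<le> 1 / (1/2)" by (intro divide_left_mono) auto
      thus ?thesis by (simp add: norm_divide)
    qed
    have q2: "cmod q \<le> 2"
    proof -
      have "cmod q = gauss_hat T t * cmod (1 / (complex_of_real a - \<i> * t))" using gauss_hat_bounds[of T t] by (simp add: q_def norm_divide)
      also have "\<dots> \<le> 1 * 2" using gauss_hat_bounds[of T t] ca by (intro mult_mono) auto
      finally show ?thesis by simp
    qed
    have e2: "cmod e2 \<le> 9 * t\<^sup>2"
    proof -
      have gh: "1 - gauss_hat T t \<le> t\<^sup>2 / 2"
      proof -
        have "1 - gauss_hat T t \<le> t\<^sup>2 / (2 * T\<^sup>2)" using exp_ge_add_one_self[of "- (t\<^sup>2 / (2 * T\<^sup>2))"] by (simp add: gauss_hat_def)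
        also have "\<dots> \<le> t\<^sup>2 / (2 * 1)" using T by (intro divide_left_mono mult_left_mono) (auto simp: one_le_power)
        finally show ?thesis by simp
      qed
      have eq: "e2 = - complex_of_real (1 - gauss_hat T t) * (1 / (a - \<i> * t)) - complex_of_real (t\<^sup>2 / a\<^sup>2) * (1 / (a - \<i> * t))"
      proof -
        have A: "1 / (a - \<i> * t) - 1 / a - \<i> * t / a\<^sup>2 = - complex_of_real (t\<^sup>2 / a\<^sup>2) * (1 / (a - \<i> * t))"
        proof -
          have a0: "complex_of_real a \<noteq> 0" using a by simp
          have "(1 / (a - \<i> * t) - 1 / a - \<i> * t / a\<^sup>2) * (a - \<i> * t) = 1 - (1 / a + \<i> * t / a\<^sup>2) * (a - \<i> * t)"
            using nz by (simp add: left_diff_distrib distrib_right)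
          also have "\<dots> = - complex_of_real (t\<^sup>2 / a\<^sup>2)"
            using a0 by (simp add: field_simps power2_eq_square)
          finally have "(1 / (a - \<i> * t) - 1 / a - \<i> * t / a\<^sup>2) * (a - \<i> * t) = - complex_of_real (t\<^sup>2 / a\<^sup>2)" .
          moreover have "x * d = y \<Longrightarrow> d \<noteq> 0 \<Longrightarrow> x = y * (1 / d)" for x y d :: complex by (simp add: field_simps)
          ultimately show ?thesis using nz by blast
        qed
        have B: "q = 1 / (a - \<i> * t) - complex_of_real (1 - gauss_hat T t) * (1 / (a - \<i> * t))"
          by (simp add: q_def diff_divide_distrib)
        have gen: "q' - p - r = - g' - m" if h: "Z - p - r = - m" "q' = Z - g'" for Z p r m q' g' :: complex
        proof -
          have "q' - p - r = (Z - p - r) - g'" using h(2) by simp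
          thus ?thesis unfolding h(1) by simp
        qed
        show ?thesis unfolding e2_def mult_minus_left by (rule gen[OF A[unfolded mult_minus_left] B])
      qed
      have "cmod e2 \<le> (1 - gauss_hat T t) * cmod (1 / (a - \<i> * t)) + t\<^sup>2 / a\<^sup>2 * cmod (1 / (a - \<i> * t))"
        unfolding eq using gauss_hat_bounds[of T t]
        by (intro order_trans[OF norm_triangle_ineq4]) (simp only: norm_mult norm_minus_cancel norm_of_real, simp)
      also have "\<dots> \<le> t\<^sup>2 / 2 * 2 + (4 * t\<^sup>2) * 2"
      proof (intro add_mono mult_mono gh ca)
        have "(1/2)\<^sup>2 \<le> a\<^sup>2" using a by (intro power_mono) auto
        hence "t\<^sup>2 / a\<^sup>2 \<le> t\<^sup>2 / (1/2)\<^sup>2" using a by (intro divide_left_mono mult_pos_pos) auto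
        thus "t\<^sup>2 / a\<^sup>2 \<le> 4 * t\<^sup>2" by (simp add: power2_eq_square)
      qed (use gauss_hat_bounds[of T t] in auto)
      finally show ?thesis by simp
    qed
    define G where "G = exp (- (v / 2))"
    \<comment> \<open>The two imaginary linear terms meet in the real product
      \<open>- B * t / a^2\<close>. It is bounded by a multiple of \<open>B^2 + t^2\<close>, hence
      of \<open>1 / u\<close> times a polynomial in \<open>v\<close>.\<close>
    have main: "Re (exp w * q) - 1 / a = - B * t / a\<^sup>2 + Re ((1 + \<i> * B) * e2) + Re (e1 * q)"
    proof -
      have "exp w * q = (1 + \<i> * B) * (1 / a + \<i> * t / a\<^sup>2) + (1 + \<i> * B) * e2 + e1 * q"
        by (simp add: e1_def e2_def algebra_simps)
      moreover have "Re ((1 + \<i> * B) * (1 / a + \<i> * t / a\<^sup>2)) = 1 / a - B * t / a\<^sup>2"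
      proof -
        have "1 / complex_of_real a = complex_of_real (1 / a)" "\<i> * complex_of_real t / complex_of_real (a\<^sup>2) = \<i> * complex_of_real (t / a\<^sup>2)" by simp_all
        thus ?thesis by (simp only:) simp
      qed
      ultimately show ?thesis by simp
    qed
    have bt: "\<bar>B * t / a\<^sup>2\<bar> \<le> 2 * B\<^sup>2 + 2 * t\<^sup>2"
    proof -
      have "(1/2)\<^sup>2 \<le> a\<^sup>2" using a by (intro power_mono) auto
      hence "\<bar>B * t\<bar> / a\<^sup>2 \<le> \<bar>B * t\<bar> / (1/2)\<^sup>2" using a by (intro divide_left_mono mult_pos_pos) auto
      also have "\<dots> = 2 * (2 * \<bar>B\<bar> * \<bar>t\<bar>)" by (simp add: abs_mult power2_eq_square)
      also have "\<dots> \<le> 2 * (\<bar>B\<bar>\<^sup>2 + \<bar>t\<bar>\<^sup>2)" by (intro mult_left_mono sum_squares_bound) auto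
      finally show ?thesis by simp
    qed
    have be: "\<bar>Re ((1 + \<i> * B) * e2)\<bar> \<le> 9 * t\<^sup>2 + 9/2 * B\<^sup>2 + 9/2 * t ^ 4"
    proof -
      have "\<bar>Re ((1 + \<i> * B) * e2)\<bar> \<le> cmod (1 + \<i> * B) * cmod e2" using abs_Re_le_cmod by (metis norm_mult)
      also have "\<dots> \<le> (1 + \<bar>B\<bar>) * (9 * t\<^sup>2)"
        using norm_triangle_ineq[of 1 "\<i> * complex_of_real B"] by (intro mult_mono e2) (auto simp: norm_mult)
      also have "\<dots> = 9 * t\<^sup>2 + 9/2 * (2 * \<bar>B\<bar> * t\<^sup>2)" by (simp add: algebra_simps)
      also have "\<dots> \<le> 9 * t\<^sup>2 + 9/2 * (\<bar>B\<bar>\<^sup>2 + (t\<^sup>2)\<^sup>2)" by (intro add_left_mono mult_left_mono sum_squares_bound) auto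
      also have "\<dots> = 9 * t\<^sup>2 + 9/2 * B\<^sup>2 + 9/2 * t ^ 4" by (simp add: power_mult[symmetric] algebra_simps)
      finally show ?thesis .
    qed
    have eq1: "\<bar>Re (e1 * q)\<bar> \<le> 2 * cmod e1"
    proof -
      have "\<bar>Re (e1 * q)\<bar> \<le> cmod e1 * cmod q" using abs_Re_le_cmod by (metis norm_mult)
      also have "\<dots> \<le> cmod e1 * 2" by (intro mult_left_mono q2) auto
      finally show ?thesis by simp
    qed
    define E where "E = exp (v / 4)"
    have E1: "E \<ge> 1" using v0 by (simp add: E_def)
    define X where "X = v + v\<^sup>2 + v ^ 3 + v ^ 4"
    have "\<bar>Re (exp w * q) - 1 / a\<bar> \<le> 11 * t\<^sup>2 + (13/2) * B\<^sup>2 + (9/2) * t ^ 4 + 2 * cmod R + 4 * (B\<^sup>2 + (cmod R)\<^sup>2) * E"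
    proof -
      have "\<bar>Re (exp w * q) - 1 / a\<bar> \<le> \<bar>B * t / a\<^sup>2\<bar> + \<bar>Re ((1 + \<i> * B) * e2)\<bar> + \<bar>Re (e1 * q)\<bar>"
        unfolding main by linarith
      also have "\<dots> \<le> (2 * B\<^sup>2 + 2 * t\<^sup>2) + (9 * t\<^sup>2 + 9/2 * B\<^sup>2 + 9/2 * t ^ 4) + 2 * (cmod R + (2 * B\<^sup>2 + 2 * (cmod R)\<^sup>2) * E)"
        unfolding E_def by (intro add_mono bt be order_trans[OF eq1] mult_left_mono e1) auto
      also have "\<dots> = 11 * t\<^sup>2 + (13/2) * B\<^sup>2 + (9/2) * t ^ 4 + 2 * cmod R + 4 * (B\<^sup>2 + (cmod R)\<^sup>2) * E"
        by (simp add: algebra_simps)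
      finally show ?thesis .
    qed
    also have "\<dots> \<le> (11 * t\<^sup>2 + (13/2) * B\<^sup>2 + (9/2) * t ^ 4 + 2 * cmod R) * E + 4 * (B\<^sup>2 + (cmod R)\<^sup>2) * E"
      using mult_left_mono[OF E1, of "11 * t\<^sup>2 + (13/2) * B\<^sup>2 + (9/2) * t ^ 4 + 2 * cmod R"] by simp
    also have "\<dots> = (11 * t\<^sup>2 + (21/2) * B\<^sup>2 + (9/2) * t ^ 4 + 2 * cmod R + 4 * (cmod R)\<^sup>2) * E" by (simp add: algebra_simps)
    also have "\<dots> \<le> (11 * K\<^sup>2 / u * X) * E"
    proof (rule mult_right_mono)
      have "11 * t\<^sup>2 + (21/2) * B\<^sup>2 + (9/2) * t ^ 4 + 2 * cmod R + 4 * (cmod R)\<^sup>2 \<le>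
        11 * (v / u) + (21/2) * (K * v ^ 3 / u) + (9/2) * (v\<^sup>2 / u) + 2 * (K * v\<^sup>2 / u) + 4 * (K\<^sup>2 * v ^ 4 / u)"
        by (intro add_mono mult_left_mono t2 B2 t4 R1 R2) auto
      also have "\<dots> = (11 * v + (21/2) * K * v ^ 3 + ((9/2) + 2 * K) * v\<^sup>2 + 4 * K\<^sup>2 * v ^ 4) / u"
        by (simp add: add_divide_distrib algebra_simps)
      also have "\<dots> \<le> (11 * K\<^sup>2 * v + 11 * K\<^sup>2 * v ^ 3 + 11 * K\<^sup>2 * v\<^sup>2 + 11 * K\<^sup>2 * v ^ 4) / u"
        using KK K2 v0 u by (intro divide_right_mono add_mono mult_right_mono) auto
      also have "\<dots> = 11 * K\<^sup>2 / u * X" by (simp add: X_def algebra_simps add_divide_distrib)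
      finally show "11 * t\<^sup>2 + (21/2) * B\<^sup>2 + (9/2) * t ^ 4 + 2 * cmod R + 4 * (cmod R)\<^sup>2 \<le> 11 * K\<^sup>2 / u * X" .
    qed (simp add: E_def)
    \<comment> \<open>The main factor \<open>exp (- v / 2)\<close> pays \<open>exp (v / 4)\<close>
      for Taylor's remainder and \<open>exp (v / 8)\<close> for the powers of \<open>v\<close>,
      which leaves \<open>exp (- v / 8)\<close> for the integration.\<close>
    also have "\<dots> \<le> (11 * K\<^sup>2 / u * (P * exp (v / 8))) * E"
    proof (intro mult_right_mono mult_left_mono)
      have pw: "v ^ n \<le> 8 ^ n * fact n * exp (v / 8)" for n
      proof -
        have "v ^ n = 8 ^ n * (v / 8) ^ n" by (simp add: power_divide)
        also have "\<dots> \<le> 8 ^ n * (fact n * exp (v / 8))" using v0 by (intro mult_left_mono power_le_fact_exp) auto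
        finally show ?thesis by simp
      qed
      show "X \<le> P * exp (v / 8)" using pw[of 1] pw[of 2] pw[of 3] pw[of 4] by (simp add: X_def P_def fact_numeral)
    qed (use u E1 in auto)
    finally have fin: "\<bar>Re (exp w * q) - 1 / a\<bar> \<le> 11 * K\<^sup>2 / u * (P * exp (v / 8)) * E" .
    have ex: "exp (- (\<sigma>\<^sup>2 * t\<^sup>2 / 2) + \<i> * (\<beta> * t ^ 3) + R) = complex_of_real G * exp w"
    proof -
      have "- (\<sigma>\<^sup>2 * t\<^sup>2 / 2) + \<i> * (\<beta> * t ^ 3) + R = complex_of_real (- (v / 2)) + w"
        by (simp add: v_def w_def B_def)
      thus ?thesis by (simp only: exp_add exp_of_real G_def)
    qed
    have "gauss_hat T t * Re (exp (- (\<sigma>\<^sup>2 * t\<^sup>2 / 2) + \<i> * (\<beta> * t ^ 3) + R) / (a - \<i> * t)) = G * Re (exp w * q)"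
    proof -
      have r: "Re (complex_of_real b * w) = b * Re w" for b w by simp
      have "complex_of_real (gauss_hat T t) * (complex_of_real G * exp w / (a - \<i> * t)) = complex_of_real G * (exp w * q)"
        by (simp add: q_def)
      thus ?thesis unfolding ex by (metis r)
    qed
    hence "\<bar>gauss_hat T t * Re (exp (- (\<sigma>\<^sup>2 * t\<^sup>2 / 2) + \<i> * (\<beta> * t ^ 3) + R) / (a - \<i> * t)) - exp (- (\<sigma>\<^sup>2 * t\<^sup>2 / 2)) / a\<bar>
        = \<bar>G * (Re (exp w * q) - 1 / a)\<bar>"
      by (simp only: right_diff_distrib) (simp only: G_def v_def times_divide_eq_right mult_1_right)
    also have "\<dots> = G * \<bar>Re (exp w * q) - 1 / a\<bar>" unfolding abs_mult by (simp add: G_def)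
    also have "\<dots> \<le> G * (11 * K\<^sup>2 / u * (P * exp (v / 8)) * E)"
      by (intro mult_left_mono fin) (simp add: G_def)
    also have "\<dots> = C / u * (exp (- (v / 2)) * exp (v / 8) * exp (v / 4))" by (simp add: C_def G_def E_def)
    also have "exp (- (v / 2)) * exp (v / 8) * exp (v / 4) = exp (- (\<sigma>\<^sup>2 / 8 * t\<^sup>2))"
      by (simp add: v_def exp_add[symmetric])
    finally show "\<bar>gauss_hat T t * Re (exp (- (\<sigma>\<^sup>2 * t\<^sup>2 / 2) + \<i> * (\<beta> * t ^ 3) + R) / (a - \<i> * t)) - exp (- (\<sigma>\<^sup>2 * t\<^sup>2 / 2)) / a\<bar>
       \<le> C / u * exp (- (\<sigma>\<^sup>2 / 8 * t\<^sup>2))" .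
  qed
qed

lemma exp_neg_le_inverse:
  fixes x :: real
  assumes "x > 0"
  shows "exp (- x) \<le> 1 / x"
proof -
  have "x \<le> exp x" using exp_ge_add_one_self[of x] by linarith
  hence "1 / exp x \<le> 1 / x" using assms by (intro divide_left_mono) auto
  thus ?thesis by (simp add: exp_minus inverse_eq_divide)
qed

text \<open>The law with characteristic function \<open>char M\<close> is assumed Gaussian to fourth order on
  \<open>\<bar>t\<bar> \<le> \<tau>\<close> and negligible up to \<open>T1\<close>; beyond \<open>T1\<close> smoothing at scale \<open>1/u\<close> takes over.\<close>

definition saddle_bound :: "real \<Rightarrow> real \<Rightarrow> real \<Rightarrow> bool" where
  "saddle_bound K C u0 \<longleftrightarrow> (\<forall>(M :: real measure) (a::real) (u::real) (\<sigma>::real) (\<beta>::real) (\<gamma>::real) (\<tau>::real) (T1::real) (\<delta>::real).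
     real_distribution M \<longrightarrow> 1/2 \<le> a \<longrightarrow> a \<le> 1 \<longrightarrow> u \<ge> 1 \<longrightarrow> u \<ge> u0 \<longrightarrow> \<sigma> > 0 \<longrightarrow> \<sigma>\<^sup>2 \<ge> u \<longrightarrow>
     \<beta>\<^sup>2 \<le> K * \<sigma> ^ 6 / u \<longrightarrow> 0 \<le> \<gamma> \<longrightarrow> \<gamma> \<le> K * \<sigma> ^ 4 / u \<longrightarrow>
     \<tau> > 0 \<longrightarrow> \<gamma> * \<tau>\<^sup>2 \<le> \<sigma>\<^sup>2 / 4 \<longrightarrow> \<sigma>\<^sup>2 * \<tau>\<^sup>2 \<ge> u / K \<longrightarrow>
     (\<forall>t. \<bar>t\<bar> \<le> \<tau> \<longrightarrow> (\<exists>R. cmod R \<le> \<gamma> * t ^ 4 \<and> char M t = exp (- (\<sigma>\<^sup>2 * t\<^sup>2 / 2) + \<i> * (\<beta> * t ^ 3) + R))) \<longrightarrow>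
     (\<forall>t. \<tau> \<le> \<bar>t\<bar> \<longrightarrow> \<bar>t\<bar> \<le> T1 \<longrightarrow> cmod (char M t) \<le> \<delta>) \<longrightarrow>
     T1 \<ge> 0 \<longrightarrow> \<delta> \<ge> 0 \<longrightarrow> T1 * \<delta> \<le> 1 / (u * \<sigma>) \<longrightarrow> exp (- (T1\<^sup>2 / (4 * u\<^sup>2))) \<le> 1 / (u\<^sup>2 * \<sigma>) \<longrightarrow>
     \<bar>(\<integral>z. indicator {..0} z * exp (a * z) \<partial>M) * (a * \<sigma> * sqrt (2 * pi)) - 1\<bar> \<le> C / u)"

text \<open>Smoothing is applied with \<open>T = u\<close>. Then \<open>I\<close> is
  \<open>O(1 / \<sigma>)\<close> and \<open>J\<close> equals the main term up to
  \<open>O(1 / (u * \<sigma>))\<close>. The difference of \<open>E\<close> and \<open>J\<close> is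
  at most a multiple of \<open>(E + I) / u\<close>, which has the same order once \<open>E\<close>
  itself is known to be \<open>O(1 / \<sigma>)\<close>.\<close>

lemma saddle_point_local:
  fixes K :: real
  assumes K: "K \<ge> 1"
  shows "\<exists>C u0. saddle_bound K C u0"
proof -
  obtain C0 where C0: "C0 \<ge> 0" and core: "\<And>(\<sigma>::real) (u::real) (\<beta>::real) (\<gamma>::real) (a::real) (t::real) (T::real) (R::complex).
     \<lbrakk>1/2 \<le> a; a \<le> 1; u \<ge> 1; \<sigma> > 0; \<sigma>\<^sup>2 \<ge> u; \<beta>\<^sup>2 \<le> K * \<sigma> ^ 6 / u; 0 \<le> \<gamma>; \<gamma> \<le> K * \<sigma> ^ 4 / u;
     cmod R \<le> \<gamma> * t ^ 4; \<gamma> * t\<^sup>2 \<le> \<sigma>\<^sup>2 / 4; T \<ge> 1\<rbrakk> \<Longrightarrow>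
     \<bar>gauss_hat T t * Re (exp (- (\<sigma>\<^sup>2 * t\<^sup>2 / 2) + \<i> * (\<beta> * t ^ 3) + R) / (a - \<i> * t)) - exp (- (\<sigma>\<^sup>2 * t\<^sup>2 / 2)) / a\<bar>
       \<le> C0 / u * exp (- (\<sigma>\<^sup>2 / 8 * t\<^sup>2))"
    using saddle_integrand_close[OF K] by blast
  \<comment> \<open>\<open>C0\<close> is for the range up to \<open>\<tau>\<close>. The
    \<open>8 * K\<close> covers the Gaussian main term beyond \<open>\<tau>\<close>, where it is at
    most \<open>2 * (4 * K / u)\<close> times \<open>exp (- (\<sigma>^2 / 8 * t^2))\<close>.\<close>
  define C1 where "C1 = C0 + 8 * K"
  define c0 :: real where "c0 = exp 4 * sqrt 2"
  \<comment> \<open>The summands belong to the ranges up to \<open>\<tau>\<close>, up to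
    \<open>T1\<close> and beyond \<open>T1\<close>. In \<open>CJ\<close> the last two are doubled
    because \<open>1 / a \<le> 2\<close>.\<close>
  define CI :: real where "CI = sqrt (4 * pi) + 2 + 2 * sqrt pi"
  define CJ :: real where "CJ = C1 * sqrt (8 * pi) + 4 + 4 * sqrt pi"
  define CE :: real where "CE = 2 * (2 + CJ + CI)"
  define C where "C = (c0 * CE + CI + CJ) * sqrt (2 * pi)"
  have pos: "C1 \<ge> 0" "c0 \<ge> 0" "CI \<ge> 0" "CJ \<ge> 0" "CE \<ge> 0"
    using C0 K by (auto simp: C1_def c0_def CI_def CJ_def CE_def intro!: add_nonneg_nonneg mult_nonneg_nonneg)
  show ?thesis
  proof (rule exI[of _ C], rule exI[of _ "2 * c0"], unfold saddle_bound_def, intro allI impI)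
    fix M :: "real measure" and a u \<sigma> \<beta> \<gamma> \<tau> T1 \<delta> :: real
    assume M: "real_distribution M" and a: "1/2 \<le> a" "a \<le> 1" and u: "u \<ge> 1" "u \<ge> 2 * c0" and s: "\<sigma> > 0" "\<sigma>\<^sup>2 \<ge> u"
      and b: "\<beta>\<^sup>2 \<le> K * \<sigma> ^ 6 / u" and g: "0 \<le> \<gamma>" "\<gamma> \<le> K * \<sigma> ^ 4 / u"
      and tau: "\<tau> > 0" "\<gamma> * \<tau>\<^sup>2 \<le> \<sigma>\<^sup>2 / 4" "\<sigma>\<^sup>2 * \<tau>\<^sup>2 \<ge> u / K"
      and near: "\<forall>t. \<bar>t\<bar> \<le> \<tau> \<longrightarrow> (\<exists>R. cmod R \<le> \<gamma> * t ^ 4 \<and> char M t = exp (- (\<sigma>\<^sup>2 * t\<^sup>2 / 2) + \<i> * (\<beta> * t ^ 3) + R))"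
      and far: "\<forall>t. \<tau> \<le> \<bar>t\<bar> \<longrightarrow> \<bar>t\<bar> \<le> T1 \<longrightarrow> cmod (char M t) \<le> \<delta>"
      and T1: "T1 \<ge> 0" and d: "\<delta> \<ge> 0" "T1 * \<delta> \<le> 1 / (u * \<sigma>)" and tail: "exp (- (T1\<^sup>2 / (4 * u\<^sup>2))) \<le> 1 / (u\<^sup>2 * \<sigma>)"
    interpret real_distribution M by fact
    note [measurable] = char_measurable
    define E where "E = (\<integral>z. indicator {..0} z * exp (a * z) \<partial>M)"
    define h where "h = (\<lambda>t. gauss_hat u t * Re (char M t / (a - \<i> * t)))"
    define I where "I = (\<integral>t. gauss_hat u t * cmod (char M t) \<partial>lborel)"
    define J where "J = 1 / (2 * pi) * (\<integral>t. h t \<partial>lborel)"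
    define \<eta> where "\<eta> = exp (- (T1\<^sup>2 / (4 * u\<^sup>2)))"
    have EJ: "\<bar>E - J\<bar> \<le> c0 / u * E + I / u"
      using smoothing_bound[OF M _ a(2) u(1)] a unfolding E_def J_def I_def c0_def h_def by simp
    have E0: "E \<ge> 0" unfolding E_def by (intro Bochner_Integration.integral_nonneg) auto
    have u0: "u > 0" using u by simp
    have us: "u * \<sigma> > 0" using u0 s by simp
    have gsmall: "\<gamma> * t\<^sup>2 \<le> \<sigma>\<^sup>2 / 4" if "\<bar>t\<bar> \<le> \<tau>" for t
    proof -
      have "\<bar>t\<bar>\<^sup>2 \<le> \<tau>\<^sup>2" using that by (intro power_mono) auto
      hence "\<gamma> * t\<^sup>2 \<le> \<gamma> * \<tau>\<^sup>2" using g by (intro mult_left_mono) auto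
      thus ?thesis using tau by linarith
    qed
    have cnear: "cmod (char M t) \<le> exp (- (\<sigma>\<^sup>2 / 4 * t\<^sup>2))" if t: "\<bar>t\<bar> \<le> \<tau>" for t
    proof -
      obtain R where R: "cmod R \<le> \<gamma> * t ^ 4" "char M t = exp (- (\<sigma>\<^sup>2 * t\<^sup>2 / 2) + \<i> * (\<beta> * t ^ 3) + R)" using near t by blast
      have "Re (- (\<sigma>\<^sup>2 * t\<^sup>2 / 2) + \<i> * (\<beta> * t ^ 3) + R) = - (\<sigma>\<^sup>2 * t\<^sup>2 / 2) + Re R" by simp
      hence "cmod (char M t) = exp (- (\<sigma>\<^sup>2 * t\<^sup>2 / 2) + Re R)" unfolding R(2) norm_exp_eq_Re by simp
      also have "\<gamma> * t ^ 4 = (\<gamma> * t\<^sup>2) * t\<^sup>2" by (simp add: power_add[symmetric])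
      hence "Re R \<le> (\<sigma>\<^sup>2 / 4) * t\<^sup>2" using R(1) mult_right_mono[OF gsmall[OF t] zero_le_power2[of t]] complex_Re_le_cmod[of R] by linarith
      hence "exp (- (\<sigma>\<^sup>2 * t\<^sup>2 / 2) + Re R) \<le> exp (- (\<sigma>\<^sup>2 / 4 * t\<^sup>2))" by simp
      finally show ?thesis .
    qed
    \<comment> \<open>Half of the exponent of \<open>gauss_hat\<close> is evaluated at
      \<open>T1\<close>, the other half is kept for integration.\<close>
    have gtail: "gauss_hat u t \<le> \<eta> * exp (- (1 / (4 * u\<^sup>2) * t\<^sup>2))" if "\<bar>t\<bar> \<ge> T1" for t
    proof -
      have "T1\<^sup>2 \<le> \<bar>t\<bar>\<^sup>2" using that T1 by (intro power_mono) auto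
      hence "T1\<^sup>2 / (4 * u\<^sup>2) \<le> t\<^sup>2 / (4 * u\<^sup>2)" by (intro divide_right_mono) auto
      hence "gauss_hat u t \<le> exp (- (T1\<^sup>2 / (4 * u\<^sup>2)) + - (t\<^sup>2 / (4 * u\<^sup>2)))"
        unfolding gauss_hat_def by simp
      thus ?thesis by (simp add: \<eta>_def exp_add[symmetric])
    qed
    have eta: "\<eta> \<ge> 0" "\<eta> \<le> 1 / (u\<^sup>2 * \<sigma>)" using tail by (auto simp: \<eta>_def)
    let ?ind = "\<lambda>t. indicator {-T1..T1} t :: real"
    let ?tl = "\<lambda>t. \<eta> * exp (- (1 / (4 * u\<^sup>2) * t\<^sup>2))"
    have tl0: "?tl t \<ge> 0" for t using eta by simp
    have chat: "gauss_hat u t * cmod (char M t) \<le> \<delta> * ?ind t + ?tl t" if t: "\<bar>t\<bar> \<ge> \<tau>" for t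
    proof (cases "\<bar>t\<bar> \<le> T1")
      case True
      hence "gauss_hat u t * cmod (char M t) \<le> 1 * \<delta>"
        using far t gauss_hat_bounds[of u t] by (intro mult_mono) auto
      moreover have "?ind t = 1" using True by (auto simp: indicator_def)
      ultimately show ?thesis using tl0[of t] by simp
    next
      case False
      have "gauss_hat u t * cmod (char M t) \<le> ?tl t * 1"
        using False cmod_char_le_1[of t] gauss_hat_bounds[of u t] eta by (intro mult_mono gtail) auto
      moreover have "\<delta> * ?ind t \<ge> 0" using d by simp
      ultimately show ?thesis by simp
    qed
    have q4: "1 / (4 * u\<^sup>2) > 0" "\<sigma>\<^sup>2 / 8 > 0" "\<sigma>\<^sup>2 / 4 > 0" "\<sigma>\<^sup>2 / 2 > 0" using u0 s by auto
    note gi = gaussian_integral(1)[OF q4(1)] gaussian_integral(1)[OF q4(2)] gaussian_integral(1)[OF q4(3)] gaussian_integral(1)[OF q4(4)]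
    note gv = gaussian_integral(2)[OF q4(1)] gaussian_integral(2)[OF q4(2)] gaussian_integral(2)[OF q4(3)] gaussian_integral(2)[OF q4(4)]
    have ii: "integrable lborel ?ind" "(\<integral>t. ?ind t \<partial>lborel) = 2 * T1"
      using T1 by (auto simp: integrable_indicator_iff)
    have sq: "sqrt (pi / (1 / (4 * u\<^sup>2))) = 2 * u * sqrt pi" "sqrt (pi / (\<sigma>\<^sup>2 / 8)) = sqrt (8 * pi) / \<sigma>"
       "sqrt (pi / (\<sigma>\<^sup>2 / 4)) = sqrt (4 * pi) / \<sigma>" "sqrt (pi / (\<sigma>\<^sup>2 / 2)) = sqrt (2 * pi) / \<sigma>"
      using u0 s by (simp_all add: real_sqrt_mult real_sqrt_divide)
    have hb: "has_bochner_integral lborel (\<lambda>t. exp (- (1 / (4 * u\<^sup>2) * t\<^sup>2))) (2 * u * sqrt pi)"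
        "has_bochner_integral lborel (\<lambda>t. exp (- (\<sigma>\<^sup>2 / 8 * t\<^sup>2))) (sqrt (8 * pi) / \<sigma>)"
        "has_bochner_integral lborel (\<lambda>t. exp (- (\<sigma>\<^sup>2 / 4 * t\<^sup>2))) (sqrt (4 * pi) / \<sigma>)"
        "has_bochner_integral lborel (\<lambda>t. exp (- (\<sigma>\<^sup>2 / 2 * t\<^sup>2))) (sqrt (2 * pi) / \<sigma>)"
        "has_bochner_integral lborel ?ind (2 * T1)"
      unfolding has_bochner_integral_iff by (intro conjI gi ii; simp only: gv sq)+
    have Td: "\<delta> * (2 * T1) \<le> 2 / (u * \<sigma>)" using d by (simp add: mult_ac)
    have et: "\<eta> * (2 * u * sqrt pi) \<le> 2 * sqrt pi / (u * \<sigma>)"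
    proof -
      have "\<eta> * (2 * u * sqrt pi) \<le> 1 / (u\<^sup>2 * \<sigma>) * (2 * u * sqrt pi)" using eta u0 by (intro mult_right_mono) auto
      also have "\<dots> = 2 * sqrt pi / (u * \<sigma>)" using u0 s by (simp add: power2_eq_square)
      finally show ?thesis .
    qed
    have hm: "h \<in> borel_measurable lborel" unfolding h_def by measurable
    have I: "I \<le> CI / \<sigma>"
    proof -
      let ?B = "\<lambda>t. exp (- (\<sigma>\<^sup>2 / 4 * t\<^sup>2)) + (\<delta> * ?ind t + ?tl t)"
      have "I \<le> (\<integral>t. ?B t \<partial>lborel)" unfolding I_def
      proof (rule integral_mono)
        show iB: "integrable lborel ?B" using gi ii by (intro Bochner_Integration.integrable_add integrable_mult_right)
        show "integrable lborel (\<lambda>t. gauss_hat u t * cmod (char M t))"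
          using gauss_hat_bounds[of u] cmod_char_le_1
          by (intro Bochner_Integration.integrable_bound[OF integrable_gauss_hat[OF u0]]) (auto simp: abs_mult intro!: mult_left_le)
        fix t :: real
        show "gauss_hat u t * cmod (char M t) \<le> ?B t"
        proof (cases "\<bar>t\<bar> \<le> \<tau>")
          case True
          have "gauss_hat u t * cmod (char M t) \<le> 1 * exp (- (\<sigma>\<^sup>2 / 4 * t\<^sup>2))"
            using gauss_hat_bounds[of u t] by (intro mult_mono cnear True) auto
          moreover have "\<delta> * ?ind t \<ge> 0" using d by simp
          ultimately show ?thesis using tl0[of t] by linarith
        next
          case False
          thus ?thesis using chat[of t] exp_gt_zero[of "- (\<sigma>\<^sup>2 / 4 * t\<^sup>2)"] by linarith
        qed
      qed
      also have "\<dots> = sqrt (4 * pi) / \<sigma> + (\<delta> * (2 * T1) + \<eta> * (2 * u * sqrt pi))"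
        by (intro has_bochner_integral_integral_eq has_bochner_integral_add has_bochner_integral_mult_right hb)
      also have "\<dots> \<le> sqrt (4 * pi) / \<sigma> + (2 / (u * \<sigma>) + 2 * sqrt pi / (u * \<sigma>))"
        by (intro add_mono Td et order_refl)
      also have "\<dots> \<le> sqrt (4 * pi) / \<sigma> + (2 / (1 * \<sigma>) + 2 * sqrt pi / (1 * \<sigma>))"
        using u s by (intro add_mono divide_left_mono mult_right_mono order_refl mult_pos_pos) auto
      finally show ?thesis by (simp add: CI_def add_divide_distrib)
    qed
    have J: "\<bar>J - 1 / (a * \<sigma> * sqrt (2 * pi))\<bar> \<le> CJ / (u * \<sigma>)"
    proof -
      let ?m = "\<lambda>t. exp (- (\<sigma>\<^sup>2 / 2 * t\<^sup>2)) / a"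
      let ?B = "\<lambda>t. C1 / u * exp (- (\<sigma>\<^sup>2 / 8 * t\<^sup>2)) + 2 * (\<delta> * ?ind t + ?tl t)"
      have iB: "integrable lborel ?B" using gi ii by (intro Bochner_Integration.integrable_add integrable_mult_right)
      have im: "integrable lborel ?m" using gi by (intro integrable_divide)
      have rb: "\<bar>h t\<bar> \<le> 2 * (gauss_hat u t * cmod (char M t))" for t
      proof -
        have "cmod (complex_of_real a - \<i> * t) \<ge> 1/2" using cmod_diff_ii_ge[of a t] a by linarith
        hence "cmod (char M t) / cmod (complex_of_real a - \<i> * t) \<le> cmod (char M t) / (1/2)" by (intro divide_left_mono mult_pos_pos) auto
        hence "\<bar>Re (char M t / (a - \<i> * t))\<bar> \<le> 2 * cmod (char M t)"
          using abs_Re_le_cmod[of "char M t / (a - \<i> * t)"] by (simp add: norm_divide)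
        hence "gauss_hat u t * \<bar>Re (char M t / (a - \<i> * t))\<bar> \<le> gauss_hat u t * (2 * cmod (char M t))"
          using gauss_hat_bounds[of u t] by (intro mult_left_mono) auto
        thus ?thesis unfolding h_def abs_mult using gauss_hat_bounds[of u t] by simp
      qed
      have ih: "integrable lborel h"
      proof (rule Bochner_Integration.integrable_bound)
        show "integrable lborel (\<lambda>t. 2 * gauss_hat u t)" using integrable_gauss_hat[OF u0] by simp
        show "AE t in lborel. norm (h t) \<le> norm (2 * gauss_hat u t)"
        proof (rule AE_I2)
          fix t
          have "gauss_hat u t * cmod (char M t) \<le> gauss_hat u t" using cmod_char_le_1 gauss_hat_bounds[of u t] by (intro mult_left_le) auto
          hence "2 * (gauss_hat u t * cmod (char M t)) \<le> 2 * gauss_hat u t" by simp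
          thus "norm (h t) \<le> norm (2 * gauss_hat u t)" using order_trans[OF rb] gauss_hat_bounds[of u t] by simp
        qed
      qed (rule hm)
      have ptw: "\<bar>h t - ?m t\<bar> \<le> ?B t" for t
      proof (cases "\<bar>t\<bar> \<le> \<tau>")
        case True
        obtain R where R: "cmod R \<le> \<gamma> * t ^ 4" "char M t = exp (- (\<sigma>\<^sup>2 * t\<^sup>2 / 2) + \<i> * (\<beta> * t ^ 3) + R)" using near True by blast
        have "\<bar>h t - exp (- (\<sigma>\<^sup>2 * t\<^sup>2 / 2)) / a\<bar> \<le> C0 / u * exp (- (\<sigma>\<^sup>2 / 8 * t\<^sup>2))"
          unfolding h_def R(2) by (rule core[OF a u(1) s b g R(1) gsmall[OF True] u(1)])
        hence "\<bar>h t - ?m t\<bar> \<le> C0 / u * exp (- (\<sigma>\<^sup>2 / 8 * t\<^sup>2))" by simp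
        also have "\<dots> \<le> C1 / u * exp (- (\<sigma>\<^sup>2 / 8 * t\<^sup>2))"
          using u0 K by (intro mult_right_mono divide_right_mono) (auto simp: C1_def)
        finally show ?thesis using tl0[of t] d by (simp add: add_nonneg_nonneg add_increasing2)
      next
        case False
        have 1: "\<bar>h t\<bar> \<le> 2 * (\<delta> * ?ind t + ?tl t)" using False by (intro order_trans[OF rb] mult_left_mono chat) auto
        have "\<bar>?m t\<bar> \<le> 2 * exp (- (\<sigma>\<^sup>2 / 2 * t\<^sup>2))"
          using a mult_right_mono[of "1/2" a "exp (- (\<sigma>\<^sup>2 / 2 * t\<^sup>2))"] by (simp add: field_simps)
        also have "exp (- (\<sigma>\<^sup>2 / 2 * t\<^sup>2)) \<le> exp (- (\<sigma>\<^sup>2 * \<tau>\<^sup>2 / 4) + - (\<sigma>\<^sup>2 / 8 * t\<^sup>2))"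
        proof -
          have "\<tau>\<^sup>2 \<le> \<bar>t\<bar>\<^sup>2" using False tau by (intro power_mono) auto
          hence "\<sigma>\<^sup>2 * \<tau>\<^sup>2 \<le> \<sigma>\<^sup>2 * t\<^sup>2" by (intro mult_left_mono) auto
          moreover have "0 \<le> \<sigma>\<^sup>2 * t\<^sup>2" by simp
          ultimately have "\<sigma>\<^sup>2 * \<tau>\<^sup>2 / 4 + \<sigma>\<^sup>2 * t\<^sup>2 / 8 \<le> \<sigma>\<^sup>2 * t\<^sup>2 / 2" by linarith
          thus ?thesis by simp
        qed
        also have "\<dots> = exp (- (\<sigma>\<^sup>2 * \<tau>\<^sup>2 / 4)) * exp (- (\<sigma>\<^sup>2 / 8 * t\<^sup>2))" by (rule exp_add)
        also have "exp (- (\<sigma>\<^sup>2 * \<tau>\<^sup>2 / 4)) \<le> 4 * K / u"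
        proof -
          have uk: "u / K / 4 > 0" using u0 K by simp
          have "exp (- (\<sigma>\<^sup>2 * \<tau>\<^sup>2 / 4)) \<le> exp (- (u / K / 4))" using tau(3) by simp
          also have "\<dots> \<le> 1 / (u / K / 4)" by (rule exp_neg_le_inverse[OF uk])
          finally show ?thesis using u0 K by (simp add: field_simps)
        qed
        finally have "\<bar>?m t\<bar> \<le> 2 * (4 * K / u * exp (- (\<sigma>\<^sup>2 / 8 * t\<^sup>2)))" by simp
        also have "\<dots> = 8 * K / u * exp (- (\<sigma>\<^sup>2 / 8 * t\<^sup>2))" by simp
        also have "\<dots> \<le> C1 / u * exp (- (\<sigma>\<^sup>2 / 8 * t\<^sup>2))"
          using u0 C0 by (intro mult_right_mono divide_right_mono) (auto simp: C1_def)
        finally show ?thesis using 1 by linarith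
      qed
      have "\<bar>(\<integral>t. h t \<partial>lborel) - (\<integral>t. ?m t \<partial>lborel)\<bar> = \<bar>\<integral>t. h t - ?m t \<partial>lborel\<bar>" using ih im by simp
      also have "\<dots> \<le> (\<integral>t. \<bar>h t - ?m t\<bar> \<partial>lborel)" by (rule integral_abs_bound)
      also have "\<dots> \<le> (\<integral>t. ?B t \<partial>lborel)" using ih im iB ptw by (intro integral_mono) auto
      also have "\<dots> = C1 / u * (sqrt (8 * pi) / \<sigma>) + 2 * (\<delta> * (2 * T1) + \<eta> * (2 * u * sqrt pi))"
        by (intro has_bochner_integral_integral_eq has_bochner_integral_add has_bochner_integral_mult_right hb)
      also have "\<dots> \<le> C1 / u * (sqrt (8 * pi) / \<sigma>) + 2 * (2 / (u * \<sigma>) + 2 * sqrt pi / (u * \<sigma>))"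
        by (intro add_mono mult_left_mono Td et order_refl) auto
      also have "\<dots> = CJ / (u * \<sigma>)" by (simp add: CJ_def add_divide_distrib)
      finally have 0: "\<bar>(\<integral>t. h t \<partial>lborel) - (\<integral>t. ?m t \<partial>lborel)\<bar> \<le> CJ / (u * \<sigma>)" .
      have "(\<integral>t. ?m t \<partial>lborel) = sqrt (2 * pi) / \<sigma> / a"
        by (intro has_bochner_integral_integral_eq has_bochner_integral_divide hb)
      with 0 have 1: "\<bar>(\<integral>t. h t \<partial>lborel) - sqrt (2 * pi) / (\<sigma> * a)\<bar> \<le> CJ / (u * \<sigma>)" by simp
      have "1 / (2 * pi) * (sqrt (2 * pi) / (\<sigma> * a)) = 1 / (a * \<sigma> * sqrt (2 * pi))"
        using a s by (simp add: field_simps)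
      hence "J - 1 / (a * \<sigma> * sqrt (2 * pi)) = 1 / (2 * pi) * ((\<integral>t. h t \<partial>lborel) - sqrt (2 * pi) / (\<sigma> * a))"
        unfolding J_def by (simp only: right_diff_distrib)
      hence "\<bar>J - 1 / (a * \<sigma> * sqrt (2 * pi))\<bar> = 1 / (2 * pi) * \<bar>(\<integral>t. h t \<partial>lborel) - sqrt (2 * pi) / (\<sigma> * a)\<bar>"
        by (simp only: abs_mult) simp
      also have "\<dots> \<le> 1 * \<bar>(\<integral>t. h t \<partial>lborel) - sqrt (2 * pi) / (\<sigma> * a)\<bar>"
        using pi_gt3 by (intro mult_right_mono) (auto simp: field_simps)
      also have "\<dots> \<le> CJ / (u * \<sigma>)" using 1 by simp
      finally show ?thesis .
    qed
    have sp: "sqrt (2 * pi) \<ge> 1" using pi_gt3 by simp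
    have asp: "a * \<sigma> * sqrt (2 * pi) > 0" using a s by simp
    have mm: "1 / (a * \<sigma> * sqrt (2 * pi)) \<le> 2 / \<sigma>"
    proof -
      have "1/2 * \<sigma> * 1 \<le> a * \<sigma> * sqrt (2 * pi)" using a s sp by (intro mult_mono) auto
      hence "1 / (a * \<sigma> * sqrt (2 * pi)) \<le> 1 / (1/2 * \<sigma> * 1)" using asp s by (intro divide_left_mono) auto
      thus ?thesis by simp
    qed
    have drop: "x / (u * \<sigma>) \<le> x / \<sigma>" if "x \<ge> 0" for x
    proof -
      have "x / (u * \<sigma>) \<le> x / (1 * \<sigma>)" using that u s by (intro divide_left_mono mult_right_mono) auto
      thus ?thesis by simp
    qed
    have Iu: "I / u \<le> CI / (u * \<sigma>)"
      using divide_right_mono[OF I, of u] u0 by (simp add: mult.commute)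
    \<comment> \<open>A bound on \<open>E\<close> itself: \<open>u \<ge> 2 * c0\<close> makes
      \<open>c0 / u * E\<close> at most \<open>E / 2\<close>, which is moved to the left-hand
      side.\<close>
    have EE: "E \<le> CE / \<sigma>"
    proof -
      have "c0 / u \<le> 1/2" using u u0 by (simp add: field_simps)
      hence "c0 / u * E \<le> 1/2 * E" using E0 by (intro mult_right_mono) auto
      moreover have "E \<le> 2 * (J + X)" if "Y \<le> 1/2 * E" "E - J \<le> Y + X" for X Y using that by argo
      ultimately have "E \<le> 2 * (J + I / u)" using abs_le_D1[OF EJ] by blast
      also have "\<dots> \<le> 2 * ((2 / \<sigma> + CJ / \<sigma>) + CI / \<sigma>)"
      proof (intro mult_left_mono add_mono)
        have "J \<le> p + q" if "J - m \<le> r" "m \<le> p" "r \<le> q" for m p q r using that by linarith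
        thus "J \<le> 2 / \<sigma> + CJ / \<sigma>" using abs_le_D1[OF J] mm drop[OF pos(4)] by blast
        show "I / u \<le> CI / \<sigma>" using Iu drop[OF pos(3)] by (rule order_trans)
      qed auto
      also have "\<dots> = CE / \<sigma>" by (simp add: CE_def add_divide_distrib)
      finally show ?thesis .
    qed
    have "\<bar>E - 1 / (a * \<sigma> * sqrt (2 * pi))\<bar> \<le> c0 / u * (CE / \<sigma>) + CI / (u * \<sigma>) + CJ / (u * \<sigma>)"
    proof -
      have "c0 / u * E \<le> c0 / u * (CE / \<sigma>)" using pos u0 by (intro mult_left_mono EE) auto
      moreover have "\<bar>E - m\<bar> \<le> p + q + r" if "\<bar>E - J\<bar> \<le> X + Y" "\<bar>J - m\<bar> \<le> r" "Y \<le> q" "X \<le> p" for m p q r X Y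
        using that by linarith
      ultimately show ?thesis using EJ J Iu by blast
    qed
    also have "\<dots> = (c0 * CE + CI + CJ) / (u * \<sigma>)" by (simp add: add_divide_distrib)
    finally have F: "\<bar>E - 1 / (a * \<sigma> * sqrt (2 * pi))\<bar> \<le> (c0 * CE + CI + CJ) / (u * \<sigma>)" .
    have eqE: "E * (a * \<sigma> * sqrt (2 * pi)) - 1 = (E - 1 / (a * \<sigma> * sqrt (2 * pi))) * (a * \<sigma> * sqrt (2 * pi))"
      using a s by (simp add: left_diff_distrib)
    have "\<bar>E * (a * \<sigma> * sqrt (2 * pi)) - 1\<bar> = \<bar>E - 1 / (a * \<sigma> * sqrt (2 * pi))\<bar> * (a * \<sigma> * sqrt (2 * pi))"
    proof -
      have "\<bar>x * r\<bar> = \<bar>x\<bar> * r" if "r > 0" for x r :: real using that by (simp add: abs_mult)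
      thus ?thesis unfolding eqE using asp by blast
    qed
    also have "\<dots> \<le> (c0 * CE + CI + CJ) / (u * \<sigma>) * (1 * \<sigma> * sqrt (2 * pi))"
      using F a s pos us by (intro mult_mono) (auto intro!: divide_nonneg_pos add_nonneg_nonneg mult_nonneg_nonneg)
    also have "\<dots> = C / u" using s u0 by (simp add: C_def)
    finally show "\<bar>(\<integral>z. indicator {..0} z * exp (a * z) \<partial>M) * (a * \<sigma> * sqrt (2 * pi)) - 1\<bar> \<le> C / u"
      by (simp add: E_def)
  qed
qed

section \<open>The Euler product as a compound Poisson law\<close>

text \<open>Zero is excluded explicitly because its set of prime factors is empty.\<close>

definition smooth_nats :: "nat set \<Rightarrow> nat set" where
  "smooth_nats P = {n. n > 0 \<and> prime_factors n \<subseteq> P}"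

lemma smooth_nats_empty: "smooth_nats {} = {1}"
  by (auto simp: smooth_nats_def prime_factorization_empty_iff)

lemma smooth_nats_dvd: "n \<in> smooth_nats P \<longleftrightarrow> n > 0 \<and> (\<forall>p. prime p \<longrightarrow> p dvd n \<longrightarrow> p \<in> P)"
  by (auto simp: smooth_nats_def in_prime_factors_iff)

lemma multiplicity_power_mult:
  assumes "prime (p::nat)" "\<not> p dvd m"
  shows "multiplicity p (p ^ k * m) = k"
proof (rule multiplicity_eqI)
  show "\<not> p ^ Suc k dvd p ^ k * m" using assms by (simp add: prime_gt_0_nat)
qed simp

text \<open>Splitting off the power of \<open>p\<close>; reindexing along this bijection is the
  induction step of \<open>euler_product\<close>.\<close>

lemma smooth_nats_insert:
  assumes p: "prime p" "p \<notin> P"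
  shows "bij_betw (\<lambda>(m, k). p ^ k * m) (smooth_nats P \<times> UNIV) (smooth_nats (insert p P))"
  unfolding bij_betw_def
proof
  have nd: "\<not> p dvd m" if "m \<in> smooth_nats P" for m using that p by (auto simp: smooth_nats_dvd)
  show "inj_on (\<lambda>(m, k). p ^ k * m) (smooth_nats P \<times> UNIV)"
  proof (rule inj_onI, clarify)
    fix m k m' k' assume m: "m \<in> smooth_nats P" "m' \<in> smooth_nats P" and eq: "p ^ k * m = p ^ k' * m'"
    have "k = k'" using multiplicity_power_mult[OF p(1) nd[OF m(1)], of k] multiplicity_power_mult[OF p(1) nd[OF m(2)], of k'] eq by simp
    thus "m = m' \<and> k = k'" using eq p by (simp add: prime_gt_0_nat)
  qed
  show "(\<lambda>(m, k). p ^ k * m) ` (smooth_nats P \<times> UNIV) = smooth_nats (insert p P)"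
  proof (intro equalityI subsetI)
    fix n assume n: "n \<in> smooth_nats (insert p P)"
    define v where "v = multiplicity p n"
    obtain m where m: "n = p ^ v * m" "\<not> p dvd m"
      using multiplicity_decompose'[of n p] n p unfolding v_def smooth_nats_def
      by (metis (no_types, lifting) mem_Collect_eq mult.commute not_prime_unit less_numeral_extra(3))
    have "m \<in> smooth_nats P"
      unfolding smooth_nats_dvd
    proof (intro conjI allI impI)
      show "m > 0" using m n by (auto simp: smooth_nats_def intro: Nat.gr0I)
      fix r assume r: "prime r" "r dvd m"
      hence "r \<in> insert p P" using n m unfolding smooth_nats_dvd by auto
      thus "r \<in> P" using r m by auto
    qed
    thus "n \<in> (\<lambda>(m, k). p ^ k * m) ` (smooth_nats P \<times> UNIV)" using m by force
  next
    fix n assume "n \<in> (\<lambda>(m, k). p ^ k * m) ` (smooth_nats P \<times> UNIV)"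
    then obtain m k where n: "n = p ^ k * m" "m \<in> smooth_nats P" by auto
    show "n \<in> smooth_nats (insert p P)"
      unfolding smooth_nats_dvd
    proof (intro conjI allI impI)
      show "n > 0" using n p by (simp add: smooth_nats_def prime_gt_0_nat)
      fix r assume r: "prime r" "r dvd n"
      hence "r dvd p ^ k \<or> r dvd m" using n by (simp add: prime_dvd_mult_iff)
      thus "r \<in> insert p P"
      proof
        assume "r dvd p ^ k"
        hence "r dvd p" using r prime_dvd_power by blast
        thus ?thesis using r p by (simp add: primes_dvd_imp_eq)
      next
        assume "r dvd m" thus ?thesis using r n by (auto simp: smooth_nats_dvd)
      qed
    qed
  qed
qed

lemma norm_of_real_mult_less_one:
  fixes z :: complex and c :: real
  assumes "\<bar>c\<bar> \<le> 1" "norm z < 1"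
  shows "norm (c * z) < 1"
proof -
  have "norm (c * z) \<le> 1 * norm z" unfolding norm_mult using assms by (intro mult_right_mono) auto
  thus ?thesis using assms by linarith
qed

text \<open>Cauchy product of the geometric series of \<open>c * z\<close> and
  \<open>z\<close>.\<close>

lemma local_series:
  fixes z :: complex and c :: real
  assumes c: "\<bar>c\<bar> \<le> 1" and z: "norm z < 1"
  shows "summable (\<lambda>k. norm (complex_of_real (local_coeff c k) * z ^ k))"
    and "(\<lambda>k. complex_of_real (local_coeff c k) * z ^ k) sums (1 / ((1 - z) * (1 - c * z)))"
proof -
  have cz: "norm (c * z) < 1" by (rule norm_of_real_mult_less_one[OF c z])
  have sz: "summable (\<lambda>k. norm (z ^ k))" "summable (\<lambda>k. norm ((c * z) ^ k))"
    using z cz by (simp_all add: norm_power summable_geometric)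
  have eq: "complex_of_real (local_coeff c k) * z ^ k = (\<Sum>i\<le>k. (c * z) ^ i * z ^ (k - i))" for k
  proof -
    have "(c * z) ^ i * z ^ (k - i) = complex_of_real (c ^ i) * z ^ k" if "i \<le> k" for i
      using that by (simp add: power_mult_distrib mult.assoc flip: power_add)
    thus ?thesis by (simp add: sum_distrib_right)
  qed
  show "(\<lambda>k. complex_of_real (local_coeff c k) * z ^ k) sums (1 / ((1 - z) * (1 - c * z)))"
  proof -
    have "(\<lambda>k. \<Sum>i\<le>k. (c * z) ^ i * z ^ (k - i)) sums ((\<Sum>k. (c * z) ^ k) * (\<Sum>k. z ^ k))"
      by (rule Cauchy_product_sums[OF sz(2,1)])
    also have "(\<Sum>k. (c * z) ^ k) * (\<Sum>k. z ^ k) = 1 / ((1 - z) * (1 - c * z))"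
      using suminf_geometric[OF cz] suminf_geometric[OF z] by (simp add: mult.commute)
    finally show ?thesis unfolding eq .
  qed
  have "summable (\<lambda>k. \<Sum>i\<le>k. norm ((c * z) ^ i) * norm (z ^ (k - i)))"
    using sz by (intro summable_Cauchy_product) auto
  thus "summable (\<lambda>k. norm (complex_of_real (local_coeff c k) * z ^ k))"
  proof (rule summable_comparison_test'[where N = 0])
    fix k show "norm (norm (complex_of_real (local_coeff c k) * z ^ k)) \<le> (\<Sum>i\<le>k. norm ((c * z) ^ i) * norm (z ^ (k - i)))"
    proof -
      have "norm (complex_of_real (local_coeff c k) * z ^ k) \<le> (\<Sum>i\<le>k. norm ((c * z) ^ i * z ^ (k - i)))"
        unfolding eq by (rule norm_sum)
      also have "\<dots> = (\<Sum>i\<le>k. norm ((c * z) ^ i) * norm (z ^ (k - i)))" by (simp only: norm_mult)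
      finally show ?thesis by (simp only: real_norm_def abs_norm_cancel)
    qed
  qed
qed

lemma chi4_abs_le: "\<bar>chi4 p\<bar> \<le> 1"
  using chi4_cases[of p] by auto

text \<open>A general completely multiplicative \<open>\<omega>\<close> lets one statement serve
  both \<open>H_G\<close>, with \<open>n powr (-s)\<close>, and the characteristic function, with an
  additional phase \<open>iexp (t * ln n)\<close>. Absolute summability is part of the induction
  because the step sums over a product set.\<close>

lemma euler_product:
  fixes \<omega> :: "nat \<Rightarrow> complex"
  assumes fin: "finite P" and pr: "\<And>p. p \<in> P \<Longrightarrow> prime p" and w1: "\<omega> 1 = 1"
    and mult: "\<And>m n. m > 0 \<Longrightarrow> n > 0 \<Longrightarrow> \<omega> (m * n) = \<omega> m * \<omega> n"
    and lt: "\<And>p. p \<in> P \<Longrightarrow> norm (\<omega> p) < 1"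
  shows "(\<lambda>n. norm (complex_of_real (real (r2 n) / 4) * \<omega> n)) summable_on (smooth_nats P) \<and>
    ((\<lambda>n. complex_of_real (real (r2 n) / 4) * \<omega> n) has_sum (\<Prod>p\<in>P. 1 / ((1 - \<omega> p) * (1 - chi4 p * \<omega> p)))) (smooth_nats P)"
  using fin pr lt
proof (induction P rule: finite_induct)
  case empty
  have "((\<lambda>n. complex_of_real (real (r2 n) / 4) * \<omega> n) has_sum (\<Sum>n\<in>{1}. complex_of_real (real (r2 n) / 4) * \<omega> n)) {1}"
    by (rule has_sum_finite) simp
  thus ?case unfolding smooth_nats_empty using w1 r2_1 by simp
next
  case (insert p P)
  have p: "prime p" "norm (\<omega> p) < 1" using insert by auto
  let ?f = "\<lambda>n. complex_of_real (real (r2 n) / 4) * \<omega> n"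
  let ?g = "\<lambda>k. complex_of_real (local_coeff (chi4 p) k) * \<omega> p ^ k"
  define Q where "Q = (\<Prod>p\<in>P. 1 / ((1 - \<omega> p) * (1 - chi4 p * \<omega> p)))"
  have IH: "(\<lambda>n. norm (?f n)) summable_on (smooth_nats P)" "(?f has_sum Q) (smooth_nats P)"
    using insert unfolding Q_def by auto
  have pw: "\<omega> (p ^ k) = \<omega> p ^ k" for k
    using p w1 by (induction k) (auto simp: mult prime_gt_0_nat)
  have fe: "?f (p ^ k * m) = ?f m * ?g k" if "m \<in> smooth_nats P" for m k
  proof -
    have m: "m > 0" "\<not> p dvd m" using that insert.hyps p by (auto simp: smooth_nats_dvd)
    have "\<omega> (p ^ k * m) = \<omega> p ^ k * \<omega> m" using m p by (subst mult) (auto simp: pw prime_gt_0_nat)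
    thus ?thesis by (simp add: r2_prime_power_mult[OF p(1) m(2)])
  qed
  note ls = local_series[OF chi4_abs_le[of p] p(2)]
  have gs: "(?g has_sum (1 / ((1 - \<omega> p) * (1 - chi4 p * \<omega> p)))) UNIV"
    by (rule norm_summable_imp_has_sum[OF ls])
  have ga: "(\<lambda>k. norm (?g k)) summable_on UNIV"
    using ls(1) by (subst summable_on_UNIV_nonneg_real_iff) auto
  have as: "(\<lambda>x. norm (case x of (m, k) \<Rightarrow> ?f m * ?g k)) summable_on (smooth_nats P \<times> UNIV)"
    unfolding Infinite_Sum.abs_summable_on_Sigma_iff
  proof (intro conjI ballI)
    fix m show "(\<lambda>k. norm (case (m, k) of (m, k) \<Rightarrow> ?f m * ?g k)) summable_on UNIV"
      using summable_on_cmult_right[OF ga, of "norm (?f m)"] by (simp add: norm_mult)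
    have "(\<lambda>m. norm (?f m) * (\<Sum>\<^sub>\<infinity>k. norm (?g k))) summable_on smooth_nats P"
      by (rule summable_on_cmult_left[OF IH(1)])
    moreover have "(\<Sum>\<^sub>\<infinity>k. norm (?g k)) \<ge> 0" by (intro infsum_nonneg) auto
    moreover have "(\<Sum>\<^sub>\<infinity>k. norm (case (m, k) of (m, k) \<Rightarrow> ?f m * ?g k)) = norm (?f m) * (\<Sum>\<^sub>\<infinity>k. norm (?g k))" for m
      unfolding split_conv norm_mult[of "?f m"] by (rule infsum_cmult_right) (use ga in auto)
    ultimately show "(\<lambda>m. norm (\<Sum>\<^sub>\<infinity>k\<in>UNIV. norm (case (m, k) of (m, k) \<Rightarrow> ?f m * ?g k))) summable_on smooth_nats P"
      by (simp only: real_norm_def abs_mult abs_norm_cancel abs_of_nonneg)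
  qed
  have hs: "((\<lambda>(m, k). ?f m * ?g k) has_sum (Q * (1 / ((1 - \<omega> p) * (1 - chi4 p * \<omega> p))))) (smooth_nats P \<times> UNIV)"
  proof (rule has_sum_SigmaI)
    fix m show "((\<lambda>k. case (m, k) of (m, k) \<Rightarrow> ?f m * ?g k) has_sum (?f m * (1 / ((1 - \<omega> p) * (1 - chi4 p * \<omega> p))))) UNIV"
      unfolding split_conv by (rule has_sum_cmult_right[OF gs])
    show "((\<lambda>m. ?f m * (1 / ((1 - \<omega> p) * (1 - chi4 p * \<omega> p)))) has_sum (Q * (1 / ((1 - \<omega> p) * (1 - chi4 p * \<omega> p))))) (smooth_nats P)"
      by (rule has_sum_cmult_left[OF IH(2)])
    show "(\<lambda>(m, k). ?f m * ?g k) summable_on smooth_nats P \<times> UNIV" using as by (rule Infinite_Sum.abs_summable_summable)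
  qed
  note bij = smooth_nats_insert[OF p(1) insert.hyps(2)]
  have cong: "(case x of (m, k) \<Rightarrow> ?f m * ?g k) = ?f (case x of (m, k) \<Rightarrow> p ^ k * m)" if "x \<in> smooth_nats P \<times> UNIV" for x
    using that fe by (cases x) auto
  have "((\<lambda>x. ?f (case x of (m, k) \<Rightarrow> p ^ k * m)) has_sum (Q * (1 / ((1 - \<omega> p) * (1 - chi4 p * \<omega> p))))) (smooth_nats P \<times> UNIV)"
    using hs by (subst has_sum_cong[OF cong[symmetric]]) auto
  hence 1: "(?f has_sum (Q * (1 / ((1 - \<omega> p) * (1 - chi4 p * \<omega> p))))) (smooth_nats (insert p P))"
    using has_sum_reindex_bij_betw[OF bij, of ?f] by simp
  have "(\<lambda>x. norm (?f (case x of (m, k) \<Rightarrow> p ^ k * m))) summable_on (smooth_nats P \<times> UNIV)"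
    using as by (subst summable_on_cong[of _ _ "\<lambda>x. norm (case x of (m, k) \<Rightarrow> ?f m * ?g k)"]) (auto simp only: cong)
  hence 2: "(\<lambda>n. norm (?f n)) summable_on smooth_nats (insert p P)"
    using summable_on_reindex_bij_betw[OF bij, of "\<lambda>n. norm (?f n)"] by simp
  show ?case using 1 2 insert.hyps unfolding Q_def by (simp add: mult.commute)
qed

text \<open>Coefficients of the logarithm of \<open>1 / ((1 - q) (1 - c q))\<close>. Division by zero gives
  \<open>levy c q 0 = 0\<close>, so series over all \<open>k\<close> effectively start at 1.\<close>

definition levy :: "real \<Rightarrow> real \<Rightarrow> nat \<Rightarrow> real" where
  "levy c q k = (1 + c ^ k) * q ^ k / real k"

text \<open>Stated after exponentiation, so that no branch of the logarithm has to be followed when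
  local factors are multiplied.\<close>

lemma levy_exp:
  fixes z :: complex and c :: real
  assumes c: "\<bar>c\<bar> \<le> 1" and z: "norm z < 1"
  shows "summable (\<lambda>k. complex_of_real (1 + c ^ k) * z ^ k / of_nat k)"
    and "exp (\<Sum>k. complex_of_real (1 + c ^ k) * z ^ k / of_nat k) = 1 / ((1 - z) * (1 - c * z))"
proof -
  have cz: "norm (c * z) < 1" by (rule norm_of_real_mult_less_one[OF c z])
  have ls: "(\<lambda>k. w ^ k / of_nat k) sums (- ln (1 - w))" if "norm w < 1" for w :: complex
    using sums_minus[OF Ln_series'[of "- w"]] that by simp
  have nz: "1 - w \<noteq> 0" if "norm w < 1" for w :: complex using that by auto
  have eq: "complex_of_real (1 + c ^ k) * z ^ k / of_nat k = z ^ k / of_nat k + (c * z) ^ k / of_nat k" for k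
    by (simp add: power_mult_distrib distrib_right add_divide_distrib)
  have s: "(\<lambda>k. complex_of_real (1 + c ^ k) * z ^ k / of_nat k) sums (- ln (1 - z) + - ln (1 - c * z))"
    unfolding eq by (intro sums_add ls z cz)
  show "summable (\<lambda>k. complex_of_real (1 + c ^ k) * z ^ k / of_nat k)" using s by (rule sums_summable)
  have "exp (- ln (1 - z) + - ln (1 - c * z)) = exp (- ln (1 - z)) * exp (- ln (1 - c * z))" by (rule exp_add)
  also have "\<dots> = 1 / ((1 - z) * (1 - c * z))"
    using nz[OF z] nz[OF cz] by (simp add: exp_minus exp_Ln inverse_eq_divide)
  finally show "exp (\<Sum>k. complex_of_real (1 + c ^ k) * z ^ k / of_nat k) = 1 / ((1 - z) * (1 - c * z))"
    using sums_unique[OF s] by simp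
qed

lemma levy_zero [simp]: "levy c q 0 = 0" by (simp add: levy_def)

lemma levy_nonneg: "\<bar>c\<bar> \<le> 1 \<Longrightarrow> 0 \<le> q \<Longrightarrow> levy c q k \<ge> 0"
proof -
  assume c: "\<bar>c\<bar> \<le> 1" and q: "0 \<le> q"
  have "\<bar>c ^ k\<bar> \<le> 1" using c by (simp add: power_abs power_le_one)
  hence "1 + c ^ k \<ge> 0" by linarith
  thus ?thesis using q by (simp add: levy_def)
qed

lemma levy_le:
  assumes c: "\<bar>c\<bar> \<le> 1" and q: "0 \<le> q"
  shows "levy c q k \<le> 2 * q ^ k"
proof (cases "k = 0")
  case False
  have "\<bar>c ^ k\<bar> \<le> 1" using c by (simp add: power_abs power_le_one)
  hence "(1 + c ^ k) * q ^ k \<le> 2 * q ^ k" using q by (intro mult_right_mono) auto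
  moreover have "(1 + c ^ k) * q ^ k / real k \<le> (1 + c ^ k) * q ^ k / 1"
    using False q \<open>\<bar>c ^ k\<bar> \<le> 1\<close> by (intro divide_left_mono mult_nonneg_nonneg) auto
  ultimately show ?thesis by (simp add: levy_def)
qed (use q in simp)

text \<open>Writing \<open>q = r * r\<close>, one factor \<open>r ^ k\<close> absorbs the power of
  \<open>k\<close> and the other gives the geometric series.\<close>

lemma summable_power_mult_geometric:
  fixes q :: real
  assumes "0 < q" "q < 1"
  shows "summable (\<lambda>k. real k ^ j * q ^ k)"
proof -
  define b where "b = - ln q / 2"
  have b: "b > 0" using assms by (simp add: b_def)
  define r where "r = exp (- b)"
  have r: "0 < r" "r < 1" using b by (auto simp: r_def)
  have q: "q = r * r"
  proof -
    have "r * r = exp (ln q)" by (simp add: r_def b_def flip: exp_add)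
    thus ?thesis using assms by simp
  qed
  show ?thesis
  proof (rule summable_comparison_test'[where N = 0])
    show "summable (\<lambda>k. fact j / b ^ j * r ^ k)" using r by (intro summable_mult summable_geometric) auto
    fix k :: nat
    have "(b * real k) ^ j \<le> fact j * exp (b * real k)" using b by (intro power_le_fact_exp) simp
    also have "exp (b * real k) = 1 / r ^ k"
    proof -
      have "r ^ k = exp (real k * (- b))" unfolding r_def by (rule exp_of_nat_mult[symmetric])
      thus ?thesis by (simp add: exp_minus inverse_eq_divide mult.commute)
    qed
    finally have "real k ^ j * r ^ k \<le> fact j / b ^ j" using b r by (simp add: power_mult_distrib field_simps)
    hence "(real k ^ j * r ^ k) * r ^ k \<le> fact j / b ^ j * r ^ k" using r by (intro mult_right_mono) auto
    thus "norm (real k ^ j * q ^ k) \<le> fact j / b ^ j * r ^ k"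
      using r by (simp add: q power_mult_distrib abs_mult mult.assoc)
  qed
qed

text \<open>The \<open>j\<close>-th moment of the jump measure of one prime, in which a jump of
  \<open>k\<close> units has intensity \<open>levy c q k\<close>.\<close>

definition levy_moment :: "nat \<Rightarrow> real \<Rightarrow> real \<Rightarrow> real" where
  "levy_moment j c q = (\<Sum>k. levy c q k * real k ^ j)"

lemma summable_levy_moment:
  assumes c: "\<bar>c\<bar> \<le> 1" and q: "0 < q" "q < 1"
  shows "summable (\<lambda>k. levy c q k * real k ^ j)"
proof (rule summable_comparison_test'[where N = 0])
  show "summable (\<lambda>k. 2 * (real k ^ j * q ^ k))" by (intro summable_mult summable_power_mult_geometric q)
  fix k
  have "levy c q k * real k ^ j \<le> 2 * q ^ k * real k ^ j" using c q by (intro mult_right_mono levy_le) auto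
  thus "norm (levy c q k * real k ^ j) \<le> 2 * (real k ^ j * q ^ k)"
    using levy_nonneg[OF c, of q k] q by (simp add: abs_mult mult_ac)
qed

lemma levy_moment_1_2:
  assumes c: "\<bar>c\<bar> \<le> 1" and q: "0 < q" "q < 1"
  shows "levy_moment 1 c q = q / (1 - q) + c * q / (1 - c * q)"
    and "levy_moment 2 c q = q / (1 - q)\<^sup>2 + c * q / (1 - c * q)\<^sup>2"
proof -
  have cq: "\<bar>c * q\<bar> < 1"
  proof -
    have "\<bar>c * q\<bar> \<le> 1 * q" unfolding abs_mult using c q by (intro mult_mono) auto
    thus ?thesis using q by simp
  qed
  have g1: "(\<lambda>k. x ^ Suc k) sums (x / (1 - x))" if "\<bar>x\<bar> < 1" for x :: real
    using sums_mult[OF geometric_sums[of x], of x] that by simp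
  have g2: "(\<lambda>k. real (Suc k) * x ^ Suc k) sums (x / (1 - x)\<^sup>2)" if "\<bar>x\<bar> < 1" for x :: real
    using sums_mult[OF geometric_deriv_sums[of x], of x] that by (simp add: mult_ac)
  have e1: "levy c q (Suc k) * real (Suc k) ^ 1 = q ^ Suc k + (c * q) ^ Suc k" for k
  proof -
    define n where "n = real (Suc k)"
    have "n \<noteq> 0" by (simp add: n_def)
    thus ?thesis unfolding levy_def n_def[symmetric] power_mult_distrib
      by (simp add: distrib_right add_divide_distrib del: power_Suc)
  qed
  have e2: "levy c q (Suc k) * real (Suc k) ^ 2 = real (Suc k) * q ^ Suc k + real (Suc k) * (c * q) ^ Suc k" for k
  proof -
    define n where "n = real (Suc k)"
    have "n \<noteq> 0" by (simp add: n_def)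
    thus ?thesis unfolding levy_def n_def[symmetric] power_mult_distrib
      by (simp add: field_simps power2_eq_square del: power_Suc)
  qed
  have "(\<lambda>k. levy c q (Suc k) * real (Suc k) ^ 1) sums (q / (1 - q) + c * q / (1 - c * q))"
    unfolding e1 using q cq by (intro sums_add g1) auto
  from sums_Suc_iff[THEN iffD1, OF this] show "levy_moment 1 c q = q / (1 - q) + c * q / (1 - c * q)"
    unfolding levy_moment_def by (simp add: sums_iff)
  have "(\<lambda>k. levy c q (Suc k) * real (Suc k) ^ 2) sums (q / (1 - q)\<^sup>2 + c * q / (1 - c * q)\<^sup>2)"
    unfolding e2 using q cq by (intro sums_add g2) auto
  from sums_Suc_iff[THEN iffD1, OF this] show "levy_moment 2 c q = q / (1 - q)\<^sup>2 + c * q / (1 - c * q)\<^sup>2"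
    unfolding levy_moment_def by (simp add: sums_iff)
qed

text \<open>Only the term \<open>k = 1\<close> is kept; it carries exactly the weight of Mertens'
  estimate.\<close>

lemma levy_moment_lower:
  assumes c: "\<bar>c\<bar> \<le> 1" and q: "0 < q" "q < 1"
  shows "levy_moment j c q \<ge> (1 + c) * q"
proof -
  have "(\<Sum>k\<in>{1}. levy c q k * real k ^ j) \<le> (\<Sum>k. levy c q k * real k ^ j)"
    using levy_nonneg[OF c, of q] q by (intro sum_le_suminf summable_levy_moment c q) auto
  thus ?thesis by (simp add: levy_moment_def levy_def)
qed

text \<open>One factor \<open>q\<close> is pulled out of \<open>q ^ k\<close> and the rest is at
  most \<open>(3/4) ^ (k - 1)\<close>, which explains the 4/3. This bound, uniform in
  \<open>q\<close>, is the reason for keeping the saddle point at or above 1/2.\<close>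

lemma levy_moment_upper:
  "\<exists>C\<ge>0. \<forall>c q j. \<bar>c\<bar> \<le> 1 \<longrightarrow> 0 < q \<longrightarrow> q \<le> 3/4 \<longrightarrow> j \<le> 4 \<longrightarrow> levy_moment j c q \<le> C * q"
proof -
  define B where "B = (\<Sum>k. real k ^ 4 * (3/4) ^ k)"
  have sB: "summable (\<lambda>k. real k ^ 4 * (3/4::real) ^ k)" by (rule summable_power_mult_geometric) auto
  have B0: "B \<ge> 0" unfolding B_def by (intro suminf_nonneg sB) auto
  have "levy_moment j c q \<le> 2 * (4/3) * B * q" if c: "\<bar>c\<bar> \<le> 1" and q: "0 < q" "q \<le> 3/4" and j: "j \<le> 4" for c q j
  proof -
    have "levy_moment j c q \<le> (\<Sum>k. 2 * (4/3) * q * (real k ^ 4 * (3/4) ^ k))"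
      unfolding levy_moment_def
    proof (rule suminf_le)
      show "summable (\<lambda>k. levy c q k * real k ^ j)" using c q by (intro summable_levy_moment) auto
      show "summable (\<lambda>k. 2 * (4/3) * q * (real k ^ 4 * (3/4) ^ k))" by (intro summable_mult sB)
      fix k
      show "levy c q k * real k ^ j \<le> 2 * (4/3) * q * (real k ^ 4 * (3/4) ^ k)"
      proof (cases k)
        case (Suc i)
        have "levy c q k * real k ^ j \<le> (2 * q ^ k) * real k ^ 4"
          using c q j Suc by (intro mult_mono levy_le power_increasing) auto
        also have "q ^ k = q * q ^ i" using Suc by simp
        also have "(2 * (q * q ^ i)) * real k ^ 4 \<le> (2 * (q * (3/4) ^ i)) * real k ^ 4"
          using q by (intro mult_right_mono mult_left_mono power_mono) auto
        also have "\<dots> = 2 * (4/3) * q * (real k ^ 4 * (3/4) ^ k)" using Suc by simp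
        finally show ?thesis .
      qed simp
    qed
    also have "\<dots> = 2 * (4/3) * q * B" unfolding B_def by (intro suminf_mult sB)
    finally show ?thesis by (simp add: mult_ac)
  qed
  moreover have "2 * (4/3) * B \<ge> 0" using B0 by simp
  ultimately show ?thesis by blast
qed

section \<open>The generating function and its saddle point\<close>

definition primes_le :: "real \<Rightarrow> nat set" where
  "primes_le y = {p. prime p \<and> real p \<le> y}"

lemma finite_primes_le: "finite (primes_le y)"
proof (rule finite_subset)
  show "primes_le y \<subseteq> {..nat \<lfloor>y\<rfloor>}"
    unfolding primes_le_def by (auto simp: le_nat_floor)
qed simp

lemma primes_le_prime: "p \<in> primes_le y \<Longrightarrow> prime p"
  by (simp add: primes_le_def)

text \<open>The hypothesis on \<open>y\<close> admits \<open>n = 1\<close>, whose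
  \<open>largest_prime_factor\<close> is 1 by convention.\<close>

lemma smooth_nats_largest_prime_factor:
  assumes "y \<ge> 1"
  shows "{n. 1 \<le> n \<and> real (largest_prime_factor n) \<le> y} = smooth_nats (primes_le y)"
proof -
  have "real (largest_prime_factor n) \<le> y \<longleftrightarrow> prime_factors n \<subseteq> primes_le y" if "n > 0" for n
  proof (cases "prime_factors n = {}")
    case True thus ?thesis using assms by (simp add: largest_prime_factor_def)
  next
    case False
    have "real (Max (prime_factors n)) \<le> y \<longleftrightarrow> (\<forall>p\<in>prime_factors n. real p \<le> y)"
    proof
      assume "real (Max (prime_factors n)) \<le> y"
      thus "\<forall>p\<in>prime_factors n. real p \<le> y" by (meson Max_ge finite_set_mset of_nat_le_iff order_trans)
    next
      assume "\<forall>p\<in>prime_factors n. real p \<le> y"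
      thus "real (Max (prime_factors n)) \<le> y" using False by (meson Max_in finite_set_mset)
    qed
    thus ?thesis using False by (auto simp: largest_prime_factor_def primes_le_def in_prime_factors_iff)
  qed
  thus ?thesis by (auto simp: smooth_nats_def Suc_le_eq)
qed

lemma prime_powr_bounds:
  assumes "prime p" "s > 0"
  shows "0 < real p powr (- s)" "real p powr (- s) < 1"
proof -
  have p: "real p > 1" using prime_gt_1_nat[OF assms(1)] by simp
  thus "0 < real p powr (- s)" by simp
  have "real p powr (- s) < real p powr 0" using p assms by (intro powr_less_mono) auto
  thus "real p powr (- s) < 1" using p by simp
qed

lemma chi4_mult_lt:
  assumes "0 < q" "q < 1"
  shows "1 - chi4 p * q > 0"
proof -
  have "chi4 p * q \<le> 1 * q" using chi4_abs_le[of p] assms by (intro mult_right_mono) auto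
  thus ?thesis using assms by linarith
qed

lemma H_G_euler:
  assumes y: "y \<ge> 1" and s: "s > 0"
  shows "((\<lambda>n. (real (r2 n) / 4) * real n powr (- s)) has_sum H_G s y) (smooth_nats (primes_le y))"
    and "H_G s y = (\<Prod>p\<in>primes_le y. 1 / ((1 - real p powr (- s)) * (1 - chi4 p * real p powr (- s))))"
proof -
  let ?w = "\<lambda>n. complex_of_real (real n powr (- s))"
  let ?Q = "\<Prod>p\<in>primes_le y. 1 / ((1 - real p powr (- s)) * (1 - chi4 p * real p powr (- s)))"
  have "((\<lambda>n. complex_of_real (real (r2 n) / 4) * ?w n) has_sum (\<Prod>p\<in>primes_le y. 1 / ((1 - ?w p) * (1 - chi4 p * ?w p)))) (smooth_nats (primes_le y))"
  proof (rule conjunct2[OF euler_product[OF finite_primes_le primes_le_prime]])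
    fix p assume "p \<in> primes_le y"
    thus "norm (?w p) < 1" using prime_powr_bounds[OF primes_le_prime s, of p y] by simp
  qed (auto simp: powr_mult)
  hence "((\<lambda>n. complex_of_real ((real (r2 n) / 4) * real n powr (- s))) has_sum complex_of_real ?Q) (smooth_nats (primes_le y))"
    by simp
  hence 1: "((\<lambda>n. (real (r2 n) / 4) * real n powr (- s)) has_sum ?Q) (smooth_nats (primes_le y))"
    by (simp only: has_sum_of_real_iff)
  have "H_G s y = ?Q"
    unfolding H_G_def smooth_nats_largest_prime_factor[OF y] using infsumI[OF 1] by (simp add: powr_minus_divide)
  thus "H_G s y = ?Q" and "((\<lambda>n. (real (r2 n) / 4) * real n powr (- s)) has_sum H_G s y) (smooth_nats (primes_le y))"
    using 1 by auto
qed

lemma H_G_pos: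
  assumes "y \<ge> 1" "s > 0"
  shows "H_G s y > 0"
  unfolding H_G_euler(2)[OF assms]
proof (rule prod_pos)
  fix p assume "p \<in> primes_le y"
  note q = prime_powr_bounds[OF primes_le_prime[OF this] assms(2)]
  show "0 < 1 / ((1 - real p powr (- s)) * (1 - chi4 p * real p powr (- s)))"
    using q(2) chi4_mult_lt[OF q] by simp
qed

lemma phi_G_eq:
  assumes "y \<ge> 1" "s > 0"
  shows "phi_G s y = (\<Sum>p\<in>primes_le y. - ln (1 - real p powr (- s)) - ln (1 - chi4 p * real p powr (- s)))"
  unfolding phi_G_def H_G_euler(2)[OF assms]
proof (subst ln_prod)
  show "(\<Sum>p\<in>primes_le y. ln (1 / ((1 - real p powr (- s)) * (1 - chi4 p * real p powr (- s))))) =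
     (\<Sum>p\<in>primes_le y. - ln (1 - real p powr (- s)) - ln (1 - chi4 p * real p powr (- s)))"
  proof (rule sum.cong[OF refl])
    fix p assume "p \<in> primes_le y"
    note q = prime_powr_bounds[OF primes_le_prime[OF \<open>p \<in> primes_le y\<close>] assms(2)]
    have b: "1 - real p powr (- s) > 0" "1 - chi4 p * real p powr (- s) > 0"
      using q(2) chi4_mult_lt[OF q] by simp_all
    thus "ln (1 / ((1 - real p powr (- s)) * (1 - chi4 p * real p powr (- s)))) = - ln (1 - real p powr (- s)) - ln (1 - chi4 p * real p powr (- s))"
      by (simp add: ln_div ln_mult)
  qed
  fix p assume "p \<in> primes_le y"
  note b = prime_powr_bounds[OF primes_le_prime[OF this] assms(2)]
  have "1 - real p powr (- s) \<noteq> 0" "1 - chi4 p * real p powr (- s) \<noteq> 0"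
    using b(2) chi4_mult_lt[OF b, of p] by linarith+
  thus "1 / ((1 - real p powr (- s)) * (1 - chi4 p * real p powr (- s))) \<noteq> 0" by simp
qed (rule finite_primes_le)

text \<open>The \<open>j\<close>-th cumulant, \<open>(-1)\<^sup>j \<phi>\<^sub>j(s, G; y)\<close> in the notation of the paper.\<close>

definition kap :: "nat \<Rightarrow> real \<Rightarrow> real \<Rightarrow> real" where
  "kap j s y = (\<Sum>p\<in>primes_le y. levy_moment j (chi4 p) (real p powr (- s)) * ln (real p) ^ j)"

lemma DERIV_divide_one_minus:
  assumes "(f has_real_derivative f') (at s)" "1 - f s \<noteq> 0"
  shows "((\<lambda>t. f t / (1 - f t)) has_real_derivative f' / (1 - f s)\<^sup>2) (at s)"
proof -
  have "((\<lambda>t. f t / (1 - f t)) has_real_derivative (f' * (1 - f s) - f s * (0 - f')) / ((1 - f s) * (1 - f s))) (at s)"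
    by (intro DERIV_divide DERIV_diff DERIV_const assms)
  also have "f' * (1 - f s) - f s * (0 - f') = f'" by (simp add: algebra_simps)
  finally show ?thesis by (simp add: power2_eq_square)
qed

text \<open>The closed forms of \<open>levy_moment_1_2\<close> reduce the differentiation to finite
  sums of elementary functions of \<open>p powr (-t)\<close>.\<close>

lemma phi_G_has_derivative:
  assumes "y \<ge> 1" "s > 0"
  shows "((\<lambda>t. phi_G t y) has_real_derivative (- kap 1 s y)) (at s)"
    and "((\<lambda>t. kap 1 t y) has_real_derivative (- kap 2 s y)) (at s)"
proof -
  have ev: "eventually (\<lambda>t. t \<in> {0<..}) (nhds s)" using assms by (intro eventually_nhds_in_open) auto
  let ?q = "\<lambda>p t. real p powr (- t)"
  have dq: "((\<lambda>t. ?q p t) has_real_derivative (- ln (real p) * ?q p s)) (at s)" if "p \<in> primes_le y" for p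
    using prime_gt_0_nat[OF primes_le_prime[OF that]] by (auto intro!: derivative_eq_intros)
  have b: "1 - ?q p s > 0" "1 - chi4 p * ?q p s > 0" "?q p s > 0" "?q p s < 1" if "p \<in> primes_le y" for p
  proof -
    note q = prime_powr_bounds[OF primes_le_prime[OF that] assms(2)]
    show "1 - ?q p s > 0" "1 - chi4 p * ?q p s > 0" "?q p s > 0" "?q p s < 1" using q chi4_mult_lt[OF q] by simp_all
  qed
  have "((\<lambda>t. \<Sum>p\<in>primes_le y. - ln (1 - ?q p t) - ln (1 - chi4 p * ?q p t)) has_real_derivative
      (\<Sum>p\<in>primes_le y. - (levy_moment 1 (chi4 p) (?q p s) * ln (real p) ^ 1))) (at s)"
  proof (rule DERIV_sum)
    fix p assume p: "p \<in> primes_le y"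
    show "((\<lambda>t. - ln (1 - ?q p t) - ln (1 - chi4 p * ?q p t)) has_real_derivative
        - (levy_moment 1 (chi4 p) (?q p s) * ln (real p) ^ 1)) (at s)"
    proof -
      define c l r where "c = chi4 p" and "l = ln (real p)" and "r = ?q p s"
      have pos: "1 - r > 0" "1 - c * r > 0" using b[OF p] by (auto simp: c_def r_def)
      have "((\<lambda>t. - ln (1 - ?q p t) - ln (1 - c * ?q p t)) has_real_derivative
          - (1 / (1 - r) * (0 - (- l * r))) - 1 / (1 - c * r) * (0 - c * (- l * r))) (at s)"
        unfolding r_def l_def using pos[unfolded r_def]
        by (intro DERIV_diff DERIV_minus DERIV_chain2[OF DERIV_ln_divide] DERIV_const DERIV_cmult dq[OF p])
      also have "- (1 / (1 - r) * (0 - (- l * r))) - 1 / (1 - c * r) * (0 - c * (- l * r)) = - ((r / (1 - r) + c * r / (1 - c * r)) * l ^ 1)"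
        by (simp add: algebra_simps)
      finally show ?thesis unfolding levy_moment_1_2(1)[OF chi4_abs_le b(3,4)[OF p]] c_def l_def r_def .
    qed
  qed
  moreover have "eventually (\<lambda>t. phi_G t y = (\<Sum>p\<in>primes_le y. - ln (1 - ?q p t) - ln (1 - chi4 p * ?q p t))) (nhds s)"
    using ev by eventually_elim (use phi_G_eq[OF assms(1)] in auto)
  ultimately show "((\<lambda>t. phi_G t y) has_real_derivative (- kap 1 s y)) (at s)"
    by (subst DERIV_cong_ev[OF refl _ refl]) (auto simp: kap_def sum_negf)
  have "((\<lambda>t. \<Sum>p\<in>primes_le y. (?q p t / (1 - ?q p t) + chi4 p * ?q p t / (1 - chi4 p * ?q p t)) * ln (real p) ^ 1) has_real_derivative
      (\<Sum>p\<in>primes_le y. - (levy_moment 2 (chi4 p) (?q p s) * ln (real p) ^ 2))) (at s)"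
  proof (rule DERIV_sum)
    fix p assume p: "p \<in> primes_le y"
    show "((\<lambda>t. (?q p t / (1 - ?q p t) + chi4 p * ?q p t / (1 - chi4 p * ?q p t)) * ln (real p) ^ 1) has_real_derivative
        - (levy_moment 2 (chi4 p) (?q p s) * ln (real p) ^ 2)) (at s)"
    proof -
      define c l r where "c = chi4 p" and "l = ln (real p)" and "r = ?q p s"
      have nz: "1 - r \<noteq> 0" "1 - c * r \<noteq> 0" using b[OF p] by (auto simp: c_def r_def)
      have "((\<lambda>t. (?q p t / (1 - ?q p t) + c * ?q p t / (1 - c * ?q p t)) * l ^ 1) has_real_derivative
          (- l * r / (1 - r)\<^sup>2 + c * (- l * r) / (1 - c * r)\<^sup>2) * l ^ 1) (at s)"
        unfolding r_def l_def using nz[unfolded r_def]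
        by (intro DERIV_cmult_right DERIV_add DERIV_divide_one_minus DERIV_cmult dq[OF p])
      also have "(- l * r / (1 - r)\<^sup>2 + c * (- l * r) / (1 - c * r)\<^sup>2) * l ^ 1 = - ((r / (1 - r)\<^sup>2 + c * r / (1 - c * r)\<^sup>2) * l ^ 2)"
        by (simp add: power2_eq_square[of l] algebra_simps)
      finally show ?thesis unfolding levy_moment_1_2(2)[OF chi4_abs_le b(3,4)[OF p]] c_def l_def r_def .
    qed
  qed
  moreover have "eventually (\<lambda>t. kap 1 t y = (\<Sum>p\<in>primes_le y. (?q p t / (1 - ?q p t) + chi4 p * ?q p t / (1 - chi4 p * ?q p t)) * ln (real p) ^ 1)) (nhds s)"
    using ev
  proof eventually_elim
    case (elim t)
    thus ?case unfolding kap_def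
      by (intro sum.cong refl arg_cong2[where f = "(*)"] levy_moment_1_2(1) chi4_abs_le prime_powr_bounds) (auto simp: primes_le_prime)
  qed
  ultimately show "((\<lambda>t. kap 1 t y) has_real_derivative (- kap 2 s y)) (at s)"
    by (subst DERIV_cong_ev[OF refl _ refl]) (auto simp: kap_def sum_negf)
qed

lemma phi_G_deriv_eq:
  assumes "y \<ge> 1" "s > 0"
  shows "phi_G_deriv 1 s y = - kap 1 s y" and "phi_G_deriv 2 s y = kap 2 s y"
proof -
  have d1: "deriv (\<lambda>t. phi_G t y) t = - kap 1 t y" if "t > 0" for t
    using phi_G_has_derivative(1)[OF assms(1) that] by (rule DERIV_imp_deriv)
  show "phi_G_deriv 1 s y = - kap 1 s y" using d1[OF assms(2)] by (simp add: phi_G_deriv_def)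
  have ev: "eventually (\<lambda>t. deriv (\<lambda>t. phi_G t y) t = - kap 1 t y) (nhds s)"
  proof -
    have "eventually (\<lambda>t. t \<in> {0<..}) (nhds s)" using assms by (intro eventually_nhds_in_open) auto
    thus ?thesis by eventually_elim (use d1 in auto)
  qed
  have "((\<lambda>t. - kap 1 t y) has_real_derivative kap 2 s y) (at s)"
    using DERIV_minus[OF phi_G_has_derivative(2)[OF assms]] by simp
  hence "(deriv (\<lambda>t. phi_G t y) has_real_derivative kap 2 s y) (at s)"
    using ev by (subst DERIV_cong_ev[OF refl _ refl]) auto
  hence "deriv (deriv (\<lambda>t. phi_G t y)) s = kap 2 s y" by (rule DERIV_imp_deriv)
  thus "phi_G_deriv 2 s y = kap 2 s y" by (simp add: phi_G_deriv_def numeral_2_eq_2)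
qed

text \<open>For primes that are 3 modulo 4 the lower bound used is just 0; strict positivity comes
  from the prime 2, where \<open>chi4\<close> vanishes.\<close>

lemma kap_2_pos:
  assumes "y \<ge> 2" "s > 0"
  shows "kap 2 s y > 0"
proof -
  have 2: "2 \<in> primes_le y" using assms by (simp add: primes_le_def)
  have nn: "0 \<le> levy_moment 2 (chi4 p) (real p powr (- s)) * ln (real p) ^ 2" if "p \<in> primes_le y" for p
    using levy_moment_lower[OF chi4_abs_le prime_powr_bounds[OF primes_le_prime[OF that] assms(2)], of p 2]
      chi4_coeff_bounds(1)[of p 1] by (intro mult_nonneg_nonneg) (auto intro: order_trans[rotated] mult_nonneg_nonneg)
  have "(1 + chi4 2) * 2 powr (- s) \<le> levy_moment 2 (chi4 2) (2 powr (- s))"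
    using levy_moment_lower[OF chi4_abs_le prime_powr_bounds[OF two_is_prime_nat assms(2)], of 2 2] by simp
  moreover have "chi4 2 = 0" by (simp add: chi4_def)
  ultimately have "levy_moment 2 (chi4 2) (real 2 powr (- s)) > 0" by (simp add: less_le_trans[of 0 "2 powr (- s)"])
  hence "0 < levy_moment 2 (chi4 2) (real 2 powr (- s)) * ln (real 2) ^ 2" by simp
  thus ?thesis unfolding kap_def using 2 nn finite_primes_le by (intro sum_pos2[where i = 2]) auto
qed

lemma kap_1_strict_decreasing:
  assumes "y \<ge> 2" "0 < s" "s < t"
  shows "kap 1 t y < kap 1 s y"
proof (rule DERIV_neg_imp_decreasing[OF assms(3)])
  fix x assume "s \<le> x" "x \<le> t"
  hence "x > 0" using assms by simp
  thus "\<exists>d. ((\<lambda>t. kap 1 t y) has_real_derivative d) (at x) \<and> d < 0"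
    using phi_G_has_derivative(2)[of y x] kap_2_pos[of y x] assms by (intro exI[of _ "- kap 2 x y"]) auto
qed

lemma alpha_G_eqI:
  assumes "y \<ge> 2" "a > 0" "kap 1 a y = ln x"
  shows "alpha_G x y = a"
  unfolding alpha_G_def
proof (rule the_equality)
  show "0 < a \<and> ln x + phi_G_deriv 1 a y = 0" using assms phi_G_deriv_eq(1)[of y a] by simp
  fix b assume b: "0 < b \<and> ln x + phi_G_deriv 1 b y = 0"
  hence "kap 1 b y = kap 1 a y" using assms phi_G_deriv_eq(1)[of y b] by simp
  thus "b = a" using kap_1_strict_decreasing[OF assms(1), of a b] kap_1_strict_decreasing[OF assms(1), of b a] assms b
    by (cases b a rule: linorder_cases) auto
qed

section \<open>The tilted law and its characteristic function\<close>

lemma weighted_nat_distribution: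
  fixes w Z :: "nat \<Rightarrow> real"
  assumes w0: "\<And>n. w n \<ge> 0" and w1: "w sums 1"
  shows "\<exists>M. real_distribution M \<and> (\<forall>t. (\<lambda>n. w n *\<^sub>R iexp (t * Z n)) sums char M t) \<and>
     (\<forall>g \<in> borel_measurable borel. (\<forall>z. \<bar>g z\<bar> \<le> 1) \<longrightarrow> (\<lambda>n. w n * g (Z n)) sums (\<integral>z. (g z :: real) \<partial>M))"
proof -
  define Q where "Q = density (count_space UNIV) (\<lambda>n. ennreal (w n))"
  have "emeasure Q (space Q) = (\<integral>\<^sup>+n. ennreal (w n) \<partial>count_space UNIV)"
    unfolding Q_def by (subst emeasure_density) (auto intro!: nn_integral_cong)
  also have "\<dots> = (\<Sum>n. ennreal (w n))" by (rule nn_integral_count_space_nat)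
  also have "\<dots> = ennreal 1" using w0 w1 by (simp add: suminf_ennreal2 sums_iff)
  finally interpret Q: prob_space Q by (intro prob_spaceI) simp
  have mZ: "Z \<in> borel_measurable Q" by (simp add: Q_def)
  define M where "M = distr Q borel Z"
  have M: "real_distribution M" unfolding M_def using mZ by (rule Q.real_distribution_distr)
  have swsum: "integrable (count_space UNIV) w"
    by (subst integrable_count_space_nat_iff) (use w0 w1 in \<open>auto simp: sums_iff\<close>)
  have key: "(\<lambda>n. w n *\<^sub>R f (Z n)) sums (\<integral>z. f z \<partial>M)"
    if f: "f \<in> borel_measurable borel" "\<And>z. norm (f z) \<le> 1" for f :: "real \<Rightarrow> 'b :: {banach, second_countable_topology}"
  proof -
    have i: "integrable (count_space UNIV) (\<lambda>n. w n *\<^sub>R f (Z n))"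
      by (rule Bochner_Integration.integrable_bound[OF swsum]) (use f w0 in \<open>auto simp: mult_left_le\<close>)
    have "(\<integral>z. f z \<partial>M) = (\<integral>n. f (Z n) \<partial>Q)" unfolding M_def using mZ f by (intro integral_distr) auto
    also have "\<dots> = (\<integral>n. w n *\<^sub>R f (Z n) \<partial>count_space UNIV)" unfolding Q_def
      using w0 by (intro integral_density) auto
    finally show ?thesis using sums_integral_count_space_nat[OF i] by simp
  qed
  show ?thesis
  proof (intro exI[of _ M] conjI allI ballI impI M)
    fix t show "(\<lambda>n. w n *\<^sub>R iexp (t * Z n)) sums char M t"
      unfolding char_def by (rule key) auto
    fix g :: "real \<Rightarrow> real" assume "g \<in> borel_measurable borel" "\<forall>z. \<bar>g z\<bar> \<le> 1"
    thus "(\<lambda>n. w n * g (Z n)) sums (\<integral>z. g z \<partial>M)" using key[of g] by simp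
  qed
qed

text \<open>The Levy-Khinchin exponent of a sum of independent compound Poisson variables, one for
  each prime, with jumps \<open>k * ln p\<close>. The subtracted linear term removes the
  mean.\<close>

definition levy_exponent :: "real \<Rightarrow> real \<Rightarrow> real \<Rightarrow> complex" where
  "levy_exponent a y t = (\<Sum>p\<in>primes_le y. \<Sum>k. levy (chi4 p) (real p powr (- a)) k *\<^sub>R
      (iexp (t * (real k * ln (real p))) - 1 - \<i> * (t * (real k * ln (real p)))))"

text \<open>Up to the compensating phase, the exponential is the quotient of the local Euler factors
  at \<open>a - i t\<close> and at \<open>a\<close>.\<close>

lemma levy_local:
  fixes t :: real
  assumes p: "prime p" and a: "a > 0"
  defines "q \<equiv> real p powr (- a)" and "l \<equiv> ln (real p)" and "c \<equiv> chi4 p"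
  defines "z \<equiv> complex_of_real q * iexp (t * l)"
  shows "summable (\<lambda>k. levy c q k *\<^sub>R (iexp (t * (real k * l)) - 1 - \<i> * (t * (real k * l))))"
    and "exp (\<Sum>k. levy c q k *\<^sub>R (iexp (t * (real k * l)) - 1 - \<i> * (t * (real k * l)))) =
       (1 / ((1 - z) * (1 - c * z))) * complex_of_real ((1 - q) * (1 - c * q)) * iexp (- (t * (levy_moment 1 c q * l)))"
proof -
  note q = prime_powr_bounds[OF p a, folded q_def]
  have c: "\<bar>c\<bar> \<le> 1" unfolding c_def by (rule chi4_abs_le)
  have z: "norm z < 1" using q by (simp add: z_def norm_mult)
  have qn: "norm (complex_of_real q) < 1" using q by simp
  let ?f1 = "\<lambda>k. complex_of_real (1 + c ^ k) * z ^ k / of_nat k"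
  let ?f2 = "\<lambda>k. complex_of_real (1 + c ^ k) * complex_of_real q ^ k / of_nat k"
  let ?f3 = "\<lambda>k. complex_of_real (levy c q k * real k ^ 1) * (\<i> * (t * l))"
  have zp: "z ^ k = complex_of_real (q ^ k) * iexp (t * (real k * l))" for k
    by (simp add: z_def power_mult_distrib mult_ac flip: exp_of_nat_mult)
  have eq: "levy c q k *\<^sub>R (iexp (t * (real k * l)) - 1 - \<i> * (t * (real k * l))) = ?f1 k - ?f2 k - ?f3 k" for k
    unfolding zp levy_def by (simp add: scaleR_conv_of_real algebra_simps add_divide_distrib diff_divide_distrib)
  note s1 = levy_exp[OF c z] and s2 = levy_exp[OF c qn]
  have s3: "?f3 sums (complex_of_real (levy_moment 1 c q) * (\<i> * (t * l)))"
    unfolding levy_moment_def by (intro sums_mult2 sums_of_real summable_sums summable_levy_moment c q)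
  have S: "(\<lambda>k. ?f1 k - ?f2 k - ?f3 k) sums ((\<Sum>k. ?f1 k) - (\<Sum>k. ?f2 k) - complex_of_real (levy_moment 1 c q) * (\<i> * (t * l)))"
    by (intro sums_diff summable_sums s1(1) s2(1) s3)
  show "summable (\<lambda>k. levy c q k *\<^sub>R (iexp (t * (real k * l)) - 1 - \<i> * (t * (real k * l))))"
    unfolding eq by (rule sums_summable[OF S])
  have "exp (\<Sum>k. levy c q k *\<^sub>R (iexp (t * (real k * l)) - 1 - \<i> * (t * (real k * l)))) =
     exp ((\<Sum>k. ?f1 k) + - (\<Sum>k. ?f2 k) + - (complex_of_real (levy_moment 1 c q) * (\<i> * (t * l))))"
    unfolding eq using sums_unique[OF S] by simp
  also have "\<dots> = exp (\<Sum>k. ?f1 k) * exp (- (\<Sum>k. ?f2 k)) * exp (- (complex_of_real (levy_moment 1 c q) * (\<i> * (t * l))))"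
    by (simp only: exp_add)
  also have "exp (\<Sum>k. ?f1 k) = 1 / ((1 - z) * (1 - c * z))" by (rule s1(2))
  also have "exp (- (\<Sum>k. ?f2 k)) = complex_of_real ((1 - q) * (1 - c * q))"
    unfolding exp_minus s2(2) by simp
  also have "exp (- (complex_of_real (levy_moment 1 c q) * (\<i> * (t * l)))) = iexp (- (t * (levy_moment 1 c q * l)))"
    by (simp add: mult_ac)
  finally show "exp (\<Sum>k. levy c q k *\<^sub>R (iexp (t * (real k * l)) - 1 - \<i> * (t * (real k * l)))) =
       (1 / ((1 - z) * (1 - c * z))) * complex_of_real ((1 - q) * (1 - c * q)) * iexp (- (t * (levy_moment 1 c q * l)))" .
qed

lemma tilted_distribution:
  assumes y: "y \<ge> 2" and a: "a > 0" and x: "x > 0" and k1: "kap 1 a y = ln x"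
  shows "\<exists>M. real_distribution M \<and> (\<forall>t. char M t = exp (levy_exponent a y t)) \<and>
     Psi_G x y = 4 * x powr a * H_G a y * (\<integral>z. indicator {..0} z * exp (a * z) \<partial>M)"
proof -
  let ?P = "primes_le y" and ?S = "smooth_nats (primes_le y)"
  have y1: "y \<ge> 1" using y by simp
  define H where "H = H_G a y"
  have H: "H > 0" unfolding H_def by (rule H_G_pos[OF y1 a])
  define w where "w = (\<lambda>n. if n \<in> ?S then (real (r2 n) / 4) * real n powr (- a) / H else 0)"
  define Z where "Z = (\<lambda>n::nat. ln (real n) - ln x)"
  have w0: "w n \<ge> 0" for n using H by (simp add: w_def)
  have "((\<lambda>n. (real (r2 n) / 4) * real n powr (- a) * (1 / H)) has_sum H_G a y * (1 / H)) ?S"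
    by (intro has_sum_cmult_left H_G_euler(1)[OF y1 a])
  hence "((\<lambda>n. (real (r2 n) / 4) * real n powr (- a) / H) has_sum 1) ?S"
    using H by (simp add: H_def)
  moreover have "(w has_sum 1) UNIV \<longleftrightarrow> ((\<lambda>n. (real (r2 n) / 4) * real n powr (- a) / H) has_sum 1) ?S"
    by (rule has_sum_cong_neutral) (auto simp: w_def)
  ultimately have "(w has_sum 1) UNIV" by simp
  hence w1: "w sums 1" by (rule has_sum_imp_sums)
  obtain M where M: "real_distribution M" and ch: "\<And>t. (\<lambda>n. w n *\<^sub>R iexp (t * Z n)) sums char M t"
    and ex: "\<And>g. g \<in> borel_measurable borel \<Longrightarrow> (\<forall>z. \<bar>g z\<bar> \<le> 1) \<Longrightarrow> (\<lambda>n. w n * g (Z n)) sums (\<integral>z. g z \<partial>M)"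
    using weighted_nat_distribution[OF w0 w1, of Z] by blast
  have "char M t = exp (levy_exponent a y t)" for t
  proof -
    define \<omega> where "\<omega> = (\<lambda>n::nat. complex_of_real (real n powr (- a)) * iexp (t * ln (real n)))"
    have "((\<lambda>n. complex_of_real (real (r2 n) / 4) * \<omega> n) has_sum (\<Prod>p\<in>?P. 1 / ((1 - \<omega> p) * (1 - chi4 p * \<omega> p)))) ?S"
    proof (rule conjunct2[OF euler_product[OF finite_primes_le primes_le_prime]])
      show "\<omega> 1 = 1" by (simp add: \<omega>_def)
      show "\<omega> (m * n) = \<omega> m * \<omega> n" if "m > 0" "n > 0" for m n
        using that by (simp add: \<omega>_def powr_mult ln_mult distrib_left exp_add)
      fix p assume "p \<in> ?P"
      thus "norm (\<omega> p) < 1" using prime_powr_bounds[OF primes_le_prime a, of p y] by (simp add: \<omega>_def norm_mult)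
    qed
    hence "((\<lambda>n. (complex_of_real (real (r2 n) / 4) * \<omega> n) * (iexp (- (t * ln x)) / H)) has_sum
       (\<Prod>p\<in>?P. 1 / ((1 - \<omega> p) * (1 - chi4 p * \<omega> p))) * (iexp (- (t * ln x)) / H)) ?S"
      by (rule has_sum_cmult_left)
    moreover have "w n *\<^sub>R iexp (t * Z n) = (complex_of_real (real (r2 n) / 4) * \<omega> n) * (iexp (- (t * ln x)) / H)" if "n \<in> ?S" for n
    proof -
      have e: "iexp (t * Z n) = iexp (t * ln (real n)) * iexp (- (t * ln x))"
        by (simp add: Z_def right_diff_distrib flip: exp_add)
      show ?thesis unfolding e using that by (simp add: w_def \<omega>_def scaleR_conv_of_real)
    qed
    moreover have "w n *\<^sub>R iexp (t * Z n) = 0" if "n \<notin> ?S" for n using that by (simp add: w_def)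
    ultimately have "((\<lambda>n. w n *\<^sub>R iexp (t * Z n)) has_sum (\<Prod>p\<in>?P. 1 / ((1 - \<omega> p) * (1 - chi4 p * \<omega> p))) * (iexp (- (t * ln x)) / H)) UNIV"
      by (subst has_sum_cong_neutral[where T = ?S and g = "\<lambda>n. (complex_of_real (real (r2 n) / 4) * \<omega> n) * (iexp (- (t * ln x)) / H)"]) auto
    hence "(\<lambda>n. w n *\<^sub>R iexp (t * Z n)) sums ((\<Prod>p\<in>?P. 1 / ((1 - \<omega> p) * (1 - chi4 p * \<omega> p))) * (iexp (- (t * ln x)) / H))"
      by (rule has_sum_imp_sums)
    hence c1: "char M t = (\<Prod>p\<in>?P. 1 / ((1 - \<omega> p) * (1 - chi4 p * \<omega> p))) * (iexp (- (t * ln x)) / H)"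
      using ch[of t] sums_unique2 by blast
    let ?q = "\<lambda>p. real p powr (- a)"
    have invH: "complex_of_real (1 / H) = (\<Prod>p\<in>?P. complex_of_real ((1 - ?q p) * (1 - chi4 p * ?q p)))"
      unfolding H_def H_G_euler(2)[OF y1 a] by (simp add: prod_dividef)
    \<comment> \<open>Here the saddle-point equation enters: the compensators add up to
      \<open>t * kap 1 a y\<close>, which is \<open>t * ln x\<close>, the shift in the definition of
      \<open>Z\<close>.\<close>
    have lx: "iexp (- (t * ln x)) = (\<Prod>p\<in>?P. iexp (- (t * (levy_moment 1 (chi4 p) (?q p) * ln (real p)))))"
    proof -
      have "\<i> * complex_of_real (- (t * ln x)) = (\<Sum>p\<in>?P. \<i> * complex_of_real (- (t * (levy_moment 1 (chi4 p) (?q p) * ln (real p)))))"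
        unfolding k1[symmetric] kap_def by (simp add: sum_distrib_left sum_negf)
      thus ?thesis by (simp only:) (rule exp_sum[OF finite_primes_le])
    qed
    have "exp (levy_exponent a y t) = (\<Prod>p\<in>?P. exp (\<Sum>k. levy (chi4 p) (?q p) k *\<^sub>R
      (iexp (t * (real k * ln (real p))) - 1 - \<i> * (t * (real k * ln (real p))))))"
      unfolding levy_exponent_def by (rule exp_sum[OF finite_primes_le])
    also have "\<dots> = (\<Prod>p\<in>?P. (1 / ((1 - \<omega> p) * (1 - chi4 p * \<omega> p))) * complex_of_real ((1 - ?q p) * (1 - chi4 p * ?q p)) *
        iexp (- (t * (levy_moment 1 (chi4 p) (?q p) * ln (real p)))))"
      unfolding \<omega>_def by (intro prod.cong refl levy_local(2) a) (auto simp: primes_le_prime)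
    also have "\<dots> = (\<Prod>p\<in>?P. 1 / ((1 - \<omega> p) * (1 - chi4 p * \<omega> p))) * complex_of_real (1 / H) * iexp (- (t * ln x))"
      unfolding invH lx by (simp only: prod.distrib)
    also have "\<dots> = char M t" unfolding c1 by simp
    finally show ?thesis by simp
  qed
  moreover have "Psi_G x y = 4 * x powr a * H_G a y * (\<integral>z. indicator {..0} z * exp (a * z) \<partial>M)"
  proof -
    define N where "N = {n. 1 \<le> n \<and> real n \<le> x \<and> real (largest_prime_factor n) \<le> y}"
    have N: "N = {n \<in> ?S. real n \<le> x}"
      unfolding smooth_nats_largest_prime_factor[OF y1, symmetric] N_def by auto
    have fN: "finite N"
      by (rule finite_subset[of _ "{..nat \<lfloor>x\<rfloor>}"]) (auto simp: N_def le_nat_floor)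
    let ?g = "\<lambda>z::real. indicator {..0} z * exp (a * z)"
    have g: "\<bar>?g z\<bar> \<le> 1" for z using a by (auto simp: indicator_def mult_nonneg_nonpos)
    have "(\<lambda>n. w n * ?g (Z n)) sums (\<integral>z. ?g z \<partial>M)" by (rule ex) (use g in auto)
    moreover have "(\<lambda>n. w n * ?g (Z n)) sums (\<Sum>n\<in>N. w n * ?g (Z n))"
    proof (rule sums_finite[OF fN])
      fix n assume n: "n \<notin> N"
      show "w n * ?g (Z n) = 0"
      proof (cases "n \<in> ?S")
        case True
        hence "real n > x" "n > 0" using n N by (auto simp: smooth_nats_def)
        hence "Z n > 0" using x by (simp add: Z_def)
        thus ?thesis by simp
      qed (simp add: w_def)
    qed
    ultimately have E: "(\<integral>z. ?g z \<partial>M) = (\<Sum>n\<in>N. w n * ?g (Z n))" using sums_unique2 by blast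
    have "4 * x powr a * H * (\<Sum>n\<in>N. w n * ?g (Z n)) = (\<Sum>n\<in>N. real (r2 n))"
      unfolding sum_distrib_left
    proof (rule sum.cong[OF refl])
      fix n assume n: "n \<in> N"
      hence n': "n \<in> ?S" "n > 0" "real n \<le> x" using N by (auto simp: smooth_nats_def)
      have "Z n \<le> 0" using n' x by (simp add: Z_def)
      \<comment> \<open>The tilt is undone: this factor cancels \<open>n powr (-a)\<close> in the
        weight and leaves \<open>r2 n\<close> up to a constant.\<close>
      hence "?g (Z n) = real n powr a / x powr a"
        using n' x by (simp add: Z_def powr_def right_diff_distrib exp_diff)
      moreover have "real n powr (- a) * real n powr a = 1" using n' by (simp flip: powr_add)
      ultimately show "4 * x powr a * H * (w n * ?g (Z n)) = real (r2 n)"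
        using n' H x by (simp add: w_def)
    qed
    thus ?thesis unfolding E Psi_G_def N_def[symmetric] H_def by simp
  qed
  ultimately show ?thesis using M by blast
qed

section \<open>Estimates at the saddle point\<close>

lemma sum_primes_le_powr:
  assumes y: "y \<ge> 1" and a: "0 \<le> a" "a < 1"
  shows "(\<Sum>p\<in>primes_le y. ln (real p) * real p powr (- a)) \<le> 24 / (1 - a) * y powr (1 - a)"
proof -
  define n where "n = nat \<lfloor>y\<rfloor>"
  have n: "real n \<le> y" using y by (simp add: n_def)
  have "primes_le y = {p. prime p \<and> p \<le> n}"
    unfolding primes_le_def n_def using y by (auto simp: le_nat_floor) (metis le_nat_iff of_int_le_iff of_int_of_nat_eq of_nat_le_iff n n_def order_trans)
  hence "(\<Sum>p\<in>primes_le y. ln (real p) * real p powr (- a)) \<le> 24 / (1 - a) * real n powr (1 - a)"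
    using sum_ln_primes_powr_le[OF a, of n] by simp
  also have "\<dots> \<le> 24 / (1 - a) * y powr (1 - a)" using a n by (intro mult_left_mono powr_mono2) auto
  finally show ?thesis .
qed

text \<open>Naming the constant allows \<open>window\<close> and \<open>mass_const\<close> to be
  defined outside any proof.\<close>

definition mertens_const :: real where
  "mertens_const = (SOME C. C \<ge> 0 \<and> (\<forall>w y. 1 \<le> w \<longrightarrow> w \<le> y \<longrightarrow>
     (\<Sum>p | prime p \<and> w < real p \<and> real p \<le> y. (1 + chi4 p) * ln (real p) / real p) \<ge> ln (y / w) - C))"

lemma mertens_const:
  "mertens_const \<ge> 0"
  "1 \<le> w \<Longrightarrow> w \<le> y \<Longrightarrow> (\<Sum>p | prime p \<and> w < real p \<and> real p \<le> y. (1 + chi4 p) * ln (real p) / real p) \<ge> ln (y / w) - mertens_const"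
proof -
  have "mertens_const \<ge> 0 \<and> (\<forall>w y. 1 \<le> w \<longrightarrow> w \<le> y \<longrightarrow>
     (\<Sum>p | prime p \<and> w < real p \<and> real p \<le> y. (1 + chi4 p) * ln (real p) / real p) \<ge> ln (y / w) - mertens_const)"
    unfolding mertens_const_def by (rule someI_ex[OF mertens_interval_lower])
  thus "mertens_const \<ge> 0" "1 \<le> w \<Longrightarrow> w \<le> y \<Longrightarrow> (\<Sum>p | prime p \<and> w < real p \<and> real p \<le> y. (1 + chi4 p) * ln (real p) / real p) \<ge> ln (y / w) - mertens_const"
    by auto
qed

text \<open>More than twice the constant of Mertens' estimate, so that on a logarithmic interval of
  length \<open>window\<close> or more at least half of the main term survives; the added 2 keeps it
  away from 0.\<close>

definition window :: real where "window = 2 * mertens_const + 2"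

lemma window_ge: "window \<ge> 2" using mertens_const(1) by (simp add: window_def)

text \<open>Used with \<open>v = L * (1 - window / \<xi>)\<close>, where \<open>L = ln y\<close>:
  the range in which \<open>p powr (1 - a)\<close> stays within a factor \<open>exp window\<close>
  of its largest possible value \<open>exp \<xi>\<close>.\<close>

definition top_primes :: "real \<Rightarrow> real \<Rightarrow> nat set" where
  "top_primes v y = {p. prime p \<and> v < ln (real p) \<and> real p \<le> y}"

lemma top_primes_subset: "top_primes v y \<subseteq> primes_le y"
  by (auto simp: top_primes_def primes_le_def)

lemma finite_top_primes: "finite (top_primes v y)"
  using finite_subset[OF top_primes_subset finite_primes_le] .

text \<open>On this range \<open>p powr (-a)\<close> is at least
  \<open>exp (\<xi> - window) / p\<close>, which brings the sum into Mertens' form over a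
  logarithmic length \<open>window * L / \<xi>\<close>. Since \<open>L / \<xi> \<ge> 1\<close>, the
  error constant consumes at most half of that length.\<close>

lemma top_primes_sum_lower:
  fixes y a :: real
  defines "L \<equiv> ln y" and "\<xi> \<equiv> (1 - a) * ln y"
  assumes y: "y > 1" and a: "0 \<le> a" "a < 1" and xi: "\<xi> \<ge> window"
  shows "(\<Sum>p\<in>top_primes (L * (1 - window / \<xi>)) y. (1 + chi4 p) * real p powr (- a) * ln (real p)) \<ge> exp (- window) * (window / 2) * (exp \<xi> / \<xi>) * L"
proof -
  have L: "L > 0" using y by (simp add: L_def)
  have xi0: "\<xi> > 0" using xi window_ge by linarith
  have xiL: "\<xi> \<le> L" using a L by (simp add: \<xi>_def L_def)
  define v where "v = L * (1 - window / \<xi>)"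
  have v: "0 \<le> v" "v \<le> L" using L xi xi0 window_ge by (auto simp: v_def field_simps)
  define w where "w = exp v"
  have w: "1 \<le> w" "w \<le> y" using v y by (auto simp: w_def L_def ln_ge_iff[symmetric])
  have lw: "ln (y / w) = window * (L / \<xi>)" using y xi0 by (simp add: w_def ln_div L_def[symmetric] v_def field_simps)
  have set: "top_primes v y = {p. prime p \<and> w < real p \<and> real p \<le> y}"
  proof -
    have "v < ln (real p) \<longleftrightarrow> w < real p" if "prime p" for p
      using prime_gt_0_nat[OF that] unfolding w_def by (metis exp_less_cancel_iff exp_ln of_nat_0_less_iff)
    thus ?thesis by (auto simp: top_primes_def)
  qed
  have r: "L / \<xi> \<ge> 1" using xiL xi0 by simp
  have "mertens_const \<le> window / 2 * 1" by (simp add: window_def)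
  also have "\<dots> \<le> window / 2 * (L / \<xi>)" using r window_ge by (intro mult_left_mono) auto
  finally have m: "mertens_const \<le> window / 2 * (L / \<xi>)" .
  have "exp (\<xi> - window) * (window / 2 * (L / \<xi>)) \<le> exp (\<xi> - window) * (ln (y / w) - mertens_const)"
  proof (rule mult_left_mono)
    have gen: "x \<le> z - m" if "z = x + x" "m \<le> x" for x z m :: real using that by simp
    show "window / 2 * (L / \<xi>) \<le> ln (y / w) - mertens_const" unfolding lw by (rule gen[OF _ m]) simp
  qed simp
  also have "\<dots> \<le> exp (\<xi> - window) * (\<Sum>p\<in>top_primes v y. (1 + chi4 p) * ln (real p) / real p)"
    unfolding set using mertens_const(2)[OF w] by (intro mult_left_mono) auto
  also have "\<dots> \<le> (\<Sum>p\<in>top_primes v y. (1 + chi4 p) * real p powr (- a) * ln (real p))"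
    unfolding sum_distrib_left
  proof (rule sum_mono)
    fix p assume p: "p \<in> top_primes v y"
    hence pp: "prime p" "w < real p" using set by auto
    have p0: "real p > 0" using prime_gt_0_nat[OF pp(1)] by simp
    have "exp (\<xi> - window) = w powr (1 - a)"
      using xi0 L by (simp add: w_def powr_def v_def \<xi>_def L_def[symmetric] field_simps)
    also have "\<dots> \<le> real p powr (1 - a)" using pp w a by (intro powr_mono2) auto
    also have "\<dots> = real p * real p powr (- a)" using p0 by (simp add: powr_diff powr_minus field_simps)
    finally have e: "exp (\<xi> - window) \<le> real p * real p powr (- a)" .
    have nn: "(1 + chi4 p) * ln (real p) / real p \<ge> 0"
      using chi4_coeff_bounds(1)[of p 1] prime_ge_1_nat[OF pp(1)] by simp
    have "exp (\<xi> - window) * ((1 + chi4 p) * ln (real p) / real p) \<le> (real p * real p powr (- a)) * ((1 + chi4 p) * ln (real p) / real p)"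
      by (intro mult_right_mono e nn)
    also have "\<dots> = (1 + chi4 p) * real p powr (- a) * ln (real p)" using p0 by simp
    finally show "exp (\<xi> - window) * ((1 + chi4 p) * ln (real p) / real p) \<le> (1 + chi4 p) * real p powr (- a) * ln (real p)" .
  qed
  finally show ?thesis unfolding v_def by (simp add: exp_diff exp_minus field_simps)
qed

lemma two_powr_half_le: "1/2 \<le> a \<Longrightarrow> prime p \<Longrightarrow> real p powr (- a) \<le> 3/4"
proof -
  assume a: "1/2 \<le> a" and p: "prime p"
  have "real p powr (- a) \<le> 2 powr (- a)" using prime_ge_2_nat[OF p] a by (intro powr_mono2') auto
  also have "\<dots> \<le> 2 powr (- (1/2))" using a by (intro powr_mono) auto
  also have "\<dots> = 1 / sqrt 2" by (simp add: powr_minus powr_half_sqrt field_simps)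
  also note inverse_sqrt_two_le
  finally show ?thesis .
qed

definition levy_const :: real where
  "levy_const = (SOME C. C \<ge> 0 \<and> (\<forall>c q j. \<bar>c\<bar> \<le> 1 \<longrightarrow> 0 < q \<longrightarrow> q \<le> 3/4 \<longrightarrow> j \<le> 4 \<longrightarrow> levy_moment j c q \<le> C * q)) + 1"

lemma levy_const: "levy_const \<ge> 1"
  "\<bar>c\<bar> \<le> 1 \<Longrightarrow> 0 < q \<Longrightarrow> q \<le> 3/4 \<Longrightarrow> j \<le> 4 \<Longrightarrow> levy_moment j c q \<le> levy_const * q"
proof -
  have *: "levy_const - 1 \<ge> 0 \<and> (\<forall>c q j. \<bar>c\<bar> \<le> 1 \<longrightarrow> 0 < q \<longrightarrow> q \<le> 3/4 \<longrightarrow> j \<le> 4 \<longrightarrow> levy_moment j c q \<le> (levy_const - 1) * q)"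
    unfolding levy_const_def add_diff_cancel_right' by (rule someI_ex[OF levy_moment_upper])
  show "levy_const \<ge> 1" using * by simp
  assume h: "\<bar>c\<bar> \<le> 1" "0 < q" "q \<le> 3/4" "j \<le> 4"
  have "levy_moment j c q \<le> (levy_const - 1) * q" using * h by blast
  also have "\<dots> \<le> levy_const * q" using h by (intro mult_right_mono) auto
  finally show "levy_moment j c q \<le> levy_const * q" .
qed

text \<open>One logarithm goes into Chebyshev's bound, the remaining \<open>j - 1\<close> are
  bounded by \<open>ln y\<close>. The shape of the result comes from
  \<open>y powr (1 - a) / (1 - a) = ln y * exp \<xi> / \<xi>\<close> with
  \<open>\<xi> = (1 - a) * ln y\<close>.\<close>

lemma kap_upper:
  assumes y: "y > 1" and a: "1/2 \<le> a" "a < 1" and j: "1 \<le> j" "j \<le> 4"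
  shows "kap j a y \<le> 24 * levy_const * (exp ((1 - a) * ln y) / ((1 - a) * ln y)) * ln y ^ j"
proof -
  have L: "ln y > 0" using y by simp
  have "kap j a y \<le> (\<Sum>p\<in>primes_le y. levy_const * ln y ^ (j - 1) * (ln (real p) * real p powr (- a)))"
    unfolding kap_def
  proof (rule sum_mono)
    fix p assume p: "p \<in> primes_le y"
    hence pp: "prime p" "real p \<le> y" by (auto simp: primes_le_def)
    have l0: "0 \<le> ln (real p)" "ln (real p) \<le> ln y" using prime_ge_1_nat[OF pp(1)] pp(2) y by auto
    have q: "0 < real p powr (- a)" "real p powr (- a) \<le> 3/4" using prime_gt_0_nat[OF pp(1)] two_powr_half_le[OF a(1) pp(1)] by auto
    have "levy_moment j (chi4 p) (real p powr (- a)) * ln (real p) ^ j \<le> (levy_const * real p powr (- a)) * (ln (real p) * ln y ^ (j - 1))"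
    proof (rule mult_mono)
      show "levy_moment j (chi4 p) (real p powr (- a)) \<le> levy_const * real p powr (- a)" using levy_const(2)[OF chi4_abs_le q j(2)] .
      have "ln (real p) ^ j = ln (real p) * ln (real p) ^ (j - 1)" using j by (simp flip: power_Suc)
      also have "\<dots> \<le> ln (real p) * ln y ^ (j - 1)" using l0 by (intro mult_left_mono power_mono) auto
      finally show "ln (real p) ^ j \<le> ln (real p) * ln y ^ (j - 1)" .
    qed (use l0 levy_const(1) in auto)
    thus "levy_moment j (chi4 p) (real p powr (- a)) * ln (real p) ^ j \<le> levy_const * ln y ^ (j - 1) * (ln (real p) * real p powr (- a))"
      by (simp add: mult_ac)
  qed
  also have "\<dots> = levy_const * ln y ^ (j - 1) * (\<Sum>p\<in>primes_le y. ln (real p) * real p powr (- a))"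
    by (simp add: sum_distrib_left)
  also have "\<dots> \<le> levy_const * ln y ^ (j - 1) * (24 / (1 - a) * y powr (1 - a))"
    using y a L levy_const(1) by (intro mult_left_mono sum_primes_le_powr) auto
  also have "\<dots> = 24 * levy_const * (exp ((1 - a) * ln y) / ((1 - a) * ln y)) * ln y ^ j"
  proof -
    have "ln y ^ j = ln y * ln y ^ (j - 1)" using j by (simp flip: power_Suc)
    thus ?thesis using L a y by (simp add: powr_def)
  qed
  finally show ?thesis .
qed

text \<open>Matches \<open>kap_upper\<close> up to constants. The condition
  \<open>\<xi> \<ge> 2 * window\<close> places the top primes above \<open>ln p = L / 2\<close>, so
  the extra logarithms cost only a power of 2.\<close>

lemma kap_lower:
  fixes y a :: real
  defines "L \<equiv> ln y" and "\<xi> \<equiv> (1 - a) * ln y"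
  assumes y: "y > 1" and a: "0 < a" "a < 1" and xi: "\<xi> \<ge> 2 * window" and j: "j \<ge> 1"
  shows "kap j a y \<ge> exp (- window) * (window / 2) * (exp \<xi> / \<xi>) * L * (L / 2) ^ (j - 1)"
proof -
  define v where "v = L * (1 - window / \<xi>)"
  have L: "L > 0" using y by (simp add: L_def)
  have xi0: "\<xi> > 0" "\<xi> \<ge> window" using xi window_ge by linarith+
  have v: "v \<ge> L / 2"
  proof -
    have "window / \<xi> \<le> 1/2" using xi xi0 by (simp add: field_simps)
    hence "L * (1/2) \<le> L * (1 - window / \<xi>)" using L by (intro mult_left_mono) auto
    thus ?thesis by (simp add: v_def)
  qed
  have nn: "0 \<le> (1 + chi4 p) * real p powr (- a) * ln (real p)" if "prime p" for p
    using chi4_coeff_bounds(1)[of p 1] prime_ge_1_nat[OF that] by simp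
  have lm: "levy_moment j (chi4 p) (real p powr (- a)) \<ge> (1 + chi4 p) * real p powr (- a)" if "prime p" for p
    by (rule levy_moment_lower[OF chi4_abs_le prime_powr_bounds[OF that a(1)]])
  have c0: "0 \<le> (1 + chi4 p) * real p powr (- a)" for p using chi4_coeff_bounds(1)[of p 1] by simp
  have "(exp (- window) * (window / 2) * (exp \<xi> / \<xi>) * L) * (L / 2) ^ (j - 1) \<le>
     (\<Sum>p\<in>top_primes v y. (1 + chi4 p) * real p powr (- a) * ln (real p)) * (L / 2) ^ (j - 1)"
    using top_primes_sum_lower[of y a] y a xi0 L unfolding v_def L_def \<xi>_def by (intro mult_right_mono) auto
  also have "\<dots> \<le> (\<Sum>p\<in>top_primes v y. levy_moment j (chi4 p) (real p powr (- a)) * ln (real p) ^ j)"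
    unfolding sum_distrib_right
  proof (rule sum_mono)
    fix p assume p: "p \<in> top_primes v y"
    hence pp: "prime p" "ln (real p) \<ge> L / 2" using v by (auto simp: top_primes_def)
    have l0: "ln (real p) \<ge> 0" using pp L by simp
    have "(1 + chi4 p) * real p powr (- a) * ln (real p) * (L / 2) ^ (j - 1) \<le>
        (1 + chi4 p) * real p powr (- a) * ln (real p) * ln (real p) ^ (j - 1)"
      using pp L nn by (intro mult_left_mono power_mono) auto
    also have "\<dots> = (1 + chi4 p) * real p powr (- a) * ln (real p) ^ j" using j by (simp add: mult.assoc flip: power_Suc)
    also have "\<dots> \<le> levy_moment j (chi4 p) (real p powr (- a)) * ln (real p) ^ j"
      using l0 pp by (intro mult_right_mono lm) auto
    finally show "(1 + chi4 p) * real p powr (- a) * ln (real p) * (L / 2) ^ (j - 1) \<le> levy_moment j (chi4 p) (real p powr (- a)) * ln (real p) ^ j" .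
  qed
  also have "\<dots> \<le> kap j a y"
    unfolding kap_def
  proof (rule sum_mono2[OF finite_primes_le top_primes_subset])
    fix p assume "p \<in> primes_le y - top_primes v y"
    hence p: "prime p" by (auto simp: primes_le_def)
    show "0 \<le> levy_moment j (chi4 p) (real p powr (- a)) * ln (real p) ^ j"
      using order_trans[OF c0 lm[OF p]] prime_ge_1_nat[OF p] by simp
  qed
  finally show ?thesis .
qed

section \<open>Decay of the characteristic function away from 0\<close>

text \<open>After reduction to the nearest multiple of \<open>2 * pi\<close> the angle lies between
  \<open>\<rho>\<close> and \<open>pi\<close> in absolute value, where the cosine is at most
  \<open>cos \<rho> \<le> 1 - \<rho>^2 / 2 + \<rho>^3 / 6\<close>.\<close>

lemma one_minus_cos_lower:
  fixes \<theta> \<rho> :: real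
  assumes r: "0 < \<rho>" "\<rho> \<le> 1" and far: "\<And>j::int. \<bar>\<theta> - 2 * pi * j\<bar> \<ge> \<rho>"
  shows "1 - cos \<theta> \<ge> \<rho>\<^sup>2 / 4"
proof -
  define j where "j = round (\<theta> / (2 * pi))"
  define \<phi> where "\<phi> = \<theta> - 2 * pi * j"
  have "\<bar>\<theta> / (2 * pi) - j\<bar> \<le> 1/2" unfolding j_def by (metis abs_minus_commute of_int_round_abs_le)
  hence "\<bar>\<theta> / (2 * pi) - j\<bar> * (2 * pi) \<le> 1/2 * (2 * pi)" by (intro mult_right_mono) auto
  also have "\<bar>\<theta> / (2 * pi) - j\<bar> * (2 * pi) = \<bar>(\<theta> / (2 * pi) - j) * (2 * pi)\<bar>" by (simp add: abs_mult)
  also have "(\<theta> / (2 * pi) - j) * (2 * pi) = \<phi>" by (simp add: \<phi>_def left_diff_distrib)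
  finally have phi: "\<bar>\<phi>\<bar> \<le> pi" by simp
  have "cos \<theta> = cos (\<phi> + 2 * pi * j)" by (simp add: \<phi>_def)
  also have "\<dots> = cos \<phi>" by (simp only: cos_add cos_int_2pin sin_int_2pin mult_1_right mult_zero_right diff_zero)
  also have "\<dots> = cos \<bar>\<phi>\<bar>" by simp
  also have "\<dots> \<le> cos \<rho>" using r phi far[of j] by (intro cos_monotone_0_pi_le) (auto simp: \<phi>_def)
  also have "\<dots> \<le> 1 - \<rho>\<^sup>2 / 4"
  proof -
    have "cmod (iexp \<rho> - (\<Sum>k \<le> 2. (\<i> * \<rho>)^k / fact k)) \<le> \<bar>\<rho>\<bar>^(Suc 2) / fact (Suc 2)" by (rule iexp_approx1)
    moreover have "(\<Sum>k \<le> 2. (\<i> * \<rho>)^k / fact k) = 1 + \<i> * \<rho> - \<rho>\<^sup>2 / 2"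
    proof -
      have "{..2::nat} = {0, 1, 2}" by auto
      thus ?thesis by (simp add: power_mult_distrib)
    qed
    ultimately have "cmod (iexp \<rho> - (1 + \<i> * \<rho> - \<rho>\<^sup>2 / 2)) \<le> \<rho> ^ 3 / 6"
      using r by (simp add: numeral_3_eq_3 numeral_2_eq_2 fact_numeral)
    moreover have "Re (iexp \<rho> - (1 + \<i> * \<rho> - \<rho>\<^sup>2 / 2)) = cos \<rho> - (1 - \<rho>\<^sup>2 / 2)"
      by (simp add: Re_exp power2_eq_square)
    ultimately have "cos \<rho> - (1 - \<rho>\<^sup>2 / 2) \<le> \<rho> ^ 3 / 6"
      using complex_Re_le_cmod[of "iexp \<rho> - (1 + \<i> * \<rho> - \<rho>\<^sup>2 / 2)"] by linarith
    moreover have "\<rho> ^ 3 \<le> \<rho>\<^sup>2" using r by (intro power_decreasing) auto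
    ultimately show ?thesis using zero_le_power2[of \<rho>] by linarith
  qed
  finally show ?thesis by simp
qed

text \<open>\<open>sum_ln_primes_interval_le\<close> on the scale of \<open>ln p\<close>. The
  condition \<open>h * exp v \<ge> 1\<close> makes the interval at least about one unit long, so
  that rounding to integers costs a constant factor; \<open>h \<le> 1/4\<close> makes it shorter
  than its left end, as the binomial argument demands.\<close>

lemma short_interval_primes:
  fixes v h a :: real
  assumes v: "v > 0" and l: "0 < h" "h \<le> 1/4" "h * exp v \<ge> 1" and a: "0 \<le> a"
  shows "(\<Sum>p | prime p \<and> v < ln (real p) \<and> ln (real p) \<le> v + h. real p powr (- a)) \<le> 3 * h * exp ((1 - a) * v) * (1 + ln (1 + 1 / h)) / v"
proof -
  let ?J = "{p. prime p \<and> v < ln (real p) \<and> ln (real p) \<le> v + h}"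
  define e where "e = exp v"
  have e4: "e \<ge> 4"
  proof -
    have "h * e \<le> 1/4 * e" using l by (intro mult_right_mono) (auto simp: e_def)
    thus ?thesis using l(3) unfolding e_def[symmetric] by linarith
  qed
  define N where "N = nat \<lfloor>e\<rfloor>"
  \<comment> \<open>By \<open>exp h \<le> 1 + 2 * h\<close> the interval has length at most
    \<open>2 * h * e\<close>; rounding up adds at most another \<open>h * e\<close>.\<close>
  define K where "K = nat \<lceil>2 * h * e\<rceil>"
  have N: "real N \<le> e" "e < real N + 1"
  proof -
    have "real N = of_int \<lfloor>e\<rfloor>" using e4 by (simp add: N_def)
    thus "real N \<le> e" "e < real N + 1" by linarith+
  qed
  have le: "2 * h * e > 0" using l e4 by simp
  have K: "2 * h * e \<le> real K" "real K < 2 * h * e + 1"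
  proof -
    have "real K = of_int \<lceil>2 * h * e\<rceil>" using le by (simp add: K_def)
    thus "2 * h * e \<le> real K" "real K < 2 * h * e + 1" by linarith+
  qed
  have le1: "h * e \<ge> 1" using l by (simp add: e_def)
  have K3: "real K \<le> 3 * h * e" using K le1 by (simp add: mult.assoc)
  have K1: "K \<ge> 1" using K(1) le by (cases K) auto
  have KN: "K \<le> N"
  proof -
    have "3 * h * e \<le> 3/4 * e" using mult_right_mono[of h "1/4" e] l e4 by simp
    hence "real K < real N + 1" using K3 N e4 by linarith
    thus ?thesis by linarith
  qed
  have sub: "?J \<subseteq> {p. prime p \<and> N < p \<and> p \<le> N + K}"
  proof (intro subsetI CollectI conjI)
    fix p assume p: "p \<in> ?J"
    hence p0: "real p > 0" using prime_gt_0_nat[of p] by auto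
    show "prime p" using p by simp
    have "e < real p" using p p0 unfolding e_def by (metis (mono_tags, lifting) exp_less_cancel_iff exp_ln mem_Collect_eq)
    thus "N < p" using N by linarith
    have "real p = exp (ln (real p))" using p0 by simp
    also have "\<dots> \<le> exp (v + h)" using p by (simp only: exp_le_cancel_iff mem_Collect_eq)
    also have "\<dots> = e * exp h" by (simp add: e_def exp_add)
    also have "\<dots> \<le> e * (1 + 2 * h)"
    proof -
      have "exp h \<le> 1 + h + h\<^sup>2" using l by (intro exp_bound) auto
      also have "h\<^sup>2 \<le> h * 1" unfolding power2_eq_square using l by (intro mult_left_mono) auto
      finally show ?thesis using e4 by (intro mult_left_mono) auto
    qed
    also have "\<dots> \<le> e + real K" using K(1) by (simp add: algebra_simps)
    finally have "real p < real (N + K + 1)" using N by simp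
    thus "p \<le> N + K" by linarith
  qed
  have "(\<Sum>p\<in>?J. ln (real p)) \<le> (\<Sum>p | prime p \<and> N < p \<and> p \<le> N + K. ln (real p))"
    by (intro sum_mono2 sub) (auto dest: prime_ge_1_nat)
  also have "\<dots> \<le> real K * (1 + ln ((real N + real K) / real K))" by (rule sum_ln_primes_interval_le[OF K1 KN])
  also have "\<dots> \<le> (3 * h * e) * (1 + ln (1 + 1 / h))"
  proof (intro mult_mono K3 add_left_mono)
    have k0: "real K > 0" using K1 by simp
    have "(real N + real K) / real K = 1 + real N / real K" using k0 by (simp add: add_divide_distrib)
    also have "real N / real K \<le> e / (h * e)"
      using N K l e4 le1 by (intro frac_le) auto
    also have "e / (h * e) = 1 / h" using e4 by simp
    finally show "ln ((real N + real K) / real K) \<le> ln (1 + 1 / h)"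
      using k0 l by (subst ln_le_cancel_iff) (auto intro!: divide_pos_pos add_nonneg_pos add_pos_pos)
    show "0 \<le> 1 + ln ((real N + real K) / real K)"
      using k0 by (intro add_nonneg_nonneg ln_ge_zero) auto
  qed (use l e4 in auto)
  finally have T: "(\<Sum>p\<in>?J. ln (real p)) \<le> (3 * h * e) * (1 + ln (1 + 1 / h))" .
  have "(\<Sum>p\<in>?J. real p powr (- a)) \<le> (\<Sum>p\<in>?J. exp (- a * v) / v * ln (real p))"
  proof (rule sum_mono)
    fix p assume p: "p \<in> ?J"
    hence p0: "real p > 0" using prime_gt_0_nat[of p] by auto
    have "real p powr (- a) = exp (- a * ln (real p))" using p0 by (simp add: powr_def)
    also have "\<dots> \<le> exp (- a * v)" using p a by (simp add: mult_left_mono)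
    also have "\<dots> \<le> exp (- a * v) * (ln (real p) / v)"
    proof -
      have "1 \<le> ln (real p) / v" using p v by simp
      hence "exp (- a * v) * 1 \<le> exp (- a * v) * (ln (real p) / v)" by (rule mult_left_mono) simp
      thus ?thesis by simp
    qed
    finally show "real p powr (- a) \<le> exp (- a * v) / v * ln (real p)" by simp
  qed
  also have "\<dots> = exp (- a * v) / v * (\<Sum>p\<in>?J. ln (real p))" by (simp add: sum_distrib_left)
  also have "\<dots> \<le> exp (- a * v) / v * ((3 * h * e) * (1 + ln (1 + 1 / h)))" using v by (intro mult_left_mono T) auto
  also have "\<dots> = 3 * h * (exp (- a * v) * e) * (1 + ln (1 + 1 / h)) / v" by simp
  also have "exp (- a * v) * e = exp ((1 - a) * v)" by (simp add: e_def left_diff_distrib flip: exp_add)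
  finally show ?thesis .
qed

text \<open>The truncation at \<open>y\<close> makes the bound uniform in the left end. An interval
  longer than 1/4 is covered by at most \<open>8 * h\<close> intervals of length 1/4, each
  contributing a factor 9/4; hence the 18.\<close>

lemma interval_primes:
  fixes v v0 h a y :: real
  assumes y: "y > 1" and v: "v0 > 0" "v \<ge> v0" "exp v0 \<ge> 4" and l: "0 < h" "h * exp v0 \<ge> 1" and a: "0 \<le> a" "a \<le> 1"
  shows "(\<Sum>p | prime p \<and> v < ln (real p) \<and> ln (real p) \<le> v + h \<and> real p \<le> y. real p powr (- a)) \<le>
     18 * h * exp ((1 - a) * ln y) * (1 + ln (1 + 1 / h)) / v0"
proof -
  let ?X = "exp ((1 - a) * ln y)"
  let ?M = "\<lambda>v h. \<Sum>p | prime p \<and> v < ln (real p) \<and> ln (real p) \<le> v + h \<and> real p \<le> y. real p powr (- a)"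
  have fin1: "finite {p. prime p \<and> ln (real p) \<le> b}" for b
  proof (rule finite_subset[OF _ finite_primes_le[of "exp b"]], safe)
    fix p assume "prime p" "ln (real p) \<le> b"
    thus "p \<in> primes_le (exp b)" using prime_gt_0_nat[of p] unfolding primes_le_def
      by (metis (mono_tags, lifting) exp_le_cancel_iff exp_ln mem_Collect_eq of_nat_0_less_iff)
  qed
  have short: "?M v h \<le> 3 * h * ?X * (1 + ln (1 + 1 / h)) / v0"
    if v': "v \<ge> v0" and l': "0 < h" "h \<le> 1/4" "h * exp v0 \<ge> 1" for v h
  proof -
    have lnn: "ln (1 + 1 / h) \<ge> 0" using l' by (intro ln_ge_zero) auto
    show ?thesis
    proof (cases "v < ln y")
      case True
      have le: "h * exp v \<ge> 1"
      proof -
        have "h * exp v0 \<le> h * exp v" using l' v' by (intro mult_left_mono) auto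
        thus ?thesis using l' by linarith
      qed
      have "?M v h \<le> (\<Sum>p | prime p \<and> v < ln (real p) \<and> ln (real p) \<le> v + h. real p powr (- a))"
        by (rule sum_mono2) (auto intro: finite_subset[OF _ fin1[of "v + h"]])
      also have "\<dots> \<le> 3 * h * exp ((1 - a) * v) * (1 + ln (1 + 1 / h)) / v"
        using v v' l' le a by (intro short_interval_primes) auto
      also have "\<dots> \<le> 3 * h * ?X * (1 + ln (1 + 1 / h)) / v0"
        using True v v' l' a lnn by (intro frac_le mult_mono mult_nonneg_nonneg) (auto simp: mult_left_mono)
      finally show ?thesis .
    next
      case False
      have e: "{p. prime p \<and> v < ln (real p) \<and> ln (real p) \<le> v + h \<and> real p \<le> y} = {}"
      proof (safe, goal_cases)
        case (1 p)
        have "ln (real p) \<le> ln y" using 1 y prime_gt_0_nat[of p] by (subst ln_le_cancel_iff) auto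
        thus ?case using False 1 by simp
      qed
      show ?thesis unfolding e using l' v lnn by (simp add: divide_nonneg_pos)
    qed
  qed
  show ?thesis
  proof (cases "h \<le> 1/4")
    case True
    have "ln (1 + 1 / h) \<ge> 0" using l by (intro ln_ge_zero) auto
    hence "3 * h * ?X * (1 + ln (1 + 1 / h)) / v0 \<le> 18 * h * ?X * (1 + ln (1 + 1 / h)) / v0"
      using l v by (intro divide_right_mono mult_right_mono) auto
    thus ?thesis using short[OF v(2) l(1) True l(2)] by linarith
  next
    case False
    define X where "X = 9/4 * ?X / v0"
    have one: "?M v (1/4) \<le> X" if "v \<ge> v0" for v
    proof -
      have "?M v (1/4) \<le> 3 * (1/4) * ?X * (1 + ln (1 + 1 / (1/4))) / v0"
        using that v(3) by (intro short) auto
      also have "\<dots> \<le> 3 * (1/4) * ?X * (1 + 2) / v0"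
      proof -
        have "ln (5::real) \<le> 2"
        proof -
          have "(5::real) \<le> (1 + 1 + 1\<^sup>2 / 2)\<^sup>2" by (simp add: power2_eq_square)
          also have "\<dots> \<le> (exp 1)\<^sup>2" using exp_lower_Taylor_quadratic[of 1] by (intro power_mono) auto
          also have "\<dots> = exp 2" by (simp add: exp_double[symmetric])
          finally have "ln (5::real) \<le> ln (exp 2)" by (subst ln_le_cancel_iff) auto
          thus ?thesis by simp
        qed
        thus ?thesis using v by (intro divide_right_mono mult_left_mono) auto
      qed
      finally show ?thesis by (simp add: X_def)
    qed
    have many: "?M v (real n / 4) \<le> real n * X" if "v \<ge> v0" for v n
    proof (induction n)
      case 0
      have e: "{p. prime p \<and> v < ln (real p) \<and> ln (real p) \<le> v + real 0 / 4 \<and> real p \<le> y} = {}" by auto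
      show ?case unfolding e by simp
    next
      case (Suc n)
      let ?v = "v + real n / 4"
      have "?M v (real (Suc n) / 4) \<le> (\<Sum>p\<in>{p. prime p \<and> v < ln (real p) \<and> ln (real p) \<le> v + real n / 4 \<and> real p \<le> y} \<union>
           {p. prime p \<and> ?v < ln (real p) \<and> ln (real p) \<le> ?v + 1/4 \<and> real p \<le> y}. real p powr (- a))"
        by (rule sum_mono2) (auto intro: finite_subset[OF _ finite_primes_le[of y]] simp: primes_le_def add_divide_distrib)
      also have "\<dots> \<le> ?M v (real n / 4) + ?M ?v (1/4)"
        by (subst sum.union_disjoint) (auto intro: finite_subset[OF _ finite_primes_le[of y]] simp: primes_le_def)
      also have "\<dots> \<le> real n * X + X" using that by (intro add_mono Suc one) simp
      finally show ?case by (simp add: distrib_right)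
    qed
    define n where "n = nat \<lceil>4 * h\<rceil>"
    have n: "4 * h \<le> real n" "real n \<le> 4 * h + 1"
    proof -
      have "real n = of_int \<lceil>4 * h\<rceil>" using l by (simp add: n_def)
      thus "4 * h \<le> real n" "real n \<le> 4 * h + 1" by linarith+
    qed
    have X0: "X \<ge> 0" using v by (simp add: X_def)
    have "?M v h \<le> ?M v (real n / 4)"
      using n by (intro sum_mono2) (auto intro: finite_subset[OF _ finite_primes_le[of y]] simp: primes_le_def)
    also have "\<dots> \<le> real n * X" by (rule many[OF v(2)])
    also have "\<dots> \<le> (8 * h) * X" using n False X0 by (intro mult_right_mono) auto
    also have "\<dots> = 18 * h * ?X * 1 / v0" by (simp add: X_def)
    also have "\<dots> \<le> 18 * h * ?X * (1 + ln (1 + 1 / h)) / v0"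
      using l v by (intro divide_right_mono mult_left_mono) (auto intro!: ln_ge_zero)
    finally show ?thesis .
  qed
qed

text \<open>The factor \<open>exp (- window)\<close> is the variation of
  \<open>p powr (1 - a)\<close> over the top primes, \<open>window / 2\<close> is what Mertens'
  estimate leaves there.\<close>

definition mass_const :: real where "mass_const = exp (- window) * (window / 2)"

lemma mass_const_pos: "mass_const > 0"
  using window_ge by (simp add: mass_const_def)

text \<open>A prime \<open>p\<close> contributes little to the decay at \<open>t\<close> only if \<open>t * ln p\<close> is close to
  \<open>2 * pi * j\<close>, which confines \<open>ln p\<close> to short intervals.\<close>

lemma top_primes_decay:
  fixes y a t :: real
  defines "L \<equiv> ln y" and "\<xi> \<equiv> (1 - a) * ln y"
  defines "\<rho> \<equiv> 1 / \<xi>\<^sup>2" and "v \<equiv> L * (1 - window / \<xi>)"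
  assumes y: "y > 1" and a: "1/2 \<le> a" "a < 1" and xi: "\<xi> \<ge> 2 * window" and t: "t > 0"
    and v4: "exp v \<ge> 4" and hv: "2 * \<rho> / t * exp v \<ge> 1"
    and cond: "144 * (window + 2 * \<xi> / (t * L)) * \<rho> * (1 + ln (1 + t / (2 * \<rho>))) \<le> mass_const / 2"
  shows "(\<Sum>p\<in>top_primes v y. (1 + chi4 p) * real p powr (- a) * (1 - cos (t * ln (real p)))) \<ge> \<rho>\<^sup>2 / 4 * (mass_const / 2 * (exp \<xi> / \<xi>))"
proof -
  let ?T = "top_primes v y" and ?a = "\<lambda>p. (1 + chi4 p) * real p powr (- a)"
  have L: "L > 0" using y by (simp add: L_def)
  have xi0: "\<xi> \<ge> 1" "\<xi> \<ge> window" "\<xi> > 0" using xi window_ge by linarith+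
  have rho: "0 < \<rho>" "\<rho> \<le> 1" using xi0 by (auto simp: \<rho>_def one_le_power)
  have vL: "v \<ge> L / 2"
  proof -
    have "window / \<xi> \<le> 1/2" using xi xi0 by (simp add: field_simps)
    hence "L * (1/2) \<le> L * (1 - window / \<xi>)" using L by (intro mult_left_mono) auto
    thus ?thesis by (simp add: v_def)
  qed
  hence v0: "v > 0" using L by linarith
  have a0: "0 \<le> ?a p" for p using chi4_coeff_bounds(1)[of p 1] by simp
  have a2: "?a p \<le> 2 * real p powr (- a)" for p using chi4_coeff_bounds(2)[of p 1] by (intro mult_right_mono) auto
  have lnT: "0 \<le> ln (real p)" "ln (real p) \<le> L" if "p \<in> ?T" for p
    using that prime_ge_1_nat[of p] y by (auto simp: top_primes_def L_def)
  have A: "(\<Sum>p\<in>?T. ?a p) \<ge> mass_const * (exp \<xi> / \<xi>)"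
  proof -
    have "mass_const * (exp \<xi> / \<xi>) * L \<le> (\<Sum>p\<in>?T. ?a p * ln (real p))"
      using top_primes_sum_lower[of y a] y a xi0 unfolding mass_const_def v_def L_def \<xi>_def by auto
    also have "\<dots> \<le> (\<Sum>p\<in>?T. ?a p * L)" by (intro sum_mono mult_left_mono lnT a0) auto
    also have "\<dots> = (\<Sum>p\<in>?T. ?a p) * L" by (simp add: sum_distrib_right)
    finally show ?thesis by (rule mult_right_le_imp_le) (rule L)
  qed
  \<comment> \<open>The length of the interval to which
    \<open>\<bar>t * ln p - 2 * pi * j\<bar> < \<rho>\<close> confines \<open>ln p\<close>.\<close>
  define h where "h = 2 * \<rho> / t"
  have h: "h > 0" using rho t by (simp add: h_def)
  define Bad where "Bad = {p \<in> ?T. \<exists>j::int. \<bar>t * ln (real p) - 2 * pi * j\<bar> < \<rho>}"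
  define lo where "lo = (t * v - \<rho>) / (2 * pi)"
  define hi where "hi = (t * L + \<rho>) / (2 * pi)"
  define J where "J = {\<lceil>lo\<rceil>..\<lfloor>hi\<rfloor>}"
  \<comment> \<open>Left ends below \<open>v\<close> are moved up to \<open>v\<close>, where
    \<open>interval_primes\<close> applies; top primes satisfy \<open>ln p > v\<close>, so none is
    lost.\<close>
  define vj where "vj = (\<lambda>j::int. max v ((2 * pi * j - \<rho>) / t))"
  define I where "I = (\<lambda>j::int. {p. prime p \<and> vj j < ln (real p) \<and> ln (real p) \<le> vj j + h \<and> real p \<le> y})"
  have finI: "finite (I j)" for j by (rule finite_subset[OF _ finite_primes_le[of y]]) (auto simp: I_def primes_le_def)
  have finT: "finite ?T" by (rule finite_top_primes)
  have finBad: "finite Bad" using finT by (simp add: Bad_def)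
  have finJ: "finite J" by (simp add: J_def)
  have inI: "\<exists>j\<in>J. p \<in> I j" if p: "p \<in> Bad" for p
  proof -
    obtain j :: int where j: "\<bar>t * ln (real p) - 2 * pi * j\<bar> < \<rho>" using p by (auto simp: Bad_def)
    have pT: "p \<in> ?T" using p by (simp add: Bad_def)
    have pv: "prime p" "v < ln (real p)" "real p \<le> y" using pT by (auto simp: top_primes_def)
    have tv: "t * v \<le> t * ln (real p)" "t * ln (real p) \<le> t * L" using pv lnT[OF pT] t by auto
    have j2: "2 * pi * j < t * ln (real p) + \<rho>" "t * ln (real p) - \<rho> < 2 * pi * j" using j by linarith+
    have "lo \<le> j" "real_of_int j \<le> hi"
      unfolding lo_def hi_def using j2 tv by (auto simp: field_simps)
    hence "j \<in> J" by (simp add: J_def ceiling_le_iff le_floor_iff)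
    moreover have "p \<in> I j"
    proof -
      have l1: "(2 * pi * j - \<rho>) / t < ln (real p)" using j2 t by (simp add: field_simps)
      have "ln (real p) < (2 * pi * j + \<rho>) / t" using j2 t by (simp add: field_simps)
      also have "\<dots> = (2 * pi * j - \<rho>) / t + h" using t by (simp add: h_def field_simps)
      also have "\<dots> \<le> vj j + h" by (simp add: vj_def)
      finally show ?thesis using l1 pv by (simp add: I_def vj_def)
    qed
    ultimately show ?thesis by blast
  qed
  define X where "X = 18 * h * exp ((1 - a) * ln y) * (1 + ln (1 + 1 / h)) / v"
  have lnn: "ln (1 + 1 / h) \<ge> 0" using h by (intro ln_ge_zero) auto
  have X0: "X \<ge> 0" unfolding X_def using h lnn v0 by (intro divide_nonneg_pos mult_nonneg_nonneg) auto
  have IX: "(\<Sum>p\<in>I j. real p powr (- a)) \<le> X" for j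
    unfolding I_def X_def by (rule interval_primes) (use y v0 v4 h hv a in \<open>auto simp: vj_def h_def\<close>)
  have "(\<Sum>p\<in>Bad. ?a p) \<le> (\<Sum>p\<in>Bad. \<Sum>j\<in>J. if p \<in> I j then ?a p else 0)"
  proof (rule sum_mono)
    fix p assume "p \<in> Bad"
    then obtain j where j: "j \<in> J" "p \<in> I j" using inI by blast
    have "(if p \<in> I j then ?a p else 0) \<le> (\<Sum>j\<in>J. if p \<in> I j then ?a p else 0)"
      by (rule member_le_sum[OF j(1) _ finJ]) (use a0 in auto)
    thus "?a p \<le> (\<Sum>j\<in>J. if p \<in> I j then ?a p else 0)" using j by simp
  qed
  also have "\<dots> = (\<Sum>j\<in>J. \<Sum>p\<in>Bad. if p \<in> I j then ?a p else 0)" by (rule sum.swap)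
  also have "\<dots> \<le> (\<Sum>j\<in>J. 2 * X)"
  proof (rule sum_mono)
    fix j
    have "(\<Sum>p\<in>Bad. if p \<in> I j then ?a p else 0) = (\<Sum>p\<in>{p\<in>Bad. p \<in> I j}. ?a p)"
      by (rule sum.inter_filter[symmetric, OF finBad])
    also have "\<dots> \<le> (\<Sum>p\<in>I j. ?a p)" by (intro sum_mono2 finI a0) auto
    also have "\<dots> \<le> (\<Sum>p\<in>I j. 2 * real p powr (- a))" by (intro sum_mono a2)
    also have "\<dots> = 2 * (\<Sum>p\<in>I j. real p powr (- a))" by (simp add: sum_distrib_left)
    also have "\<dots> \<le> 2 * X" by (intro mult_left_mono IX) auto
    finally show "(\<Sum>p\<in>Bad. if p \<in> I j then ?a p else 0) \<le> 2 * X" .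
  qed
  also have "\<dots> = real (card J) * (2 * X)" by simp
  \<comment> \<open>\<open>t * ln p\<close> ranges over a length
    \<open>t * window * L / \<xi>\<close>; this bounds the number of multiples of
    \<open>2 * pi\<close> that come within \<open>\<rho>\<close> of it, generously, since the
    divisor \<open>2 * pi\<close> is dropped.\<close>
  also have "\<dots> \<le> (t * (window * L / \<xi>) + 2) * (2 * X)"
  proof (rule mult_right_mono)
    have "real (card J) \<le> max 0 (hi - lo + 1)"
    proof -
      have "real (card J) = max 0 (real_of_int (\<lfloor>hi\<rfloor> - \<lceil>lo\<rceil> + 1))" by (simp add: J_def)
      also have "\<dots> \<le> max 0 (hi - lo + 1)" by (rule max.mono) (auto, linarith)
      finally show ?thesis .
    qed
    moreover have "hi - lo + 1 \<le> t * (window * L / \<xi>) + 2"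
    proof -
      have "hi - lo = (t * (L - v) + 2 * \<rho>) / (2 * pi)" by (simp add: hi_def lo_def diff_divide_distrib[symmetric] right_diff_distrib)
      also have "L - v = window * L / \<xi>" using xi0 by (simp add: v_def field_simps)
      also have "(t * (window * L / \<xi>) + 2 * \<rho>) / (2 * pi) \<le> (t * (window * L / \<xi>) + 2 * \<rho>) / 2"
        using t L xi0 window_ge rho pi_gt3 by (intro divide_left_mono add_nonneg_nonneg mult_nonneg_nonneg divide_nonneg_nonneg) auto
      also have "\<dots> = t * (window * L / \<xi>) / 2 + \<rho>" by simp
      also have "\<dots> \<le> t * (window * L / \<xi>) + 1"
      proof -
        have "0 \<le> t * (window * L / \<xi>)" using t L xi0 window_ge by (intro mult_nonneg_nonneg divide_nonneg_nonneg) auto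
        moreover have "x / 2 + \<rho> \<le> x + 1" if "0 \<le> x" for x using that rho by linarith
        ultimately show ?thesis by blast
      qed
      finally have "hi - lo \<le> t * (window * L / \<xi>) + 1" .
      thus ?thesis by simp
    qed
    moreover have "0 \<le> t * (window * L / \<xi>) + 2" using t L xi0 window_ge by (intro add_nonneg_nonneg mult_nonneg_nonneg divide_nonneg_nonneg) auto
    ultimately show "real (card J) \<le> t * (window * L / \<xi>) + 2" by linarith
  qed (use X0 in simp)
  also have "\<dots> \<le> (t * (window * L / \<xi>) + 2) * (2 * (18 * h * exp \<xi> * (1 + ln (1 + 1 / h)) / (L / 2)))"
  proof (intro mult_left_mono)
    have "18 * h * exp \<xi> * (1 + ln (1 + 1 / h)) / v \<le> 18 * h * exp \<xi> * (1 + ln (1 + 1 / h)) / (L / 2)"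
      using vL v0 L h lnn by (intro divide_left_mono mult_nonneg_nonneg mult_pos_pos) auto
    thus "X \<le> 18 * h * exp \<xi> * (1 + ln (1 + 1 / h)) / (L / 2)" by (simp add: X_def \<xi>_def)
    show "0 \<le> t * (window * L / \<xi>) + 2" using t L xi0 window_ge by (intro add_nonneg_nonneg mult_nonneg_nonneg divide_nonneg_nonneg) auto
  qed auto
  \<comment> \<open>144 is \<open>2 * 18 * 2 * 2\<close>: the bound for \<open>1 + chi4 p\<close>,
    the constant of \<open>interval_primes\<close>, and the factors 2 in
    \<open>v \<ge> L / 2\<close> and \<open>h = 2 * \<rho> / t\<close>.\<close>
  also have "\<dots> = (144 * (window + 2 * \<xi> / (t * L)) * \<rho> * (1 + ln (1 + t / (2 * \<rho>)))) * (exp \<xi> / \<xi>)"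
  proof -
    have "1 / h = t / (2 * \<rho>)" by (simp add: h_def)
    moreover have "(t * (window * L / \<xi>) + 2) * (2 * (18 * h * E * F / (L / 2))) = (144 * (window + 2 * \<xi> / (t * L)) * \<rho> * F) * (E / \<xi>)" for E F
      using t L xi0 by (simp add: h_def field_simps)
    ultimately show ?thesis by simp
  qed
  also have "\<dots> \<le> (mass_const / 2) * (exp \<xi> / \<xi>)" using cond xi0 by (intro mult_right_mono) auto
  finally have bad: "(\<Sum>p\<in>Bad. ?a p) \<le> (mass_const / 2) * (exp \<xi> / \<xi>)" .
  have "(\<Sum>p\<in>?T. ?a p) = (\<Sum>p\<in>?T - Bad. ?a p) + (\<Sum>p\<in>Bad. ?a p)"
    by (rule sum.subset_diff) (auto simp: Bad_def finT)
  moreover have "mass_const * (exp \<xi> / \<xi>) = mass_const / 2 * (exp \<xi> / \<xi>) + mass_const / 2 * (exp \<xi> / \<xi>)" by simp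
  moreover have "x \<le> g" if "A \<ge> m" "A = g + b" "b \<le> x" "m = x + x" for A g b m x :: real using that by linarith
  ultimately have good: "(\<Sum>p\<in>?T - Bad. ?a p) \<ge> mass_const / 2 * (exp \<xi> / \<xi>)" using A bad by blast
  have "\<rho>\<^sup>2 / 4 * (mass_const / 2 * (exp \<xi> / \<xi>)) \<le> \<rho>\<^sup>2 / 4 * (\<Sum>p\<in>?T - Bad. ?a p)"
    by (intro mult_left_mono good) auto
  also have "\<dots> = (\<Sum>p\<in>?T - Bad. ?a p * (\<rho>\<^sup>2 / 4))" unfolding sum_distrib_left by (intro sum.cong refl) (rule mult.commute)
  also have "\<dots> \<le> (\<Sum>p\<in>?T - Bad. ?a p * (1 - cos (t * ln (real p))))"
  proof (rule sum_mono, rule mult_left_mono)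
    fix p assume "p \<in> ?T - Bad"
    hence "\<not> \<bar>t * ln (real p) - 2 * pi * j\<bar> < \<rho>" for j :: int by (auto simp: Bad_def)
    thus "\<rho>\<^sup>2 / 4 \<le> 1 - cos (t * ln (real p))" by (intro one_minus_cos_lower rho) (auto simp: not_less)
  qed (rule a0)
  also have "\<dots> \<le> (\<Sum>p\<in>?T. ?a p * (1 - cos (t * ln (real p))))"
    by (rule sum_mono2[OF finT]) (use a0 in auto)
  finally show ?thesis .
qed

text \<open>The reason for \<open>\<rho> = 1 / \<xi>^2\<close>: the primes near multiples of
  \<open>2 * pi / t\<close> then carry at most half of the mass. If
  \<open>t * L \<ge> \<xi>\<close>, the bracket with \<open>window\<close> is bounded and the
  logarithm has order at most \<open>\<xi>\<close>. Otherwise \<open>t \<le> 1/2\<close>, the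
  bracket has order at most \<open>\<xi>\<close> and the logarithm only \<open>ln \<xi>\<close>. In
  both regimes \<open>1 / \<xi>^2\<close> wins.\<close>

lemma decay_condition:
  fixes c :: real
  assumes c: "c > 0"
  shows "\<exists>\<xi>0. \<forall>\<xi> L t. \<xi> \<ge> \<xi>0 \<longrightarrow> \<xi> > 0 \<longrightarrow> \<xi> \<le> L / 2 \<longrightarrow> c / L \<le> t \<longrightarrow> t \<le> exp (2 * \<xi>) \<longrightarrow>
     144 * (window + 2 * \<xi> / (t * L)) * (1 / \<xi>\<^sup>2) * (1 + ln (1 + t / (2 * (1 / \<xi>\<^sup>2)))) \<le> mass_const / 2"
proof -
  define f1 where "f1 = (\<lambda>\<xi>::real. 144 * (window + 2) * (1 / \<xi>\<^sup>2) * (1 + ln (1 + exp (2 * \<xi>) * \<xi>\<^sup>2 / 2)))"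
  define f2 where "f2 = (\<lambda>\<xi>::real. 144 * (window + 2 * \<xi> / c) * (1 / \<xi>\<^sup>2) * (1 + ln (1 + \<xi>\<^sup>2)))"
  have w: "window > 0" using window_ge by linarith
  have "(f1 \<longlongrightarrow> 0) at_top" unfolding f1_def using w by real_asymp
  hence e1: "eventually (\<lambda>\<xi>. f1 \<xi> < mass_const / 2) at_top" using mass_const_pos by (intro order_tendstoD) auto
  have "(f2 \<longlongrightarrow> 0) at_top" unfolding f2_def using w c by real_asymp
  hence e2: "eventually (\<lambda>\<xi>. f2 \<xi> < mass_const / 2) at_top" using mass_const_pos by (intro order_tendstoD) auto
  from eventually_conj[OF e1 e2] obtain \<xi>0 where x0: "\<And>\<xi>. \<xi> \<ge> \<xi>0 \<Longrightarrow> f1 \<xi> < mass_const / 2 \<and> f2 \<xi> < mass_const / 2"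
    unfolding eventually_at_top_linorder by blast
  show ?thesis
  proof (intro exI[of _ \<xi>0] allI impI)
    fix \<xi> L t :: real
    assume h: "\<xi> \<ge> \<xi>0" "\<xi> > 0" "\<xi> \<le> L / 2" "c / L \<le> t" "t \<le> exp (2 * \<xi>)"
    have L: "L > 0" using h by linarith
    have t: "t > 0" using h(4) c L divide_pos_pos[of c L] by linarith
    have eq: "t / (2 * (1 / \<xi>\<^sup>2)) = t * \<xi>\<^sup>2 / 2" by simp
    have x2: "\<xi>\<^sup>2 > 0" using h by simp
    show "144 * (window + 2 * \<xi> / (t * L)) * (1 / \<xi>\<^sup>2) * (1 + ln (1 + t / (2 * (1 / \<xi>\<^sup>2)))) \<le> mass_const / 2"
    proof (cases "t * L \<ge> \<xi>")
      case True
      have "2 * \<xi> / (t * L) \<le> 2" using True t L by (simp add: field_simps)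
      moreover have "ln (1 + t * \<xi>\<^sup>2 / 2) \<le> ln (1 + exp (2 * \<xi>) * \<xi>\<^sup>2 / 2)"
      proof -
        have p1: "0 < t * \<xi>\<^sup>2" using t x2 by simp
        have "t * \<xi>\<^sup>2 \<le> exp (2 * \<xi>) * \<xi>\<^sup>2" using h x2 by (intro mult_right_mono) auto
        thus ?thesis using p1 by (subst ln_le_cancel_iff) (auto intro: add_pos_pos)
      qed
      moreover have "0 \<le> ln (1 + t * \<xi>\<^sup>2 / 2)" using t x2 by (intro ln_ge_zero) auto
      ultimately have "144 * (window + 2 * \<xi> / (t * L)) * (1 / \<xi>\<^sup>2) * (1 + ln (1 + t * \<xi>\<^sup>2 / 2)) \<le> f1 \<xi>"
        unfolding f1_def using w t L h by (intro mult_mono add_mono mult_nonneg_nonneg add_nonneg_nonneg divide_nonneg_nonneg) auto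
      thus ?thesis unfolding eq using x0[OF h(1)] by linarith
    next
      case False
      have tL: "c \<le> t * L" using h(4) L by (simp add: field_simps)
      have "2 * \<xi> / (t * L) \<le> 2 * \<xi> / c" using tL c h by (intro divide_left_mono) auto
      moreover have "ln (1 + t * \<xi>\<^sup>2 / 2) \<le> ln (1 + \<xi>\<^sup>2)"
      proof -
        have "t * L \<le> 1/2 * L" using False h by linarith
        hence "t \<le> 1/2" using L by (simp only: mult_le_cancel_right_pos)
        hence "t * \<xi>\<^sup>2 \<le> 1 * \<xi>\<^sup>2" using x2 by (intro mult_right_mono) auto
        moreover have "0 < t * \<xi>\<^sup>2" using t x2 by simp
        ultimately show ?thesis using x2 by (subst ln_le_cancel_iff) (auto intro: add_pos_pos)
      qed
      moreover have "0 \<le> ln (1 + t * \<xi>\<^sup>2 / 2)" using t x2 by (intro ln_ge_zero) auto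
      ultimately have "144 * (window + 2 * \<xi> / (t * L)) * (1 / \<xi>\<^sup>2) * (1 + ln (1 + t * \<xi>\<^sup>2 / 2)) \<le> f2 \<xi>"
        unfolding f2_def using w t L h c by (intro mult_mono add_mono mult_nonneg_nonneg add_nonneg_nonneg divide_nonneg_nonneg) auto
      thus ?thesis unfolding eq using x0[OF h(1)] by linarith
    qed
  qed
qed

text \<open>Each jump contributes a nonnegative intensity times \<open>cos - 1\<close>, so
  everything except the jumps \<open>k = 1\<close> of the top primes may be discarded.\<close>

lemma Re_levy_exponent_le:
  assumes a: "a > 0"
  shows "Re (levy_exponent a y t) \<le> - (\<Sum>p\<in>top_primes v y. (1 + chi4 p) * real p powr (- a) * (1 - cos (t * ln (real p))))"
proof -
  let ?q = "\<lambda>p. real p powr (- a)"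
  let ?r = "\<lambda>p k. levy (chi4 p) (?q p) k * (1 - cos (t * (real k * ln (real p))))"
  have r: "?r p sums (- Re (\<Sum>k. levy (chi4 p) (?q p) k *\<^sub>R (iexp (t * (real k * ln (real p))) - 1 - \<i> * (t * (real k * ln (real p))))))"
    if "prime p" for p
  proof -
    have "(\<lambda>k. Re (levy (chi4 p) (?q p) k *\<^sub>R (iexp (t * (real k * ln (real p))) - 1 - \<i> * (t * (real k * ln (real p)))))) sums
       Re (\<Sum>k. levy (chi4 p) (?q p) k *\<^sub>R (iexp (t * (real k * ln (real p))) - 1 - \<i> * (t * (real k * ln (real p)))))"
      by (rule sums_Re[OF summable_sums[OF levy_local(1)[OF that a]]])
    from sums_minus[OF this] show ?thesis by (rule sums_cong[THEN iffD1, rotated]) (simp add: Re_exp algebra_simps)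
  qed
  have nn: "?r p k \<ge> 0" if "prime p" for p k
    using levy_nonneg[OF chi4_abs_le, of "?q p" p k] prime_powr_bounds[OF that a] by simp
  have one: "(1 + chi4 p) * ?q p * (1 - cos (t * ln (real p))) \<le> - Re (\<Sum>k. levy (chi4 p) (?q p) k *\<^sub>R (iexp (t * (real k * ln (real p))) - 1 - \<i> * (t * (real k * ln (real p)))))"
    if "prime p" for p
  proof -
    have "(\<Sum>k\<in>{1}. ?r p k) \<le> (\<Sum>k. ?r p k)" using r[OF that] nn[OF that] by (intro sum_le_suminf) (auto simp: sums_iff)
    also have "\<dots> = - Re (\<Sum>k. levy (chi4 p) (?q p) k *\<^sub>R (iexp (t * (real k * ln (real p))) - 1 - \<i> * (t * (real k * ln (real p)))))"
      using sums_unique[OF r[OF that]] by simp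
    finally show ?thesis by (simp add: levy_def)
  qed
  have z: "0 \<le> (1 + chi4 p) * ?q p * (1 - cos (t * ln (real p)))" for p
    using chi4_coeff_bounds(1)[of p 1] by (intro mult_nonneg_nonneg) auto
  have "(\<Sum>p\<in>top_primes v y. (1 + chi4 p) * ?q p * (1 - cos (t * ln (real p)))) \<le>
     (\<Sum>p\<in>primes_le y. (1 + chi4 p) * ?q p * (1 - cos (t * ln (real p))))"
    by (rule sum_mono2[OF finite_primes_le top_primes_subset]) (rule z)
  also have "\<dots> \<le> (\<Sum>p\<in>primes_le y. - Re (\<Sum>k. levy (chi4 p) (?q p) k *\<^sub>R (iexp (t * (real k * ln (real p))) - 1 - \<i> * (t * (real k * ln (real p))))))"
    by (intro sum_mono one) (auto simp: primes_le_def)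
  also have "\<dots> = - Re (levy_exponent a y t)" by (simp add: levy_exponent_def sum_negf)
  finally show ?thesis by linarith
qed

text \<open>Third-order Taylor expansion at each jump. The compensator has already removed the
  linear term, so the expansion starts with the variance; summing the jump moments turns the
  coefficients into cumulants.\<close>

lemma levy_exponent_expansion:
  fixes a y t :: real
  assumes a: "a > 0"
  shows "\<exists>R. cmod R \<le> kap 4 a y / 24 * t ^ 4 \<and>
     levy_exponent a y t = - (kap 2 a y * t\<^sup>2 / 2) + \<i> * ((- kap 3 a y / 6) * t ^ 3) + R"
proof -
  let ?q = "\<lambda>p. real p powr (- a)"
  let ?l = "\<lambda>p. ln (real p)"
  let ?lv = "\<lambda>p k. levy (chi4 p) (?q p) k"
  let ?e = "\<lambda>p k. iexp (t * (real k * ?l p)) - 1 - \<i> * (t * (real k * ?l p))"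
  let ?r = "\<lambda>p k. ?lv p k *\<^sub>R (?e p k + (t * (real k * ?l p))\<^sup>2 / 2 + \<i> * (t * (real k * ?l p)) ^ 3 / 6)"
  let ?m = "\<lambda>j p. levy_moment j (chi4 p) (?q p)"
  have loc: "\<exists>R. (\<Sum>k. ?lv p k *\<^sub>R ?e p k) = - complex_of_real (?m 2 p * ?l p ^ 2 * (t\<^sup>2 / 2)) - \<i> * complex_of_real (?m 3 p * ?l p ^ 3 * (t ^ 3 / 6)) + R \<and>
      cmod R \<le> ?m 4 p * ?l p ^ 4 * (t ^ 4 / 24)" if p: "prime p" for p
  proof -
    have sm: "summable (\<lambda>k. ?lv p k * real k ^ j)" for j
      by (rule summable_levy_moment[OF chi4_abs_le prime_powr_bounds[OF p a]])
    have ms: "(\<lambda>k. ?lv p k * real k ^ j) sums ?m j p" for j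
      unfolding levy_moment_def by (rule summable_sums[OF sm])
    have s2: "(\<lambda>k. complex_of_real (?lv p k * real k ^ 2) * complex_of_real (?l p ^ 2 * (t\<^sup>2 / 2))) sums (complex_of_real (?m 2 p) * complex_of_real (?l p ^ 2 * (t\<^sup>2 / 2)))"
      by (intro sums_mult2 sums_of_real ms)
    have s3: "(\<lambda>k. complex_of_real (?lv p k * real k ^ 3) * (\<i> * complex_of_real (?l p ^ 3 * (t ^ 3 / 6)))) sums (complex_of_real (?m 3 p) * (\<i> * complex_of_real (?l p ^ 3 * (t ^ 3 / 6))))"
      by (intro sums_mult2 sums_of_real ms)
    have s1: "(\<lambda>k. ?lv p k *\<^sub>R ?e p k) sums (\<Sum>k. ?lv p k *\<^sub>R ?e p k)"
      by (rule summable_sums[OF levy_local(1)[OF p a]])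
    define R where "R = (\<Sum>k. ?lv p k *\<^sub>R ?e p k) + complex_of_real (?m 2 p) * complex_of_real (?l p ^ 2 * (t\<^sup>2 / 2)) + complex_of_real (?m 3 p) * (\<i> * complex_of_real (?l p ^ 3 * (t ^ 3 / 6)))"
    have R: "?r p sums R"
      unfolding R_def using sums_add[OF sums_add[OF s1 s2] s3]
      by (rule sums_cong[THEN iffD1, rotated]) (simp add: scaleR_conv_of_real power_mult_distrib algebra_simps)
    have s4: "(\<lambda>k. ?lv p k * real k ^ 4 * (?l p ^ 4 * (t ^ 4 / 24))) sums (?m 4 p * (?l p ^ 4 * (t ^ 4 / 24)))"
      by (intro sums_mult2 ms)
    have b: "norm (?r p k) \<le> ?lv p k * real k ^ 4 * (?l p ^ 4 * (t ^ 4 / 24))" for k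
    proof -
      define \<theta> where "\<theta> = t * (real k * ?l p)"
      have "cmod (iexp \<theta> - (\<Sum>k \<le> 3. (\<i> * \<theta>)^k / fact k)) \<le> \<bar>\<theta>\<bar>^(Suc 3) / fact (Suc 3)" by (rule iexp_approx1)
      moreover have "(\<Sum>k \<le> 3. (\<i> * \<theta>)^k / fact k) = 1 + \<i> * \<theta> - \<theta>\<^sup>2 / 2 - \<i> * \<theta> ^ 3 / 6"
      proof -
        have i3: "\<i> ^ 3 = - \<i>" by (simp add: power3_eq_cube)
        have "{..3::nat} = {0, 1, 2, 3}" by auto
        thus ?thesis by (simp add: power_mult_distrib fact_numeral i3)
      qed
      moreover have "\<bar>\<theta>\<bar>^(Suc 3) / fact (Suc 3) = \<theta> ^ 4 / 24"
      proof -
        have "Suc 3 = (4::nat)" by simp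
        thus ?thesis by (simp only: power_even_abs_numeral even_numeral) (simp add: fact_numeral)
      qed
      ultimately have "cmod (iexp \<theta> - (1 + \<i> * \<theta> - \<theta>\<^sup>2 / 2 - \<i> * \<theta> ^ 3 / 6)) \<le> \<theta> ^ 4 / 24" by (simp add: fact_numeral)
      also have "iexp \<theta> - (1 + \<i> * \<theta> - \<theta>\<^sup>2 / 2 - \<i> * \<theta> ^ 3 / 6) = iexp \<theta> - 1 - \<i> * \<theta> + \<theta>\<^sup>2 / 2 + \<i> * \<theta> ^ 3 / 6"
        by (simp add: algebra_simps)
      finally have "?lv p k * cmod (iexp \<theta> - 1 - \<i> * \<theta> + \<theta>\<^sup>2 / 2 + \<i> * \<theta> ^ 3 / 6) \<le> ?lv p k * (\<theta> ^ 4 / 24)"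
        using levy_nonneg[OF chi4_abs_le, of "?q p" p k] by (intro mult_left_mono) auto
      also have "?lv p k * (\<theta> ^ 4 / 24) = ?lv p k * real k ^ 4 * (?l p ^ 4 * (t ^ 4 / 24))"
        by (simp add: \<theta>_def power_mult_distrib)
      finally show ?thesis using levy_nonneg[OF chi4_abs_le, of "?q p" p k] unfolding \<theta>_def by simp
    qed
    have "cmod R \<le> ?m 4 p * (?l p ^ 4 * (t ^ 4 / 24))"
      unfolding sums_unique[OF R] sums_unique[OF s4]
      by (rule norm_suminf_le[OF b sums_summable[OF s4]])
    moreover have "(\<Sum>k. ?lv p k *\<^sub>R ?e p k) = - complex_of_real (?m 2 p * ?l p ^ 2 * (t\<^sup>2 / 2)) - \<i> * complex_of_real (?m 3 p * ?l p ^ 3 * (t ^ 3 / 6)) + R"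
      unfolding R_def by (simp add: mult_ac)
    ultimately show ?thesis by (intro exI[of _ R]) (simp add: mult.assoc)
  qed
  define Rp where "Rp = (\<lambda>p. SOME R. (\<Sum>k. ?lv p k *\<^sub>R ?e p k) = - complex_of_real (?m 2 p * ?l p ^ 2 * (t\<^sup>2 / 2)) - \<i> * complex_of_real (?m 3 p * ?l p ^ 3 * (t ^ 3 / 6)) + R \<and>
      cmod R \<le> ?m 4 p * ?l p ^ 4 * (t ^ 4 / 24))"
  have Rp: "(\<Sum>k. ?lv p k *\<^sub>R ?e p k) = - complex_of_real (?m 2 p * ?l p ^ 2 * (t\<^sup>2 / 2)) - \<i> * complex_of_real (?m 3 p * ?l p ^ 3 * (t ^ 3 / 6)) + Rp p"
      "cmod (Rp p) \<le> ?m 4 p * ?l p ^ 4 * (t ^ 4 / 24)" if "p \<in> primes_le y" for p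
    using someI_ex[OF loc[OF primes_le_prime[OF that]]] unfolding Rp_def by blast+
  define R where "R = (\<Sum>p\<in>primes_le y. Rp p)"
  have "cmod R \<le> (\<Sum>p\<in>primes_le y. cmod (Rp p))" unfolding R_def by (rule norm_sum)
  also have "\<dots> \<le> (\<Sum>p\<in>primes_le y. ?m 4 p * ?l p ^ 4 * (t ^ 4 / 24))" by (intro sum_mono Rp)
  also have "\<dots> = kap 4 a y / 24 * t ^ 4" unfolding kap_def sum_distrib_right[symmetric] by simp
  finally have 1: "cmod R \<le> kap 4 a y / 24 * t ^ 4" .
  have "levy_exponent a y t = (\<Sum>p\<in>primes_le y. - complex_of_real (?m 2 p * ?l p ^ 2 * (t\<^sup>2 / 2)) - \<i> * complex_of_real (?m 3 p * ?l p ^ 3 * (t ^ 3 / 6)) + Rp p)"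
    unfolding levy_exponent_def by (intro sum.cong refl Rp)
  also have "\<dots> = - complex_of_real (\<Sum>p\<in>primes_le y. ?m 2 p * ?l p ^ 2 * (t\<^sup>2 / 2)) - \<i> * complex_of_real (\<Sum>p\<in>primes_le y. ?m 3 p * ?l p ^ 3 * (t ^ 3 / 6)) + R"
    unfolding R_def by (simp only: sum.distrib sum_subtractf sum_negf of_real_sum sum_distrib_left)
  also have "(\<Sum>p\<in>primes_le y. ?m 2 p * ?l p ^ 2 * (t\<^sup>2 / 2)) = kap 2 a y * t\<^sup>2 / 2" unfolding kap_def sum_distrib_right[symmetric] by simp
  also have "(\<Sum>p\<in>primes_le y. ?m 3 p * ?l p ^ 3 * (t ^ 3 / 6)) = kap 3 a y * t ^ 3 / 6" unfolding kap_def sum_distrib_right[symmetric] by simp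
  finally have "levy_exponent a y t = - (kap 2 a y * t\<^sup>2 / 2) + \<i> * ((- kap 3 a y / 6) * t ^ 3) + R" by simp
  thus ?thesis using 1 by blast
qed

section \<open>The asymptotic formula\<close>

text \<open>Gives \<open>exp (\<xi> / 2) \<le> exp \<xi> / \<xi>\<close>, by which
  \<open>\<xi>\<close> is bounded by a multiple of a logarithm of \<open>u\<close>.\<close>

lemma le_exp_half: "x \<le> exp (x / 2)" for x :: real
proof -
  have "x \<le> 1 + x / 2 + (x / 2)\<^sup>2 / 2"
  proof -
    have "0 \<le> (x / 2 - 1)\<^sup>2" by simp
    thus ?thesis by (simp add: power2_eq_square field_simps)
  qed
  show ?thesis
  proof (cases "x \<ge> 0")
    case True
    thus ?thesis using exp_lower_Taylor_quadratic[of "x / 2"] \<open>x \<le> 1 + x / 2 + (x / 2)\<^sup>2 / 2\<close> by simp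
  next
    case False
    thus ?thesis using exp_gt_zero[of "x / 2"] by linarith
  qed
qed

text \<open>Intermediate value theorem between \<open>1/2\<close> and \<open>1 - 1 / ln y\<close>.
  At the right end \<open>\<xi> = 1\<close> and \<open>kap_upper\<close> gives a constant times
  \<open>ln y\<close>, less than \<open>u * ln y\<close>. At the left end
  \<open>\<xi> = ln y / 2\<close> and \<open>kap_lower\<close> gives a multiple of
  \<open>exp (ln y / 2)\<close>, which exceeds \<open>u * ln y\<close>.\<close>

lemma saddle_point_exists:
  assumes y: "y > 1" and L2: "ln y \<ge> 2" and Lw: "ln y \<ge> 4 * window"
    and lo: "24 * levy_const * exp 1 < u" and hi: "u * ln y \<le> 2 * mass_const * exp (ln y / 2)"
  shows "\<exists>a. 1/2 \<le> a \<and> a \<le> 1 - 1 / ln y \<and> kap 1 a y = u * ln y"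
proof -
  define L where "L = ln y"
  have L: "L \<ge> 2" using L2 by (simp add: L_def)
  have b: "1/2 \<le> 1 - 1 / L" using L by (simp add: field_simps)
  have "kap 1 (1/2) y \<ge> mass_const * (exp (L / 2) / (L / 2)) * L"
    using kap_lower[of y "1/2" 1] y Lw by (simp add: L_def mass_const_def)
  also have "mass_const * (exp (L / 2) / (L / 2)) * L = 2 * mass_const * exp (L / 2)" using L by simp
  finally have top: "u * L \<le> kap 1 (1/2) y" using hi by (simp add: L_def)
  have e: "(1 - (1 - 1 / L)) * L = 1" using L by simp
  have "kap 1 (1 - 1 / L) y \<le> 24 * levy_const * (exp 1 / 1) * L"
    using kap_upper[of y "1 - 1 / L" 1] y b L unfolding L_def[symmetric] e by simp
  also have "\<dots> \<le> u * L" using lo L by (intro mult_right_mono) auto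
  finally have bot: "kap 1 (1 - 1 / L) y \<le> u * L" .
  have "\<exists>a. 1/2 \<le> a \<and> a \<le> 1 - 1 / L \<and> kap 1 a y = u * L"
  proof (rule IVT2[OF bot top b], intro allI impI)
    fix x assume "1/2 \<le> x \<and> x \<le> 1 - 1 / L"
    hence "x > 0" by linarith
    thus "isCont (\<lambda>a. kap 1 a y) x" using phi_G_has_derivative(2)[of y x] y by (intro DERIV_isCont) auto
  qed
  thus ?thesis by (simp add: L_def)
qed

theorem theorem1p1:
  fixes \<epsilon>\<^sub>0 :: real
  assumes "\<epsilon>\<^sub>0 > 0"
  shows "\<exists>(C :: real) (y\<^sub>0 :: real). \<forall>(x :: real) (y :: real) (u :: real).
           y \<ge> 2 \<longrightarrow> x \<ge> y \<longrightarrow> x = y powr u \<longrightarrow> y \<ge> y\<^sub>0 \<longrightarrow>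
           (ln (ln y))\<^sup>2 \<le> u \<longrightarrow> u \<le> y powr (1 / (2 + \<epsilon>\<^sub>0)) / ln y \<longrightarrow>
           (\<exists>E :: real. \<bar>E\<bar> \<le> C * (1 / u) \<and>
              Psi_G x y =
                4 * x powr (alpha_G x y) * H_G (alpha_G x y) y
                  / (alpha_G x y * sqrt (2 * pi * phi_G_deriv 2 (alpha_G x y) y))
                  * (1 + E))"
proof -
  \<comment> \<open>With \<open>e = exp \<xi> / \<xi>\<close>, the upper and lower bounds on the
    first cumulant will read \<open>m * e \<le> u \<le> A * e\<close>.\<close>
  define A where "A = 24 * levy_const"
  define m where "m = mass_const"
  have A: "A > 0" using levy_const(1) by (simp add: A_def)
  have m: "m > 0" using mass_const_pos by (simp add: m_def)
  have W: "window > 0" using window_ge by linarith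
  \<comment> \<open>The cumulants will satisfy \<open>kap j \<le> K1 * u * L ^ j\<close> and
    \<open>kap 2 \<ge> k2 * u * L^2\<close>; the 2 in \<open>k2\<close> comes from
    \<open>ln p \<ge> L / 2\<close>.\<close>
  define K1 where "K1 = A / m"
  define k2 where "k2 = m / (2 * A)"
  have K1: "K1 > 0" and k2: "k2 > 0" using A m by (auto simp: K1_def k2_def)
  \<comment> \<open>Solves \<open>K1 * c^2 / 24 = k2 / 4\<close>, so that
    \<open>\<gamma> * \<tau>^2 \<le> \<sigma>^2 / 4\<close> holds for
    \<open>\<tau> = c / L\<close>.\<close>
  define c where "c = sqrt (6 * k2 / K1)"
  have c: "c > 0" "c\<^sup>2 = 6 * k2 / K1" using K1 k2 by (auto simp: c_def)
  \<comment> \<open>The last three summands are what \<open>saddle_bound\<close> demands for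
    \<open>\<beta>\<close>, \<open>\<gamma>\<close> and \<open>\<tau>\<close>, in this
    order.\<close>
  define K where "K = 1 + K1\<^sup>2 / (36 * k2 ^ 3) + K1 / (24 * k2\<^sup>2) + 1 / (k2 * c\<^sup>2)"
  have Kge: "K \<ge> 1" "K \<ge> K1\<^sup>2 / (36 * k2 ^ 3)" "K \<ge> K1 / (24 * k2\<^sup>2)" "K \<ge> 1 / (k2 * c\<^sup>2)"
  proof -
    have "0 \<le> K1\<^sup>2 / (36 * k2 ^ 3)" "0 \<le> K1 / (24 * k2\<^sup>2)" "0 \<le> 1 / (k2 * c\<^sup>2)" using K1 k2 c by auto
    thus "K \<ge> 1" "K \<ge> K1\<^sup>2 / (36 * k2 ^ 3)" "K \<ge> K1 / (24 * k2\<^sup>2)" "K \<ge> 1 / (k2 * c\<^sup>2)" unfolding K_def by linarith+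
  qed
  obtain C u0 where sb: "saddle_bound K C u0" using saddle_point_local[OF Kge(1)] by blast
  note main = sb[unfolded saddle_bound_def, rule_format]
  obtain \<xi>0 where dc: "\<And>\<xi> L t. \<xi> \<ge> \<xi>0 \<Longrightarrow> \<xi> > 0 \<Longrightarrow> \<xi> \<le> L / 2 \<Longrightarrow> c / L \<le> t \<Longrightarrow> t \<le> exp (2 * \<xi>) \<Longrightarrow>
     144 * (window + 2 * \<xi> / (t * L)) * (1 / \<xi>\<^sup>2) * (1 + ln (1 + t / (2 * (1 / \<xi>\<^sup>2)))) \<le> mass_const / 2"
    using decay_condition[OF c(1)] by blast
  \<comment> \<open>A threshold for \<open>\<xi>\<close>: \<open>\<xi>0\<close> is for the decay
    condition, \<open>10 * window\<close> gives \<open>v \<ge> 9/10 * L\<close>, and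
    \<open>A\<close> gives \<open>u \<le> exp \<xi>\<close>.\<close>
  define X0 where "X0 = max (max \<xi>0 (10 * window)) (max A 1)"
  text \<open>The lower bound for \<open>u\<close> enters only through \<open>ln y \<le> exp (sqrt u)\<close>.\<close>
  have "eventually (\<lambda>u::real. sqrt K1 * u ^ 3 * exp (sqrt u) \<le> exp (m / (8 * A) * (u / (2 * ln (u / m)) ^ 4))) at_top"
    using K1 m A by real_asymp
  moreover have "eventually (\<lambda>u::real. u\<^sup>2 * (sqrt K1 * sqrt u * exp (sqrt u)) \<le> exp (u / 4)) at_top"
    using K1 by real_asymp
  moreover have "eventually (\<lambda>u. u \<ge> max (max u0 1) (max (A * exp X0 + 1) m)) at_top" by (rule eventually_ge_at_top)
  ultimately have "eventually (\<lambda>u. sqrt K1 * u ^ 3 * exp (sqrt u) \<le> exp (m / (8 * A) * (u / (2 * ln (u / m)) ^ 4)) \<and>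
     u\<^sup>2 * (sqrt K1 * sqrt u * exp (sqrt u)) \<le> exp (u / 4) \<and> u \<ge> max (max u0 1) (max (A * exp X0 + 1) m)) at_top"
    by eventually_elim blast
  then obtain U where U: "\<And>u. u \<ge> U \<Longrightarrow> sqrt K1 * u ^ 3 * exp (sqrt u) \<le> exp (m / (8 * A) * (u / (2 * ln (u / m)) ^ 4))"
      "\<And>u. u \<ge> U \<Longrightarrow> u\<^sup>2 * (sqrt K1 * sqrt u * exp (sqrt u)) \<le> exp (u / 4)"
      "\<And>u. u \<ge> U \<Longrightarrow> u \<ge> u0 \<and> u \<ge> 1 \<and> u \<ge> A * exp X0 + 1 \<and> u \<ge> m"
    unfolding eventually_at_top_linorder by auto
  \<comment> \<open>The strict inequality keeps \<open>y powr (1 / (2 + \<epsilon>\<^sub>0))\<close>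
    below \<open>2 * m * y powr (1/2)\<close> for large \<open>y\<close>, however small the mass
    constant is; the existence of the saddle point depends on it.\<close>
  have half: "1 / (2 + \<epsilon>\<^sub>0) < 1/2" using assms by (simp add: field_simps)
  have "eventually (\<lambda>y::real. y powr (1 / (2 + \<epsilon>\<^sub>0)) \<le> 2 * m * y powr (1/2)) at_top"
    using half m by real_asymp
  moreover have "eventually (\<lambda>y::real. (ln (ln y))\<^sup>2 \<ge> U) at_top" by real_asymp
  moreover have "eventually (\<lambda>y::real. ln y \<ge> max (max 2 (4 * window)) (1 / sqrt k2)) at_top"
    by (rule eventually_compose_filterlim[OF eventually_ge_at_top ln_at_top])
  \<comment> \<open>Frequencies reach at most \<open>exp (3/4 * L)\<close> while
    \<open>exp v\<close> is at least \<open>exp (9/10 * L)\<close>; hence the intervals of bad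
    primes are long enough for \<open>interval_primes\<close>.\<close>
  moreover have "eventually (\<lambda>y::real. (ln y)\<^sup>2 * exp (3/4 * ln y) \<le> exp (9/10 * ln y)) at_top" by real_asymp
  moreover have "eventually (\<lambda>y::real. exp (9/10 * ln y) \<ge> 4) at_top" by real_asymp
  moreover have "eventually (\<lambda>y::real. ln (ln y) \<ge> 0) at_top" by real_asymp
  ultimately have "eventually (\<lambda>y. y powr (1 / (2 + \<epsilon>\<^sub>0)) \<le> 2 * m * y powr (1/2) \<and> (ln (ln y))\<^sup>2 \<ge> U \<and>
     ln y \<ge> max (max 2 (4 * window)) (1 / sqrt k2) \<and> (ln y)\<^sup>2 * exp (3/4 * ln y) \<le> exp (9/10 * ln y) \<and> exp (9/10 * ln y) \<ge> 4 \<and> ln (ln y) \<ge> 0) at_top"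
    by eventually_elim blast
  then obtain Y where Y: "\<And>y. y \<ge> Y \<Longrightarrow> y powr (1 / (2 + \<epsilon>\<^sub>0)) \<le> 2 * m * y powr (1/2) \<and> (ln (ln y))\<^sup>2 \<ge> U \<and>
     ln y \<ge> max (max 2 (4 * window)) (1 / sqrt k2) \<and> (ln y)\<^sup>2 * exp (3/4 * ln y) \<le> exp (9/10 * ln y) \<and> exp (9/10 * ln y) \<ge> 4 \<and> ln (ln y) \<ge> 0"
    unfolding eventually_at_top_linorder by blast
  show ?thesis
  proof (rule exI[of _ C], rule exI[of _ Y], intro allI impI)
    fix x y u :: real
    assume y2: "y \<ge> 2" and xy: "x \<ge> y" and x: "x = y powr u" and yY: "y \<ge> Y" and ulo: "(ln (ln y))\<^sup>2 \<le> u"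
      and uhi: "u \<le> y powr (1 / (2 + \<epsilon>\<^sub>0)) / ln y"
    define L where "L = ln y"
    note YY = Y[OF yY, folded L_def]
    have y1: "y > 1" using y2 by simp
    have L: "L \<ge> 2" "L \<ge> 4 * window" "L \<ge> 1 / sqrt k2" "L > 0" using YY by auto
    have uU: "u \<ge> U" using YY ulo by (simp add: L_def)
    have u: "u \<ge> u0" "u \<ge> 1" "u \<ge> A * exp X0 + 1" "u \<ge> m" "u > 0" using U(3)[OF uU] by auto
    have lnL: "L \<le> exp (sqrt u)"
    proof -
      have "ln L \<le> sqrt u" using ulo YY unfolding L_def by (intro real_le_rsqrt) auto
      hence "exp (ln L) \<le> exp (sqrt u)" by simp
      thus ?thesis using L by simp
    qed
    have yp: "y powr r = exp (r * L)" for r using y1 by (simp add: powr_def L_def)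
    have uL: "u * L \<le> 2 * m * exp (L / 2)"
    proof -
      have "u * L \<le> y powr (1 / (2 + \<epsilon>\<^sub>0))" using uhi L by (simp add: L_def field_simps)
      also have "\<dots> \<le> 2 * m * y powr (1/2)" using YY by blast
      finally show ?thesis by (simp add: yp)
    qed
    have u34: "u powr (3/2) \<le> exp (3/4 * L)"
    proof -
      have "u \<le> u * L" using u L mult_left_mono[of 1 L u] by simp
      also have "u * L \<le> y powr (1 / (2 + \<epsilon>\<^sub>0))" using uhi L by (simp add: L_def field_simps)
      also have "\<dots> \<le> y powr (1/2)" using half y1 by (intro powr_mono) auto
      finally have "u \<le> exp (L / 2)" by (simp add: yp)
      hence "u powr (3/2) \<le> exp (L / 2) powr (3/2)" using u by (intro powr_mono2) auto
      also have "\<dots> = exp (3/4 * L)" by (simp add: powr_def)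
      finally show ?thesis .
    qed
    have X0: "X0 \<ge> \<xi>0" "X0 \<ge> 10 * window" "X0 \<ge> A" "X0 \<ge> 1" by (auto simp: X0_def)
    have lo: "24 * levy_const * exp 1 < u"
    proof -
      have "A * exp 1 \<le> A * exp X0" using A X0 by (intro mult_left_mono) auto
      thus ?thesis using u(3) unfolding A_def by linarith
    qed
    obtain a where a: "1/2 \<le> a" "a \<le> 1 - 1 / L" "kap 1 a y = u * L"
      using saddle_point_exists[OF y1 _ _ lo] L uL unfolding L_def m_def by auto
    have a1: "a < 1" using a(2) L divide_pos_pos[of 1 L] by linarith
    have a0: "a > 0" using a by linarith
    define \<xi> where "\<xi> = (1 - a) * L"
    have xiL: "\<xi> \<le> L / 2" unfolding \<xi>_def using a L mult_right_mono[of "1 - a" "1/2" L] by simp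
    have xi1: "\<xi> \<ge> 1"
    proof -
      have "1 / L * L \<le> (1 - a) * L" using a L by (intro mult_right_mono) auto
      thus ?thesis using L by (simp add: \<xi>_def)
    qed
    define e where "e = exp \<xi> / \<xi>"
    have e0: "e > 0" using xi1 by (simp add: e_def)
    have ku: "kap j a y \<le> A * e * L ^ j" if "1 \<le> j" "j \<le> 4" for j
      using kap_upper[OF y1 a(1) a1 that] unfolding A_def e_def \<xi>_def L_def by simp
    have P1: "u \<le> A * e"
    proof -
      have "u * L \<le> (A * e) * L" using ku[of 1] a(3) by simp
      thus ?thesis using L by simp
    qed
    \<comment> \<open>A small \<open>\<xi>\<close> would bound \<open>e\<close>, contradicting
      \<open>u \<le> A * e\<close> for large \<open>u\<close>.\<close>
    have xiX: "\<xi> \<ge> X0"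
    proof (rule ccontr)
      assume "\<not> \<xi> \<ge> X0"
      hence "exp \<xi> \<le> exp X0" by simp
      moreover have "e \<le> exp \<xi> / 1" unfolding e_def using xi1 by (intro divide_left_mono) auto
      ultimately have "e \<le> exp X0" by linarith
      hence "A * e \<le> A * exp X0" using A by (intro mult_left_mono) auto
      thus False using P1 u(3) by linarith
    qed
    have xi: "\<xi> \<ge> \<xi>0" "\<xi> \<ge> 10 * window" "\<xi> \<ge> A" "\<xi> \<ge> 2 * window" "\<xi> > 0" using xiX X0 W xi1 by linarith+
    have kl: "kap j a y \<ge> m * e * L * (L / 2) ^ (j - 1)" if "j \<ge> 1" for j
      using kap_lower[of y a j] y1 a0 a1 xi that unfolding m_def mass_const_def e_def \<xi>_def L_def by simp
    have P2: "m * e \<le> u"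
    proof -
      have "(m * e) * L \<le> u * L" using kl[of 1] a(3) by simp
      thus ?thesis using L by simp
    qed
    have eu: "e \<le> u / m" using P2 m by (simp add: field_simps)
    have ue: "e \<ge> u / A" using P1 A by (simp add: field_simps)
    have kU: "kap j a y \<le> K1 * u * L ^ j" if "1 \<le> j" "j \<le> 4" for j
    proof -
      have "A * e \<le> A * (u / m)" using eu A by (intro mult_left_mono) auto
      hence "A * e * L ^ j \<le> A * (u / m) * L ^ j" using L by (intro mult_right_mono) auto
      thus ?thesis using ku[OF that] by (simp add: K1_def)
    qed
    have k2L: "kap 2 a y \<ge> k2 * u * L\<^sup>2"
    proof -
      have "k2 * u * L\<^sup>2 = m * (u / A) * L * (L / 2)" by (simp add: k2_def power2_eq_square)
      also have "\<dots> \<le> m * e * L * (L / 2)" using ue m L by (intro mult_right_mono mult_left_mono) auto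
      also have "\<dots> \<le> kap 2 a y" using kl[of 2] by simp
      finally show ?thesis .
    qed
    define \<sigma> where "\<sigma> = sqrt (kap 2 a y)"
    have kpos: "kap 2 a y > 0" by (rule kap_2_pos[OF y2 a0])
    have s: "\<sigma> > 0" "\<sigma>\<^sup>2 = kap 2 a y" using kpos by (auto simp: \<sigma>_def)
    have su: "\<sigma>\<^sup>2 \<ge> u"
    proof -
      have "(1 / sqrt k2)\<^sup>2 \<le> L\<^sup>2" using L k2 by (intro power_mono) auto
      hence "1 / k2 \<le> L\<^sup>2" using k2 by (simp add: power_divide)
      hence "1 \<le> k2 * L\<^sup>2" using k2 by (simp add: field_simps)
      hence "u * 1 \<le> u * (k2 * L\<^sup>2)" using u by (intro mult_left_mono) auto
      thus ?thesis using k2L s by (simp add: mult_ac)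
    qed
    have sL: "\<sigma> \<le> sqrt K1 * sqrt u * L"
    proof -
      have "\<sigma> \<le> sqrt (K1 * u * L\<^sup>2)" unfolding \<sigma>_def using kU[of 2] by simp
      also have "\<dots> = sqrt K1 * sqrt u * L" using L by (simp add: real_sqrt_mult)
      finally show ?thesis .
    qed
    define \<beta> where "\<beta> = - kap 3 a y / 6"
    define \<gamma> where "\<gamma> = kap 4 a y / 24"
    define \<tau> where "\<tau> = c / L"
    \<comment> \<open>Chosen so that \<open>T1^2 / (4 * u^2)\<close> equals \<open>u / 4\<close>:
      beyond \<open>T1\<close> the smoothing factor is exponentially small in
      \<open>u\<close>.\<close>
    define T1 where "T1 = u powr (3/2)"
    \<comment> \<open>The decay supplied by \<open>top_primes_decay\<close>:
      \<open>\<rho>^2 / 4 * (m / 2 * e)\<close> with \<open>\<rho> = 1 / \<xi>^2\<close>.\<close>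
    define \<delta> where "\<delta> = exp (- (m / 8 * (e / \<xi> ^ 4)))"
    have k3: "0 \<le> kap 3 a y" and k4: "0 \<le> kap 4 a y"
    proof -
      have nn: "0 \<le> m * e * L * (L / 2) ^ (j - 1)" for j using m e0 L by simp
      show "0 \<le> kap 3 a y" by (rule order_trans[OF nn kl]) simp
      show "0 \<le> kap 4 a y" by (rule order_trans[OF nn kl]) simp
    qed
    have b: "\<beta>\<^sup>2 \<le> K * \<sigma> ^ 6 / u"
    proof -
      have "\<beta>\<^sup>2 = (kap 3 a y)\<^sup>2 / 36" by (simp add: \<beta>_def power_divide)
      also have "\<dots> \<le> (K1 * u * L ^ 3)\<^sup>2 / 36" using kU[of 3] k3 by (intro divide_right_mono power_mono) auto
      also have "\<dots> = (K1\<^sup>2 / (36 * k2 ^ 3)) * (k2 * u * L\<^sup>2) ^ 3 / u"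
        using u k2 by (simp add: power_mult_distrib power2_eq_square power3_eq_cube field_simps)
      also have "\<dots> \<le> K * (\<sigma>\<^sup>2) ^ 3 / u"
        using Kge k2L s u L k2 by (intro divide_right_mono mult_mono power_mono) auto
      also have "(\<sigma>\<^sup>2) ^ 3 = \<sigma> ^ 6" by (simp flip: power_mult)
      finally show ?thesis .
    qed
    have g0: "0 \<le> \<gamma>" using k4 by (simp add: \<gamma>_def)
    have g: "\<gamma> \<le> K * \<sigma> ^ 4 / u"
    proof -
      have "\<gamma> \<le> K1 * u * L ^ 4 / 24" using kU[of 4] by (simp add: \<gamma>_def)
      also have "\<dots> = (K1 / (24 * k2\<^sup>2)) * (k2 * u * L\<^sup>2) ^ 2 / u"
        using u k2 by (simp add: power_mult_distrib power2_eq_square power4_eq_xxxx field_simps)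
      also have "\<dots> \<le> K * (\<sigma>\<^sup>2) ^ 2 / u"
        using Kge k2L s u L k2 by (intro divide_right_mono mult_mono power_mono) auto
      also have "(\<sigma>\<^sup>2) ^ 2 = \<sigma> ^ 4" by (simp flip: power_mult)
      finally show ?thesis .
    qed
    have tau0: "\<tau> > 0" using c L by (simp add: \<tau>_def)
    have tau1: "\<gamma> * \<tau>\<^sup>2 \<le> \<sigma>\<^sup>2 / 4"
    proof -
      have "\<gamma> * \<tau>\<^sup>2 \<le> (K1 * u * L ^ 4 / 24) * \<tau>\<^sup>2" using kU[of 4] by (intro mult_right_mono) (auto simp: \<gamma>_def)
      also have "\<dots> = (K1 * c\<^sup>2) * (u * L\<^sup>2) / 24" using L by (simp add: \<tau>_def power_divide power2_eq_square power4_eq_xxxx)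
      also have "K1 * c\<^sup>2 = 6 * k2" using K1 c by simp
      also have "6 * k2 * (u * L\<^sup>2) / 24 = k2 * u * L\<^sup>2 / 4" by simp
      also have "\<dots> \<le> \<sigma>\<^sup>2 / 4" using k2L s by simp
      finally show ?thesis .
    qed
    have tau2: "\<sigma>\<^sup>2 * \<tau>\<^sup>2 \<ge> u / K"
    proof -
      have kc: "k2 * c\<^sup>2 > 0" using k2 c(1) by simp
      have "u / K \<le> u / (1 / (k2 * c\<^sup>2))" using Kge kc u by (intro divide_left_mono mult_pos_pos) auto
      also have "\<dots> = (k2 * u * L\<^sup>2) * \<tau>\<^sup>2" using L by (simp add: \<tau>_def power_divide)
      also have "\<dots> \<le> \<sigma>\<^sup>2 * \<tau>\<^sup>2" using k2L s by (intro mult_right_mono) auto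
      finally show ?thesis .
    qed
    have x0: "x > 0" using xy y2 by linarith
    have lnx: "ln x = u * L" using x y1 by (simp add: ln_powr L_def)
    have k1x: "kap 1 a y = ln x" using a(3) lnx by simp
    obtain M where M: "real_distribution M" and ch: "\<And>t. char M t = exp (levy_exponent a y t)"
      and Psi: "Psi_G x y = 4 * x powr a * H_G a y * (\<integral>z. indicator {..0} z * exp (a * z) \<partial>M)"
      using tilted_distribution[OF y2 a0 x0 k1x] by blast
    have near: "\<forall>t. \<bar>t\<bar> \<le> \<tau> \<longrightarrow> (\<exists>R. cmod R \<le> \<gamma> * t ^ 4 \<and> char M t = exp (- (\<sigma>\<^sup>2 * t\<^sup>2 / 2) + \<i> * (\<beta> * t ^ 3) + R))"
    proof (intro allI impI)
      fix t
      obtain R where "cmod R \<le> kap 4 a y / 24 * t ^ 4"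
        "levy_exponent a y t = - (kap 2 a y * t\<^sup>2 / 2) + \<i> * ((- kap 3 a y / 6) * t ^ 3) + R"
        using levy_exponent_expansion[OF a0] by blast
      thus "\<exists>R. cmod R \<le> \<gamma> * t ^ 4 \<and> char M t = exp (- (\<sigma>\<^sup>2 * t\<^sup>2 / 2) + \<i> * (\<beta> * t ^ 3) + R)"
        unfolding ch s(2) \<beta>_def \<gamma>_def by (intro exI[of _ R]) simp
    qed
    define v where "v = L * (1 - window / \<xi>)"
    have v9: "v \<ge> 9/10 * L"
    proof -
      have "window / \<xi> \<le> 1/10" using xi by (simp add: field_simps)
      hence "L * (9/10) \<le> L * (1 - window / \<xi>)" using L by (intro mult_left_mono) auto
      thus ?thesis by (simp add: v_def)
    qed
    have v4: "exp v \<ge> 4"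
    proof -
      have "exp (9/10 * L) \<le> exp v" using v9 by simp
      thus ?thesis using YY by linarith
    qed
    have far0: "cmod (char M t) \<le> \<delta>" if t: "\<tau> \<le> t" "t \<le> T1" for t
    proof -
      have t0: "t > 0" using t tau0 by linarith
      \<comment> \<open>From \<open>u \<le> A * e\<close> and \<open>A \<le> \<xi>\<close>. It
        brings \<open>T1\<close> below \<open>exp (2 * \<xi>)\<close>, the range of the decay
        condition.\<close>
      have u2: "u \<le> exp \<xi>"
      proof -
        have "A * e \<le> \<xi> * e" using xi e0 by (intro mult_right_mono) auto
        also have "\<xi> * e = exp \<xi>" using xi by (simp add: e_def)
        finally show ?thesis using P1 by linarith
      qed
      have "T1 \<le> exp \<xi> powr (3/2)" unfolding T1_def using u2 u by (intro powr_mono2) auto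
      also have "\<dots> = exp (3/2 * \<xi>)" by (simp add: powr_def)
      also have "\<dots> \<le> exp (2 * \<xi>)" using xi by simp
      finally have t2: "t \<le> exp (2 * \<xi>)" using t by linarith
      have hv: "2 * (1 / \<xi>\<^sup>2) / t * exp v \<ge> 1"
      proof -
        have "t * \<xi>\<^sup>2 \<le> exp (3/4 * L) * L\<^sup>2"
          using t u34 xiL xi L t0 by (intro mult_mono power_mono) (auto simp: T1_def)
        also have "\<dots> \<le> exp (9/10 * L)" using YY by (simp add: mult.commute)
        also have "\<dots> \<le> exp v" using v9 by simp
        finally have "t * \<xi>\<^sup>2 \<le> 2 * exp v" using exp_gt_zero[of v] by linarith
        thus ?thesis using t0 xi by (simp add: field_simps)
      qed
      have cond: "144 * (window + 2 * \<xi> / (t * L)) * (1 / \<xi>\<^sup>2) * (1 + ln (1 + t / (2 * (1 / \<xi>\<^sup>2)))) \<le> mass_const / 2"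
        using t xi xiL t2 by (intro dc) (auto simp: \<tau>_def)
      have "(1 / \<xi>\<^sup>2)\<^sup>2 / 4 * (mass_const / 2 * (exp \<xi> / \<xi>)) \<le>
         (\<Sum>p\<in>top_primes v y. (1 + chi4 p) * real p powr (- a) * (1 - cos (t * ln (real p))))"
        using top_primes_decay[OF y1 a(1) a1 _ t0] xi v4 hv cond unfolding v_def \<xi>_def L_def by blast
      also have "(1 / \<xi>\<^sup>2)\<^sup>2 / 4 * (mass_const / 2 * (exp \<xi> / \<xi>)) = m / 8 * (e / \<xi> ^ 4)"
        by (simp add: m_def e_def power_divide flip: power_mult)
      finally have "Re (levy_exponent a y t) \<le> - (m / 8 * (e / \<xi> ^ 4))"
        using Re_levy_exponent_le[OF a0, of y t v] by linarith
      thus ?thesis unfolding ch norm_exp_eq_Re \<delta>_def by simp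
    qed
    interpret M: real_distribution M by (rule M)
    have far: "\<forall>t. \<tau> \<le> \<bar>t\<bar> \<longrightarrow> \<bar>t\<bar> \<le> T1 \<longrightarrow> cmod (char M t) \<le> \<delta>"
    proof (intro allI impI)
      fix t assume t: "\<tau> \<le> \<bar>t\<bar>" "\<bar>t\<bar> \<le> T1"
      \<comment> \<open>Decay was shown for positive \<open>t\<close> only; the characteristic
        function of a real law at \<open>- t\<close> is the complex conjugate of its value at
        \<open>t\<close>.\<close>
      have "cmod (char M t) = cmod (char M \<bar>t\<bar>)"
      proof (cases "t \<ge> 0")
        case False
        have "char M (- t) = cnj (char M t)"
        proof -
          have "char M (- t) = (CLINT x|M. cnj (iexp (t * x)))"
            unfolding char_def by (intro Bochner_Integration.integral_cong refl) (simp add: exp_cnj)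
          also have "\<dots> = cnj (char M t)" unfolding char_def by (rule Bochner_Integration.integral_cnj)
          finally show ?thesis .
        qed
        thus ?thesis using False by simp
      qed simp
      thus "cmod (char M t) \<le> \<delta>" using far0[OF t] by simp
    qed
    \<comment> \<open>All quantities are compared in terms of \<open>u\<close> alone:
      \<open>\<xi> \<le> 2 * ln (u / m)\<close> gives a decay exponent of order at least
      \<open>u / (ln (u / m))^4\<close>, and \<open>L \<le> exp (sqrt u)\<close> bounds
      \<open>\<sigma>\<close>.\<close>
    have T1d: "T1 * \<delta> \<le> 1 / (u * \<sigma>)"
    proof -
      have "exp (\<xi> / 2) \<le> e"
      proof -
        have "exp (\<xi> / 2) * \<xi> \<le> exp (\<xi> / 2) * exp (\<xi> / 2)" by (intro mult_left_mono le_exp_half) simp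
        also have "\<dots> = exp \<xi>" by (simp flip: exp_add)
        finally show ?thesis using xi by (simp add: e_def field_simps)
      qed
      hence "exp (\<xi> / 2) \<le> u / m" using eu by linarith
      hence "ln (exp (\<xi> / 2)) \<le> ln (u / m)" using u m by (subst ln_le_cancel_iff) auto
      hence xl: "\<xi> \<le> 2 * ln (u / m)" by simp
      have "u / (2 * ln (u / m)) ^ 4 \<le> u / \<xi> ^ 4"
        using xl xi u by (intro divide_left_mono power_mono mult_pos_pos) auto
      also have "\<dots> \<le> (A * e) / \<xi> ^ 4" using P1 xi by (intro divide_right_mono) auto
      finally have "m / (8 * A) * (u / (2 * ln (u / m)) ^ 4) \<le> m / (8 * A) * ((A * e) / \<xi> ^ 4)"
        using m A by (intro mult_left_mono) auto
      also have "\<dots> = m / 8 * (e / \<xi> ^ 4)" using A by simp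
      finally have ee: "exp (m / (8 * A) * (u / (2 * ln (u / m)) ^ 4)) \<le> exp (m / 8 * (e / \<xi> ^ 4))" by simp
      have "T1 * (u * \<sigma>) \<le> u powr (3/2) * (u * (sqrt K1 * sqrt u * exp (sqrt u)))"
        unfolding T1_def
      proof (intro mult_left_mono)
        have "sqrt K1 * sqrt u * L \<le> sqrt K1 * sqrt u * exp (sqrt u)" using K1 u by (intro mult_left_mono lnL) auto
        thus "\<sigma> \<le> sqrt K1 * sqrt u * exp (sqrt u)" using sL by linarith
      qed (use u in auto)
      also have "\<dots> = sqrt K1 * (u powr (3/2) * u * sqrt u) * exp (sqrt u)" by simp
      also have "u powr (3/2) * u * sqrt u = u ^ 3"
      proof -
        have "u powr (3/2) * u * sqrt u = u powr (3/2) * u powr 1 * u powr (1/2)" using u by (simp add: powr_half_sqrt)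
        also have "\<dots> = u powr 3" by (simp only: powr_add[symmetric]) simp
        also have "\<dots> = u ^ 3" using powr_realpow[of u 3] u by simp
        finally show ?thesis .
      qed
      also have "sqrt K1 * u ^ 3 * exp (sqrt u) \<le> exp (m / (8 * A) * (u / (2 * ln (u / m)) ^ 4))" by (rule U(1)[OF uU])
      finally have "T1 * (u * \<sigma>) \<le> exp (m / 8 * (e / \<xi> ^ 4))" using ee by linarith
      hence "T1 * (u * \<sigma>) * \<delta> \<le> exp (m / 8 * (e / \<xi> ^ 4)) * \<delta>" by (intro mult_right_mono) (auto simp: \<delta>_def)
      also have "\<dots> = 1" by (simp add: \<delta>_def flip: exp_add)
      finally have "(T1 * \<delta>) * (u * \<sigma>) \<le> 1" by (simp add: mult_ac)
      moreover have "u * \<sigma> > 0" using u s by simp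
      ultimately show ?thesis by (simp only: pos_le_divide_eq)
    qed
    have tail: "exp (- (T1\<^sup>2 / (4 * u\<^sup>2))) \<le> 1 / (u\<^sup>2 * \<sigma>)"
    proof -
      have "T1\<^sup>2 = u powr 3" unfolding T1_def by (simp add: power2_eq_square flip: powr_add)
      also have "\<dots> = u ^ 3" using powr_realpow[of u 3] u by simp
      finally have "T1\<^sup>2 / (4 * u\<^sup>2) = u / 4" using u by (simp add: power2_eq_square power3_eq_cube)
      moreover have "u\<^sup>2 * \<sigma> \<le> exp (u / 4)"
      proof -
        have "sqrt K1 * sqrt u * L \<le> sqrt K1 * sqrt u * exp (sqrt u)" using K1 u by (intro mult_left_mono lnL) auto
        hence "u\<^sup>2 * \<sigma> \<le> u\<^sup>2 * (sqrt K1 * sqrt u * exp (sqrt u))" using sL by (intro mult_left_mono) auto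
        thus ?thesis using U(2)[OF uU] by linarith
      qed
      moreover have "u\<^sup>2 * \<sigma> > 0" using u s by simp
      ultimately have "1 / exp (u / 4) \<le> 1 / (u\<^sup>2 * \<sigma>)" using u s by (intro divide_left_mono mult_pos_pos) auto
      thus ?thesis using \<open>T1\<^sup>2 / (4 * u\<^sup>2) = u / 4\<close> by (simp only: exp_minus inverse_eq_divide)
    qed
    define E0 where "E0 = (\<integral>z. indicator {..0} z * exp (a * z) \<partial>M)"
    define E where "E = E0 * (a * \<sigma> * sqrt (2 * pi)) - 1"
    have "\<bar>E\<bar> \<le> C / u" unfolding E_def E0_def
    proof (rule main[OF M a(1) _ u(2,1) s(1) su b g0 g tau0 tau1 tau2])
      show "a \<le> 1" using a1 by simp
      show "\<exists>R. cmod R \<le> \<gamma> * t ^ 4 \<and> char M t = exp (- (\<sigma>\<^sup>2 * t\<^sup>2 / 2) + \<i> * (\<beta> * t ^ 3) + R)" if "\<bar>t\<bar> \<le> \<tau>" for t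
        using near that by blast
      show "cmod (char M t) \<le> \<delta>" if "\<tau> \<le> \<bar>t\<bar>" "\<bar>t\<bar> \<le> T1" for t using far that by blast
      show "0 \<le> T1" "0 \<le> \<delta>" by (simp_all add: T1_def \<delta>_def)
    qed (rule T1d, rule tail)
    moreover have "alpha_G x y = a" by (rule alpha_G_eqI[OF y2 a0 k1x])
    moreover have "phi_G_deriv 2 a y = \<sigma>\<^sup>2" using phi_G_deriv_eq(2)[of y a] y2 a0 s by simp
    moreover have "4 * x powr a * H_G a y / (a * sqrt (2 * pi * \<sigma>\<^sup>2)) * (1 + E) = Psi_G x y"
    proof -
      define D where "D = a * \<sigma> * sqrt (2 * pi)"
      have D: "D \<noteq> 0" using a0 s by (simp add: D_def)
      have "a * sqrt (2 * pi * \<sigma>\<^sup>2) = D" using s(1) by (simp add: D_def real_sqrt_mult)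
      moreover have "1 + E = E0 * D" by (simp add: E_def D_def)
      ultimately show ?thesis unfolding Psi E0_def[symmetric] using D by simp
    qed
    ultimately show "\<exists>E :: real. \<bar>E\<bar> \<le> C * (1 / u) \<and>
              Psi_G x y =
                4 * x powr (alpha_G x y) * H_G (alpha_G x y) y
                  / (alpha_G x y * sqrt (2 * pi * phi_G_deriv 2 (alpha_G x y) y))
                  * (1 + E)"
      by (intro exI[of _ E]) simp
  qed
qed

end
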